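(* Let $\mathbf M$ and $\mathbf N$ be non-trivial total structures (not necessarily of the same type) and let $\widetilde{\mathbf M}$ and $\widetilde{\mathbf N}$ be total structures with topology that are alter egos of $\mathbf M$ and $\mathbf N$, respectively. Put $\mathcal A=\mathbb{ISP}(\mathbf M)$, $\mathcal X=\mathbb{IS}_c\mathbb P^+(\widetilde{\mathbf M})$, $\mathcal B=\mathbb{ISP}(\mathbf N)$, $\mathcal Y=\mathbb{IS}_c\mathbb P^+(\widetilde{\mathbf N})$. Assume that $\widetilde{\mathbf N}$ fully dualises $\mathbf N$, that $\widetilde{\mathbf N}$ is injective in $\mathcal Y$ and that $\mathbf N$ is injective in $\mathcal B$. Assume that $\mathbf M$ and $\widetilde{\mathbf M}$ have structural reducts $\mathbf M^\flat$ in $\mathcal B$ and $\widetilde{\mathbf M}^\flat$ in $\mathcal Y$, respectively, and let $\omega\in\mathcal B(\mathbf M^\flat,\mathbf N)\cap\mathcal Y(\widetilde{\mathbf M}^\flat,\widetilde{\mathbf N})$. Assume that one of the following sets of conditions (I), (II), (III) holds. (I) (1) $\mathbf N$ is a total algebra and $\widetilde{\mathbf N}=\langle N;G^\nu,R^\nu,\mathcal T\rangle$; and (2) (i) $\omega\circ\mathrm{Clo}_1(\widetilde{\mathbf M})$ separates the points of $M$, (ii) $\omega\circ\mathrm{Clo}_1(\mathbf M)$ separates the structure $\widetilde{\mathbf M}^\flat$, and (iii) $\widetilde{\mathbf M}$ entails every relation in $\max_{\mathbf M}\{\omega\}^{-1}(r)$, for each $r\in R^\nu$. (II) (1) $\mathbf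 N=\langle N;G^\nu,R^\nu\rangle$ and $\widetilde{\mathbf N}$ is a total algebra (with topology); and (2) (i) $\omega\circ\mathrm{Clo}_1(\widetilde{\mathbf M})$ separates the structure $\mathbf M^\flat$, (ii) $\omega\circ\mathrm{Clo}_1(\mathbf M)$ separates the points of $M$, and (iii) if $R^\nu\neq\varnothing$, then the operations in the type of $\widetilde{\mathbf M}$ are continuous and $\mathbf M$ entails every relation in $\max_{\widetilde{\mathbf M}}\{\omega\}^{-1}(r)$, for each $r\in R^\nu$. (III) (1) Both $\mathbf N$ and $\widetilde{\mathbf N}$ are total algebras (the latter with topology); and (2) (i) $\omega\circ\mathrm{Clo}_1(\widetilde{\mathbf M})$ separates the points of $M$, and (ii) $\omega\circ\mathrm{Clo}_1(\mathbf M)$ separates the points of $M$. Then: (a) $\widetilde{\mathbf M}$ fully dualises $\mathbf M$; (b) $\mathbf M$ is injective in $\mathcal A$ and $\widetilde{\mathbf M}$ is injective in $\mathcal X$, and consequently the duality is strong; (c) for all $\mathbf A\in\mathcal A$ and all $\mathbf X\in\mathcal X$, $\mathrm D(\mathbf A)^\flat\cong\mathrm H(\mathbf A^\flat)$ in $\mathcal Y$ and $\mathrm E(\mathbf X)^\flat\cong\mathrm K(\mathbf X^\flat)$ in $\mathcal B$, via the maps $\Phi_\omega^{\mathbf A}\colon\mathcal A(\mathbf A,\mathbf M)\to\mathcal B(\mathbf A^\flat,\mathbf N)$, $x\mapsto\omega\circ x$, and $\Psi_\omega^{\mathbf X}\colon\mathcal X(\mathbf X,\widetilde{\mathbf M})\to\mathcal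 Y(\mathbf X^\flat,\widetilde{\mathbf N})$, $\alpha\mapsto\omega\circ\alpha$, respectively.
   Context: **Structures.** A total structure is $\mathbf M=\langle M;G,R\rangle$ with $M$ a non-empty set, $G$ a set of finitary operations (nullary allowed) and $R$ a set of finitary non-empty relations on $M$; $G$ or $R$ may be empty. It is a total algebra if $R=\varnothing$; non-trivial means having more than one element. Operations and relations are lifted pointwise to powers. A substructure ($\le$) is a subset closed under the operations, with the restricted relations; substructures of structures without topology are non-empty. Homomorphisms preserve all operations and relations. A total structure with topology $\widetilde{\mathbf M}=\langle M;G,R,\mathcal T\rangle$ also carries a compact Hausdorff topology $\mathcal T$ on $M$ (no compatibility of structure and topology is assumed); purely structural notions applied to $\widetilde{\mathbf M}$ (term functions, substructures of $\widetilde{\mathbf M}^n$, separation of the structure, etc.) refer to the structure with the topology removed. **Classes.** $\mathbb{ISP}(\mathbf M)$ is the category of all (non-empty) structures isomorphic to substructures of powers of $\mathbf M$, with homomorphisms as morphisms. $\mathbb{IS}_c\mathbb P^+(\widetilde{\mathbf M})$ is the category of all structures with topology isomorphic to topologically closed substructures of powers $\widetilde{\mathbf M}^S$ with $S\neq\varnothing$ (product topology), with continuous homomorphisms as morphisms; the empty structure belongs to it if the type of $\widetilde{\mathbf M}$ has no nullary operations. $\mathcal C(\mathbf A,\mathbf B)$ denotes the set of morphisms in a category $\mathcal C$. Embeddings are isomorphisms onto substructures in $\mathbb{ISP}(\mathbf M)$ and isomorphisms onto topologically closed substructures in $\mathbb{IS}_c\mathbb P^+(\widetilde{\mathbf M})$;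 injectivity is with respect to these embeddings. **Alter egos.** $\widetilde{\mathbf M}=\langle M;G_2,R_2,\mathcal T\rangle$ is an alter ego of $\mathbf M=\langle M;G_1,R_1\rangle$ if each $n$-ary $r\in R_2$ forms a substructure of $\mathbf M^n$, each $n$-ary $g\in G_2$ is a homomorphism $\mathbf M^n\to\mathbf M$, each relation in $R_1$ is topologically closed and each operation in $G_1$ is continuous with respect to $\mathcal T$. **Dualities.** Let $\widetilde{\mathbf M}$ be an alter ego of $\mathbf M$, $\mathcal A=\mathbb{ISP}(\mathbf M)$, $\mathcal X=\mathbb{IS}_c\mathbb P^+(\widetilde{\mathbf M})$. For $\mathbf A\in\mathcal A$, $\mathcal A(\mathbf A,\mathbf M)$ is a closed substructure of $\widetilde{\mathbf M}^A$, giving $\mathrm D(\mathbf A)\in\mathcal X$; for $\mathbf X\in\mathcal X$, $\mathcal X(\mathbf X,\widetilde{\mathbf M})$ is a substructure of $\mathbf M^X$, giving $\mathrm E(\mathbf X)\in\mathcal A$. The evaluation maps are $e_{\mathbf A}\colon\mathbf A\to\mathrm{ED}(\mathbf A)$, $e_{\mathbf A}(a)(x)=x(a)$, and $\varepsilon_{\mathbf X}\colon\mathbf X\to\mathrm{DE}(\mathbf X)$, $\varepsilon_{\mathbf X}(x)(\alpha)=\alpha(x)$. $\widetilde{\mathbf M}$ dualises $\mathbf M$ if $e_{\mathbf A}$ is an isomorphism for all $\mathbf A\in\mathcal A$; it co-dualises $\mathbf M$ if $\varepsilon_{\mathbf X}$ is an isomorphism for all $\mathbf X\in\mathcal X$;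 it fully dualises $\mathbf M$ if both hold. A full duality is strong if moreover $\widetilde{\mathbf M}$ is injective in $\mathcal X$. For $\mathbf N,\widetilde{\mathbf N}$ the corresponding hom-functors are $\mathrm H(\mathbf B)=\mathcal B(\mathbf B,\mathbf N)\le\widetilde{\mathbf N}^B$ and $\mathrm K(\mathbf Y)=\mathcal Y(\mathbf Y,\widetilde{\mathbf N})\le\mathbf N^Y$. **Term functions and separation.** $\mathrm{Clo}_1(\cdot)$ is the set of unary term functions; $\omega\circ\mathcal E=\{\omega\circ u\mid u\in\mathcal E\}$. A set $Z$ of maps from $A$ to $N$ separates the points of $A$ if for all $a\ne b$ in $A$ some $z\in Z$ has $z(a)\neq z(b)$; it separates the structure $\mathbf A$ (where $\mathbf A$ and the structure on $N$ have the same type) if it separates the points and, for every $n$-ary relation symbol $r$ of the type and $(a_1,\dots,a_n)\notin r$ in $\mathbf A$, some $z\in Z$ has $(z(a_1),\dots,z(a_n))\notin r$ in $N$. (For $\mathbf M^\flat$ the relations on $N$ are those of $\mathbf N$, for $\widetilde{\mathbf M}^\flat$ those of $\widetilde{\mathbf N}$.) **Structural reducts.** $\langle M;G',R'\rangle$ is a structural reduct of $\langle M;G,R\rangle$ if each operation in $G'$ is a term function of $\langle M;G,R\rangle$ (a nullary term function if nullary) and each relation in $R'$ is conjunct-atomic definable, i.e. is the set of tuples satisfying a finite conjunction of atomic formulas in the language $\langle G,R\rangle$ (with equality). "$\mathbf M$ has a structural reduct $\mathbf M^\flat$ in $\mathcal B=\mathbb{ISP}(\mathbf N)$" means $\mathbf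 M^\flat$ is a structural reduct of the type of $\mathbf N$ with $\mathbf M^\flat\in\mathcal B$; then each $\mathbf A\in\mathcal A$ has a reduct $\mathbf A^\flat\in\mathcal B$ given by the same terms and formulas. "$\widetilde{\mathbf M}$ has a structural reduct $\widetilde{\mathbf M}^\flat$ in $\mathcal Y=\mathbb{IS}_c\mathbb P^+(\widetilde{\mathbf N})$" means that $\widetilde{\mathbf M}^\flat$, of the type of $\widetilde{\mathbf N}$ and with the same topology as $\widetilde{\mathbf M}$, has underlying structure a structural reduct of that of $\widetilde{\mathbf M}$, and $\widetilde{\mathbf M}^\flat\in\mathcal Y$; then each $\mathbf X\in\mathcal X$ has a reduct $\mathbf X^\flat\in\mathcal Y$ likewise. **Maximal relations and entailment.** For $r\subseteq N^n$, $\max_{\mathbf M}\{\omega\}^{-1}(r)$ is the set of all $s\subseteq M^n$ forming a substructure of $\mathbf M^n$ that is maximal (among substructures) in $\{(a_1,\dots,a_n)\in M^n\mid(\omega(a_1),\dots,\omega(a_n))\in r\}$; $\max_{\widetilde{\mathbf M}}\{\omega\}^{-1}(r)$ is defined likewise using $\widetilde{\mathbf M}$ with its topology removed in place of $\mathbf M$. $\widetilde{\mathbf M}$ entails $r\subseteq M^n$ if $r$ forms a substructure of $\mathbf M^n$ and, for all $\mathbf A\in\mathcal A$, every $\mathcal X$-morphism $\alpha\colon\mathcal A(\mathbf A,\mathbf M)\to\widetilde{\mathbf M}$ preserves $r$ (lifted pointwise). $\mathbf M$ entails $r\subseteq M^n$ if $r$ forms a topologically closed substructure of $\widetilde{\mathbf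 M}^n$ and, for all $\mathbf X\in\mathcal X$, every $\mathcal A$-morphism $u\colon\mathcal X(\mathbf X,\widetilde{\mathbf M})\to\mathbf M$ preserves $r$ (lifted pointwise). *)

theory Defs
  imports "HOL-Analysis.Analysis"
begin

section \<open>Structures\<close>

text \<open>An \<open>n\<close>-tuple over \<open>A\<close> is an extensional function on \<open>{..<n}\<close>, so that the
  set of \<open>n\<close>-tuples over \<open>M\<close> is literally the carrier of the power of \<open>M\<close> with index
  set \<open>{..<n}\<close>. The image of a tuple \<open>t\<close> under \<open>h\<close> is \<open>compose {..<n} h t\<close>.\<close>

abbreviation tuples :: "nat \<Rightarrow> 'a set \<Rightarrow> (nat \<Rightarrow> 'a) set" where
  "tuples n A \<equiv> {..<n} \<rightarrow>\<^sub>E A"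

record ('f, 'r) signature =
  opsyms :: "'f set"
  relsyms :: "'r set"
  oarity :: "'f \<Rightarrow> nat"
  rarity :: "'r \<Rightarrow> nat"

record ('a, 'f, 'r) struct =
  carrier :: "'a set"
  fun_of :: "'f \<Rightarrow> (nat \<Rightarrow> 'a) \<Rightarrow> 'a"
  rel_of :: "'r \<Rightarrow> (nat \<Rightarrow> 'a) set"

record ('a, 'f, 'r) top_struct = "('a, 'f, 'r) struct" +
  topo :: "'a topology"

text \<open>Purely structural notions are defined on the record scheme; applied to a structure with
  topology they ignore the topology.\<close>

definition is_structure :: "('f, 'r) signature \<Rightarrow> ('a, 'f, 'r, 'z) struct_scheme \<Rightarrow> bool" where
  "is_structure S A \<longleftrightarrow>
     (\<forall>f\<in>opsyms S. \<forall>xs\<in>tuples (oarity S f) (carrier A). fun_of A f xs \<in> carrier A) \<and>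
     (\<forall>r\<in>relsyms S. rel_of A r \<subseteq> tuples (rarity S r) (carrier A))"

definition is_top_structure :: "('f, 'r) signature \<Rightarrow> ('a, 'f, 'r) top_struct \<Rightarrow> bool" where
  "is_top_structure S X \<longleftrightarrow> is_structure S X \<and> topspace (topo X) = carrier X"

definition total_structure :: "('f, 'r) signature \<Rightarrow> ('a, 'f, 'r, 'z) struct_scheme \<Rightarrow> bool" where
  "total_structure S M \<longleftrightarrow>
     is_structure S M \<and> carrier M \<noteq> {} \<and> (\<forall>r\<in>relsyms S. rel_of M r \<noteq> {})"

definition total_top_structure :: "('f, 'r) signature \<Rightarrow> ('a, 'f, 'r) top_struct \<Rightarrow> bool" where
  "total_top_structure S M \<longleftrightarrow>
     total_structure S M \<and> is_top_structure S M \<and>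
     compact_space (topo M) \<and> Hausdorff_space (topo M)"

definition nontrivial :: "('a, 'f, 'r, 'z) struct_scheme \<Rightarrow> bool" where
  "nontrivial A \<longleftrightarrow> (\<exists>a\<in>carrier A. \<exists>b\<in>carrier A. a \<noteq> b)"

definition algebra_type :: "('f, 'r) signature \<Rightarrow> bool" where
  "algebra_type S \<longleftrightarrow> relsyms S = {}"

definition power_str ::
  "('f, 'r) signature \<Rightarrow> ('a, 'f, 'r, 'z) struct_scheme \<Rightarrow> 'i set \<Rightarrow> ('i \<Rightarrow> 'a, 'f, 'r) struct" where
  "power_str S M I =
     \<lparr>carrier = I \<rightarrow>\<^sub>E carrier M,
      fun_of = (\<lambda>f xs. \<lambda>i\<in>I. fun_of M f (\<lambda>k\<in>{..<oarity S f}. xs k i)),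
      rel_of = (\<lambda>r. {xs \<in> tuples (rarity S r) (I \<rightarrow>\<^sub>E carrier M).
                     \<forall>i\<in>I. (\<lambda>k\<in>{..<rarity S r}. xs k i) \<in> rel_of M r})\<rparr>"

definition add_topology :: "('a, 'f, 'r) struct \<Rightarrow> 'a topology \<Rightarrow> ('a, 'f, 'r) top_struct" where
  "add_topology A T = \<lparr>carrier = carrier A, fun_of = fun_of A, rel_of = rel_of A, topo = T\<rparr>"

definition top_power_str ::
  "('f, 'r) signature \<Rightarrow> ('a, 'f, 'r) top_struct \<Rightarrow> 'i set \<Rightarrow> ('i \<Rightarrow> 'a, 'f, 'r) top_struct" where
  "top_power_str S M I = add_topology (power_str S M I) (product_topology (\<lambda>_. topo M) I)"

text \<open>The empty set is closed under the operations iff there are no nullary operations. Substructures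
  of structures without topology are non-empty, whereas topologically closed substructures of
  structures with topology may be empty.\<close>

definition op_closed :: "('f, 'r) signature \<Rightarrow> ('a, 'f, 'r, 'z) struct_scheme \<Rightarrow> 'a set \<Rightarrow> bool" where
  "op_closed S B T \<longleftrightarrow>
     T \<subseteq> carrier B \<and> (\<forall>f\<in>opsyms S. \<forall>xs\<in>tuples (oarity S f) T. fun_of B f xs \<in> T)"

definition is_substructure ::
  "('f, 'r) signature \<Rightarrow> ('a, 'f, 'r, 'z) struct_scheme \<Rightarrow> 'a set \<Rightarrow> bool" where
  "is_substructure S B T \<longleftrightarrow> op_closed S B T \<and> T \<noteq> {}"

definition is_closed_substructure ::
  "('f, 'r) signature \<Rightarrow> ('a, 'f, 'r) top_struct \<Rightarrow> 'a set \<Rightarrow> bool" where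
  "is_closed_substructure S Y T \<longleftrightarrow> op_closed S Y T \<and> closedin (topo Y) T"

definition sub_str ::
  "('f, 'r) signature \<Rightarrow> ('a, 'f, 'r, 'z) struct_scheme \<Rightarrow> 'a set \<Rightarrow> ('a, 'f, 'r) struct" where
  "sub_str S B T =
     \<lparr>carrier = T, fun_of = fun_of B, rel_of = (\<lambda>r. rel_of B r \<inter> tuples (rarity S r) T)\<rparr>"

definition top_sub_str ::
  "('f, 'r) signature \<Rightarrow> ('a, 'f, 'r) top_struct \<Rightarrow> 'a set \<Rightarrow> ('a, 'f, 'r) top_struct" where
  "top_sub_str S Y T = add_topology (sub_str S Y T) (subtopology (topo Y) T)"


section \<open>Morphisms and the two categories\<close>

definition homs ::
  "('f, 'r) signature \<Rightarrow> ('a, 'f, 'r, 'y) struct_scheme \<Rightarrow> ('b, 'f, 'r, 'z) struct_scheme \<Rightarrow>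
   ('a \<Rightarrow> 'b) set" where
  "homs S A B =
     {h \<in> carrier A \<rightarrow>\<^sub>E carrier B.
        (\<forall>f\<in>opsyms S. \<forall>xs\<in>tuples (oarity S f) (carrier A).
           h (fun_of A f xs) = fun_of B f (compose {..<oarity S f} h xs)) \<and>
        (\<forall>r\<in>relsyms S. \<forall>xs\<in>rel_of A r. compose {..<rarity S r} h xs \<in> rel_of B r)}"

definition cont_homs ::
  "('f, 'r) signature \<Rightarrow> ('a, 'f, 'r) top_struct \<Rightarrow> ('b, 'f, 'r) top_struct \<Rightarrow>
   ('a \<Rightarrow> 'b) set" where
  "cont_homs S X Y = {h \<in> homs S X Y. continuous_map (topo X) (topo Y) h}"

definition str_iso ::
  "('f, 'r) signature \<Rightarrow> ('a, 'f, 'r) struct \<Rightarrow> ('b, 'f, 'r) struct \<Rightarrow> ('a \<Rightarrow> 'b) \<Rightarrow> bool" where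
  "str_iso S A B h \<longleftrightarrow>
     h \<in> homs S A B \<and>
     (\<exists>g\<in>homs S B A. (\<forall>a\<in>carrier A. g (h a) = a) \<and> (\<forall>b\<in>carrier B. h (g b) = b))"

definition top_iso ::
  "('f, 'r) signature \<Rightarrow> ('a, 'f, 'r) top_struct \<Rightarrow> ('b, 'f, 'r) top_struct \<Rightarrow>
   ('a \<Rightarrow> 'b) \<Rightarrow> bool" where
  "top_iso S X Y h \<longleftrightarrow>
     h \<in> cont_homs S X Y \<and>
     (\<exists>g\<in>cont_homs S Y X. (\<forall>x\<in>carrier X. g (h x) = x) \<and> (\<forall>y\<in>carrier Y. h (g y) = y))"

definition str_embedding ::
  "('f, 'r) signature \<Rightarrow> ('a, 'f, 'r) struct \<Rightarrow> ('b, 'f, 'r) struct \<Rightarrow> ('a \<Rightarrow> 'b) \<Rightarrow> bool" where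
  "str_embedding S A B h \<longleftrightarrow> (\<exists>T. is_substructure S B T \<and> str_iso S A (sub_str S B T) h)"

definition top_embedding ::
  "('f, 'r) signature \<Rightarrow> ('a, 'f, 'r) top_struct \<Rightarrow> ('b, 'f, 'r) top_struct \<Rightarrow>
   ('a \<Rightarrow> 'b) \<Rightarrow> bool" where
  "top_embedding S X Y h \<longleftrightarrow>
     (\<exists>T. is_closed_substructure S Y T \<and> top_iso S X (top_sub_str S Y T) h)"

text \<open>\<open>ISP S M\<close> and \<open>IScP S M\<close> consist of the members whose carrier is a set of elements of a
  type \<open>'u\<close>. Quantification over the whole class amounts to quantification over all types \<open>'u\<close>, which
  HOL offers only at the outermost level of a theorem; therefore every notion below that
  quantifies over a class takes the type of the elements of the carriers as an argument
  \<open>u :: 'u itself\<close>. As a hypothesis, such a notion is asserted for one sufficiently large type, and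
  as a conclusion for an arbitrary type.

  The exponents are sets of elements of \<open>'u \<Rightarrow> 'm\<close>. This is no restriction: the lemmas
  \<open>ISP_any_exponent\<close> and \<open>IScP_any_exponent\<close> show that an isomorphic copy of a (closed)
  substructure of a power with an exponent of any type is a member.\<close>

definition ISP ::
  "('f, 'r) signature \<Rightarrow> ('m, 'f, 'r) struct \<Rightarrow> ('u, 'f, 'r) struct set" where
  "ISP S M =
     {A. is_structure S A \<and> carrier A \<noteq> {} \<and>
         (\<exists>(I :: ('u \<Rightarrow> 'm) set) h. str_embedding S A (power_str S M I) h)}"

definition IScP ::
  "('f, 'r) signature \<Rightarrow> ('m, 'f, 'r) top_struct \<Rightarrow> ('u, 'f, 'r) top_struct set" where
  "IScP S M =
     {X. is_top_structure S X \<and>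
         (\<exists>(I :: ('u \<Rightarrow> 'm) set) h. I \<noteq> {} \<and> top_embedding S X (top_power_str S M I) h)}"

definition injective_in_ISP ::
  "'u itself \<Rightarrow> ('f, 'r) signature \<Rightarrow> ('m, 'f, 'r) struct \<Rightarrow> bool" where
  "injective_in_ISP u S M \<longleftrightarrow>
     (\<forall>A \<in> (ISP S M :: ('u, 'f, 'r) struct set).
      \<forall>B \<in> (ISP S M :: ('u, 'f, 'r) struct set).
      \<forall>h. str_embedding S A B h \<longrightarrow>
        (\<forall>x\<in>homs S A M. \<exists>y\<in>homs S B M. \<forall>a\<in>carrier A. y (h a) = x a))"

definition injective_in_IScP ::
  "'u itself \<Rightarrow> ('f, 'r) signature \<Rightarrow> ('m, 'f, 'r) top_struct \<Rightarrow> bool" where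
  "injective_in_IScP u S M \<longleftrightarrow>
     (\<forall>X \<in> (IScP S M :: ('u, 'f, 'r) top_struct set).
      \<forall>Y \<in> (IScP S M :: ('u, 'f, 'r) top_struct set).
      \<forall>h. top_embedding S X Y h \<longrightarrow>
        (\<forall>\<alpha>\<in>cont_homs S X M. \<exists>\<beta>\<in>cont_homs S Y M. \<forall>x\<in>carrier X. \<beta> (h x) = \<alpha> x))"


section \<open>Alter egos and dualities\<close>

definition op_continuous ::
  "('a, 'f, 'r, 'z) struct_scheme \<Rightarrow> 'a topology \<Rightarrow> ('f, 'r) signature \<Rightarrow> 'f \<Rightarrow> bool" where
  "op_continuous M T S f \<longleftrightarrow>
     continuous_map (product_topology (\<lambda>_. T) {..<oarity S f}) T (fun_of M f)"

definition alter_ego ::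
  "('f1, 'r1) signature \<Rightarrow> ('m, 'f1, 'r1) struct \<Rightarrow>
   ('f2, 'r2) signature \<Rightarrow> ('m, 'f2, 'r2) top_struct \<Rightarrow> bool" where
  "alter_ego S1 M S2 M2 \<longleftrightarrow>
     carrier M2 = carrier M \<and>
     (\<forall>r\<in>relsyms S2. is_substructure S1 (power_str S1 M {..<rarity S2 r}) (rel_of M2 r)) \<and>
     (\<forall>g\<in>opsyms S2. restrict (fun_of M2 g) (tuples (oarity S2 g) (carrier M))
                       \<in> homs S1 (power_str S1 M {..<oarity S2 g}) M) \<and>
     (\<forall>r\<in>relsyms S1.
        closedin (product_topology (\<lambda>_. topo M2) {..<rarity S1 r}) (rel_of M r)) \<and>
     (\<forall>f\<in>opsyms S1. op_continuous M (topo M2) S1 f)"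

definition Dual ::
  "('f1, 'r1) signature \<Rightarrow> ('m, 'f1, 'r1) struct \<Rightarrow>
   ('f2, 'r2) signature \<Rightarrow> ('m, 'f2, 'r2) top_struct \<Rightarrow>
   ('u, 'f1, 'r1) struct \<Rightarrow> ('u \<Rightarrow> 'm, 'f2, 'r2) top_struct" where
  "Dual S1 M S2 M2 A = top_sub_str S2 (top_power_str S2 M2 (carrier A)) (homs S1 A M)"

definition Codual ::
  "('f1, 'r1) signature \<Rightarrow> ('m, 'f1, 'r1) struct \<Rightarrow>
   ('f2, 'r2) signature \<Rightarrow> ('m, 'f2, 'r2) top_struct \<Rightarrow>
   ('u, 'f2, 'r2) top_struct \<Rightarrow> ('u \<Rightarrow> 'm, 'f1, 'r1) struct" where
  "Codual S1 M S2 M2 X = sub_str S1 (power_str S1 M (carrier X)) (cont_homs S2 X M2)"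

definition eval_alg ::
  "('f1, 'r1) signature \<Rightarrow> ('m, 'f1, 'r1) struct \<Rightarrow>
   ('u, 'f1, 'r1) struct \<Rightarrow> 'u \<Rightarrow> ('u \<Rightarrow> 'm) \<Rightarrow> 'm" where
  "eval_alg S1 M A = (\<lambda>a\<in>carrier A. \<lambda>x\<in>homs S1 A M. x a)"

definition eval_top ::
  "('f2, 'r2) signature \<Rightarrow> ('m, 'f2, 'r2) top_struct \<Rightarrow>
   ('u, 'f2, 'r2) top_struct \<Rightarrow> 'u \<Rightarrow> ('u \<Rightarrow> 'm) \<Rightarrow> 'm" where
  "eval_top S2 M2 X = (\<lambda>x\<in>carrier X. \<lambda>\<alpha>\<in>cont_homs S2 X M2. \<alpha> x)"

definition dualises ::
  "'u itself \<Rightarrow> ('f1, 'r1) signature \<Rightarrow> ('m, 'f1, 'r1) struct \<Rightarrow>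
   ('f2, 'r2) signature \<Rightarrow> ('m, 'f2, 'r2) top_struct \<Rightarrow> bool" where
  "dualises u S1 M S2 M2 \<longleftrightarrow>
     (\<forall>A \<in> (ISP S1 M :: ('u, 'f1, 'r1) struct set).
        str_iso S1 A (Codual S1 M S2 M2 (Dual S1 M S2 M2 A)) (eval_alg S1 M A))"

definition codualises ::
  "'u itself \<Rightarrow> ('f1, 'r1) signature \<Rightarrow> ('m, 'f1, 'r1) struct \<Rightarrow>
   ('f2, 'r2) signature \<Rightarrow> ('m, 'f2, 'r2) top_struct \<Rightarrow> bool" where
  "codualises u S1 M S2 M2 \<longleftrightarrow>
     (\<forall>X \<in> (IScP S2 M2 :: ('u, 'f2, 'r2) top_struct set).
        top_iso S2 X (Dual S1 M S2 M2 (Codual S1 M S2 M2 X)) (eval_top S2 M2 X))"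

definition fully_dualises ::
  "'u itself \<Rightarrow> ('f1, 'r1) signature \<Rightarrow> ('m, 'f1, 'r1) struct \<Rightarrow>
   ('f2, 'r2) signature \<Rightarrow> ('m, 'f2, 'r2) top_struct \<Rightarrow> bool" where
  "fully_dualises u S1 M S2 M2 \<longleftrightarrow> dualises u S1 M S2 M2 \<and> codualises u S1 M S2 M2"

definition strongly_dualises ::
  "'u itself \<Rightarrow> ('f1, 'r1) signature \<Rightarrow> ('m, 'f1, 'r1) struct \<Rightarrow>
   ('f2, 'r2) signature \<Rightarrow> ('m, 'f2, 'r2) top_struct \<Rightarrow> bool" where
  "strongly_dualises u S1 M S2 M2 \<longleftrightarrow>
     fully_dualises u S1 M S2 M2 \<and> injective_in_IScP u S2 M2"


section \<open>Terms, conjunct-atomic formulas and structural reducts\<close>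

datatype 'f trm = Var nat | App 'f "'f trm list"

datatype ('f, 'r) atom = Eq "'f trm" "'f trm" | Rel 'r "'f trm list"

fun wf_trm :: "('f, 'r) signature \<Rightarrow> nat \<Rightarrow> 'f trm \<Rightarrow> bool" where
  "wf_trm S n (Var i) \<longleftrightarrow> i < n"
| "wf_trm S n (App f ts) \<longleftrightarrow>
     f \<in> opsyms S \<and> length ts = oarity S f \<and> (\<forall>t\<in>set ts. wf_trm S n t)"

fun wf_atom :: "('f, 'r) signature \<Rightarrow> nat \<Rightarrow> ('f, 'r) atom \<Rightarrow> bool" where
  "wf_atom S n (Eq s t) \<longleftrightarrow> wf_trm S n s \<and> wf_trm S n t"
| "wf_atom S n (Rel r ts) \<longleftrightarrow>
     r \<in> relsyms S \<and> length ts = rarity S r \<and> (\<forall>t\<in>set ts. wf_trm S n t)"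

definition list_tuple :: "'a list \<Rightarrow> nat \<Rightarrow> 'a" where
  "list_tuple xs = (\<lambda>k\<in>{..<length xs}. xs ! k)"

fun eval_trm :: "('a, 'f, 'r, 'z) struct_scheme \<Rightarrow> (nat \<Rightarrow> 'a) \<Rightarrow> 'f trm \<Rightarrow> 'a" where
  "eval_trm A v (Var i) = v i"
| "eval_trm A v (App f ts) = fun_of A f (list_tuple (map (eval_trm A v) ts))"

fun holds_atom :: "('a, 'f, 'r, 'z) struct_scheme \<Rightarrow> (nat \<Rightarrow> 'a) \<Rightarrow> ('f, 'r) atom \<Rightarrow> bool" where
  "holds_atom A v (Eq s t) \<longleftrightarrow> eval_trm A v s = eval_trm A v t"
| "holds_atom A v (Rel r ts) \<longleftrightarrow> list_tuple (map (eval_trm A v) ts) \<in> rel_of A r"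

definition Clo1 :: "('f, 'r) signature \<Rightarrow> ('a, 'f, 'r, 'z) struct_scheme \<Rightarrow> ('a \<Rightarrow> 'a) set" where
  "Clo1 S A = {\<lambda>a\<in>carrier A. eval_trm A (\<lambda>k\<in>{..<1}. a) t | t. wf_trm S 1 t}"

text \<open>A structural reduct is given by a choice of a term for every operation symbol and of a finite
  conjunction of atomic formulas for every relation symbol of the new type. A nullary
  symbol is interpreted by a variable-free term, i.e. by a nullary term function.\<close>

record ('f, 'r, 'g, 's) interp =
  int_trm :: "'g \<Rightarrow> 'f trm"
  int_fml :: "'s \<Rightarrow> ('f, 'r) atom list"

definition wf_interp ::
  "('f, 'r) signature \<Rightarrow> ('g, 's) signature \<Rightarrow> ('f, 'r, 'g, 's) interp \<Rightarrow> bool" where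
  "wf_interp S S' J \<longleftrightarrow>
     (\<forall>g\<in>opsyms S'. wf_trm S (oarity S' g) (int_trm J g)) \<and>
     (\<forall>s\<in>relsyms S'. \<forall>p\<in>set (int_fml J s). wf_atom S (rarity S' s) p)"

definition reduct ::
  "('g, 's) signature \<Rightarrow> ('f, 'r, 'g, 's) interp \<Rightarrow>
   ('a, 'f, 'r, 'z) struct_scheme \<Rightarrow> ('a, 'g, 's) struct" where
  "reduct S' J A =
     \<lparr>carrier = carrier A,
      fun_of = (\<lambda>g xs. eval_trm A xs (int_trm J g)),
      rel_of = (\<lambda>s. {xs \<in> tuples (rarity S' s) (carrier A).
                     \<forall>p\<in>set (int_fml J s). holds_atom A xs p})\<rparr>"

definition top_reduct ::
  "('g, 's) signature \<Rightarrow> ('f, 'r, 'g, 's) interp \<Rightarrow>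
   ('a, 'f, 'r) top_struct \<Rightarrow> ('a, 'g, 's) top_struct" where
  "top_reduct S' J X = add_topology (reduct S' J X) (topo X)"


section \<open>Separation, maximal relations and entailment\<close>

definition separates_points :: "('a \<Rightarrow> 'b) set \<Rightarrow> 'a set \<Rightarrow> bool" where
  "separates_points Z A \<longleftrightarrow> (\<forall>a\<in>A. \<forall>b\<in>A. a \<noteq> b \<longrightarrow> (\<exists>z\<in>Z. z a \<noteq> z b))"

definition separates_structure ::
  "('f, 'r) signature \<Rightarrow> ('a \<Rightarrow> 'b) set \<Rightarrow>
   ('a, 'f, 'r, 'y) struct_scheme \<Rightarrow> ('b, 'f, 'r, 'z) struct_scheme \<Rightarrow> bool" where
  "separates_structure S Z A N \<longleftrightarrow>
     separates_points Z (carrier A) \<and>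
     (\<forall>r\<in>relsyms S. \<forall>xs \<in> tuples (rarity S r) (carrier A) - rel_of A r.
        \<exists>z\<in>Z. compose {..<rarity S r} z xs \<notin> rel_of N r)"

definition max_rels ::
  "('f, 'r) signature \<Rightarrow> ('a, 'f, 'r, 'z) struct_scheme \<Rightarrow> ('a \<Rightarrow> 'b) \<Rightarrow>
   nat \<Rightarrow> (nat \<Rightarrow> 'b) set \<Rightarrow> (nat \<Rightarrow> 'a) set set" where
  "max_rels S M \<omega> n r =
     (let P = {a \<in> tuples n (carrier M). compose {..<n} \<omega> a \<in> r} in
      {s. is_substructure S (power_str S M {..<n}) s \<and> s \<subseteq> P \<and>
          (\<forall>s'. is_substructure S (power_str S M {..<n}) s' \<and> s' \<subseteq> P \<and> s \<subseteq> s' \<longrightarrow> s' = s)})"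

definition ego_entails ::
  "'u itself \<Rightarrow> ('f1, 'r1) signature \<Rightarrow> ('m, 'f1, 'r1) struct \<Rightarrow>
   ('f2, 'r2) signature \<Rightarrow> ('m, 'f2, 'r2) top_struct \<Rightarrow> nat \<Rightarrow> (nat \<Rightarrow> 'm) set \<Rightarrow> bool" where
  "ego_entails u S1 M S2 M2 n r \<longleftrightarrow>
     is_substructure S1 (power_str S1 M {..<n}) r \<and>
     (\<forall>A \<in> (ISP S1 M :: ('u, 'f1, 'r1) struct set).
      \<forall>\<alpha>\<in>cont_homs S2 (Dual S1 M S2 M2 A) M2.
      \<forall>xs\<in>tuples n (homs S1 A M).
        (\<forall>a\<in>carrier A. (\<lambda>k\<in>{..<n}. xs k a) \<in> r) \<longrightarrow> compose {..<n} \<alpha> xs \<in> r)"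

definition base_entails ::
  "'u itself \<Rightarrow> ('f1, 'r1) signature \<Rightarrow> ('m, 'f1, 'r1) struct \<Rightarrow>
   ('f2, 'r2) signature \<Rightarrow> ('m, 'f2, 'r2) top_struct \<Rightarrow> nat \<Rightarrow> (nat \<Rightarrow> 'm) set \<Rightarrow> bool" where
  "base_entails u S1 M S2 M2 n r \<longleftrightarrow>
     is_closed_substructure S2 (top_power_str S2 M2 {..<n}) r \<and>
     (\<forall>X \<in> (IScP S2 M2 :: ('u, 'f2, 'r2) top_struct set).
      \<forall>h\<in>homs S1 (Codual S1 M S2 M2 X) M.
      \<forall>xs\<in>tuples n (cont_homs S2 X M2).
        (\<forall>x\<in>carrier X. (\<lambda>k\<in>{..<n}. xs k x) \<in> r) \<longrightarrow> compose {..<n} h xs \<in> r)"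


section \<open>Exponents of arbitrary type\<close>

lemma homsI:
  assumes "\<And>a. a \<in> carrier A \<Longrightarrow> h a \<in> carrier B" "h \<in> extensional (carrier A)"
    and "\<And>f xs. f \<in> opsyms S \<Longrightarrow> xs \<in> tuples (oarity S f) (carrier A) \<Longrightarrow>
           h (fun_of A f xs) = fun_of B f (compose {..<oarity S f} h xs)"
    and "\<And>r xs. r \<in> relsyms S \<Longrightarrow> xs \<in> rel_of A r \<Longrightarrow>
           compose {..<rarity S r} h xs \<in> rel_of B r"
  shows "h \<in> homs S A B"
  using assms by (auto simp: homs_def PiE_iff)

lemma reindex_exponent:
  fixes A :: "('u, 'f, 'r, 'y) struct_scheme" and M :: "('m, 'f, 'r, 'z) struct_scheme"
    and I :: "'i set" and T :: "('i \<Rightarrow> 'm) set"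
    and h :: "'u \<Rightarrow> 'i \<Rightarrow> 'm" and g :: "('i \<Rightarrow> 'm) \<Rightarrow> 'u"
  defines "p \<equiv> \<lambda>i. \<lambda>a\<in>carrier A. h a i"
  defines "J \<equiv> p ` I"
  defines "q \<equiv> \<lambda>z :: ('u \<Rightarrow> 'm) \<Rightarrow> 'm. \<lambda>i\<in>I. z (p i)"
  defines "T' \<equiv> {z \<in> J \<rightarrow>\<^sub>E carrier M. q z \<in> T}"
  defines "k \<equiv> \<lambda>a\<in>carrier A. \<lambda>j\<in>J. j a"
  defines "g' \<equiv> \<lambda>z\<in>T'. g (q z)"
  assumes A: "is_structure S A" and T: "op_closed S (power_str S M I) T"
    and h: "h \<in> homs S A (sub_str S (power_str S M I) T)"
    and g: "g \<in> homs S (sub_str S (power_str S M I) T) A"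
    and gh: "\<forall>a\<in>carrier A. g (h a) = a" and hg: "\<forall>b\<in>T. h (g b) = b"
  shows "op_closed S (power_str S M J) T'"
    and "k \<in> homs S A (sub_str S (power_str S M J) T')"
    and "g' \<in> homs S (sub_str S (power_str S M J) T') A"
    and "\<forall>a\<in>carrier A. g' (k a) = a" and "\<forall>b\<in>T'. k (g' b) = b"
    and "\<forall>a\<in>carrier A. q (k a) = h a"
proof -
  have Tsub: "T \<subseteq> I \<rightarrow>\<^sub>E carrier M"
    using T by (auto simp: op_closed_def power_str_def)
  have Top: "fun_of (power_str S M I) f xs \<in> T"
    if "f \<in> opsyms S" "xs \<in> tuples (oarity S f) T" for f xs
    using T that by (auto simp: op_closed_def)
  have hT: "h a \<in> T" if "a \<in> carrier A" for a
    using h that by (auto simp: homs_def sub_str_def)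
  have gA: "g b \<in> carrier A" if "b \<in> T" for b
    using g that by (auto simp: homs_def sub_str_def)
  have kp: "k a (p i) = h a i" if "a \<in> carrier A" "i \<in> I" for a i
    using that by (auto simp: k_def J_def p_def)
  have qk: "q (k a) = h a" if "a \<in> carrier A" for a
    using hT[OF that] Tsub that by (auto simp: q_def kp fun_eq_iff PiE_iff extensional_def)
  have kT: "k a \<in> T'" if "a \<in> carrier A" for a
  proof -
    have "k a \<in> J \<rightarrow>\<^sub>E carrier M"
      using that hT[OF that] Tsub by (auto simp: J_def k_def p_def PiE_iff)
    then show ?thesis using qk[OF that] hT[OF that] by (auto simp: T'_def)
  qed
  have ext: "x = y" if "x \<in> extensional J" "y \<in> extensional J" "\<And>i. i \<in> I \<Longrightarrow> x (p i) = y (p i)"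
    for x y :: "('u \<Rightarrow> 'm) \<Rightarrow> 'm"
    using that by (intro extensionalityI[of _ J]) (auto simp: J_def)
  have qop: "q (fun_of (power_str S M J) f zs) =
      fun_of (power_str S M I) f (compose {..<oarity S f} q zs)" for f zs
    by (auto simp: q_def power_str_def compose_def J_def fun_eq_iff intro!: arg_cong[where f="fun_of M f"])
  have qtup: "compose {..<n} q zs \<in> tuples n T" if "zs \<in> tuples n T'" for n zs
    using that by (auto simp: compose_def T'_def PiE_iff)
  show "op_closed S (power_str S M J) T'"
    unfolding op_closed_def
  proof (intro conjI ballI)
    show "T' \<subseteq> carrier (power_str S M J)" by (auto simp: T'_def power_str_def)
    fix f zs assume f: "f \<in> opsyms S" and zs: "zs \<in> tuples (oarity S f) T'"
    let ?z = "fun_of (power_str S M J) f zs"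
    have qz: "q ?z \<in> T" using qop Top[OF f qtup[OF zs]] by simp
    have "?z j \<in> carrier M" if j: "j \<in> J" for j
    proof -
      obtain i where i: "i \<in> I" "j = p i" using j by (auto simp: J_def)
      then have "q ?z i = ?z j" by (simp add: q_def)
      moreover have "q ?z i \<in> carrier M" using qz Tsub i by auto
      ultimately show ?thesis by simp
    qed
    moreover have "?z \<in> extensional J" by (simp add: power_str_def)
    ultimately show "?z \<in> T'" using qz by (auto simp: T'_def PiE_iff)
  qed
  show "k \<in> homs S A (sub_str S (power_str S M J) T')"
  proof (rule homsI)
    show "k a \<in> carrier (sub_str S (power_str S M J) T')" if "a \<in> carrier A" for a
      using kT that by (simp add: sub_str_def)
    show "k \<in> extensional (carrier A)" by (simp add: k_def)
  next
    fix f xs assume f: "f \<in> opsyms S" and xs: "xs \<in> tuples (oarity S f) (carrier A)"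
    have fxs: "fun_of A f xs \<in> carrier A" using A f xs by (auto simp: is_structure_def)
    have hf: "h (fun_of A f xs) = fun_of (power_str S M I) f (compose {..<oarity S f} h xs)"
      using h f xs by (auto simp: homs_def sub_str_def)
    show "k (fun_of A f xs) =
        fun_of (sub_str S (power_str S M J) T') f (compose {..<oarity S f} k xs)"
    proof (rule ext)
      show "k (fun_of A f xs) \<in> extensional J" using fxs by (simp add: k_def)
      show "fun_of (sub_str S (power_str S M J) T') f (compose {..<oarity S f} k xs) \<in> extensional J"
        by (simp add: sub_str_def power_str_def)
      fix i assume i: "i \<in> I"
      have "(\<lambda>n\<in>{..<oarity S f}. compose {..<oarity S f} h xs n i) =
            (\<lambda>n\<in>{..<oarity S f}. compose {..<oarity S f} k xs n (p i))"
        using xs i kp by (auto simp: fun_eq_iff compose_def PiE_iff)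
      then show "k (fun_of A f xs) (p i) =
          fun_of (sub_str S (power_str S M J) T') f (compose {..<oarity S f} k xs) (p i)"
        using i kp[OF fxs i] hf by (auto simp: sub_str_def power_str_def J_def)
    qed
  next
    fix r xs assume r: "r \<in> relsyms S" and xs: "xs \<in> rel_of A r"
    have xsA: "xs \<in> tuples (rarity S r) (carrier A)" using A r xs unfolding is_structure_def by blast
    have hr: "compose {..<rarity S r} h xs \<in> rel_of (power_str S M I) r"
      using h r xs by (auto simp: homs_def sub_str_def)
    have tup: "compose {..<rarity S r} k xs \<in> tuples (rarity S r) T'"
      using xsA kT by (auto simp: compose_def PiE_iff)
    have "(\<lambda>n\<in>{..<rarity S r}. compose {..<rarity S r} k xs n (p i)) \<in> rel_of M r" if "i \<in> I" for i
    proof -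
      have "(\<lambda>n\<in>{..<rarity S r}. compose {..<rarity S r} k xs n (p i)) =
            (\<lambda>n\<in>{..<rarity S r}. compose {..<rarity S r} h xs n i)"
        using xsA that kp by (auto simp: fun_eq_iff compose_def PiE_iff)
      then show ?thesis using hr that by (auto simp: power_str_def)
    qed
    moreover have "T' \<subseteq> J \<rightarrow>\<^sub>E carrier M" by (auto simp: T'_def)
    ultimately show "compose {..<rarity S r} k xs \<in> rel_of (sub_str S (power_str S M J) T') r"
      using tup by (auto simp: sub_str_def power_str_def J_def PiE_iff)
  qed
  show "g' \<in> homs S (sub_str S (power_str S M J) T') A"
  proof (rule homsI)
    show "g' b \<in> carrier A" if "b \<in> carrier (sub_str S (power_str S M J) T')" for b
      using gA that by (auto simp: sub_str_def g'_def T'_def)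
    show "g' \<in> extensional (carrier (sub_str S (power_str S M J) T'))"
      by (simp add: g'_def sub_str_def)
  next
    fix f zs assume f: "f \<in> opsyms S"
      and "zs \<in> tuples (oarity S f) (carrier (sub_str S (power_str S M J) T'))"
    then have zs: "zs \<in> tuples (oarity S f) T'" by (simp add: sub_str_def)
    have inT: "fun_of (power_str S M J) f zs \<in> T'"
      using \<open>op_closed S (power_str S M J) T'\<close> f zs by (auto simp: op_closed_def)
    have "g (fun_of (power_str S M I) f (compose {..<oarity S f} q zs)) =
        fun_of A f (compose {..<oarity S f} g (compose {..<oarity S f} q zs))"
      using g f qtup[OF zs] by (auto simp: homs_def sub_str_def)
    moreover have "compose {..<oarity S f} g (compose {..<oarity S f} q zs) =
        compose {..<oarity S f} g' zs"
      using zs by (auto simp: compose_def fun_eq_iff g'_def PiE_iff)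
    ultimately show "g' (fun_of (sub_str S (power_str S M J) T') f zs) =
        fun_of A f (compose {..<oarity S f} g' zs)"
      using inT qop by (simp add: g'_def sub_str_def)
  next
    fix r zs assume r: "r \<in> relsyms S" and zr: "zs \<in> rel_of (sub_str S (power_str S M J) T') r"
    then have zs: "zs \<in> tuples (rarity S r) T'" and
      z: "\<And>j. j \<in> J \<Longrightarrow> (\<lambda>n\<in>{..<rarity S r}. zs n j) \<in> rel_of M r"
      by (auto simp: sub_str_def power_str_def)
    have "(\<lambda>n\<in>{..<rarity S r}. compose {..<rarity S r} q zs n i) \<in> rel_of M r" if "i \<in> I" for i
    proof -
      have "(\<lambda>n\<in>{..<rarity S r}. compose {..<rarity S r} q zs n i) =
            (\<lambda>n\<in>{..<rarity S r}. zs n (p i))"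
        using that by (auto simp: fun_eq_iff compose_def q_def)
      then show ?thesis using z[of "p i"] that by (auto simp: J_def)
    qed
    then have "compose {..<rarity S r} q zs \<in> rel_of (sub_str S (power_str S M I) T) r"
      using qtup[OF zs] Tsub by (auto simp: sub_str_def power_str_def PiE_iff)
    then have "compose {..<rarity S r} g (compose {..<rarity S r} q zs) \<in> rel_of A r"
      using g r by (auto simp: homs_def)
    moreover have "compose {..<rarity S r} g (compose {..<rarity S r} q zs) =
        compose {..<rarity S r} g' zs"
      using zs by (auto simp: compose_def fun_eq_iff g'_def PiE_iff)
    ultimately show "compose {..<rarity S r} g' zs \<in> rel_of A r" by simp
  qed
  show "\<forall>a\<in>carrier A. g' (k a) = a" using kT qk gh by (auto simp: g'_def)
  show "\<forall>a\<in>carrier A. q (k a) = h a" using qk by blast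
  show "\<forall>b\<in>T'. k (g' b) = b"
  proof
    fix b assume b: "b \<in> T'"
    then have qb: "q b \<in> T" by (simp add: T'_def)
    show "k (g' b) = b"
    proof (rule ext)
      show "k (g' b) \<in> extensional J" using b gA[OF qb] by (simp add: k_def g'_def)
      show "b \<in> extensional J" using b by (auto simp: T'_def PiE_iff)
      fix i assume "i \<in> I"
      then show "k (g' b) (p i) = b (p i)"
        using b gA[OF qb] kp hg qb by (simp add: g'_def) (simp add: q_def)
    qed
  qed
qed

lemma ISP_any_exponent:
  fixes A :: "('u, 'f, 'r) struct" and M :: "('m, 'f, 'r) struct" and I :: "'i set"
  assumes A: "is_structure S A" "carrier A \<noteq> {}" and emb: "str_embedding S A (power_str S M I) h"
  shows "A \<in> ISP S M"
proof -
  obtain T g where T: "is_substructure S (power_str S M I) T"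
    and h: "h \<in> homs S A (sub_str S (power_str S M I) T)"
    and g: "g \<in> homs S (sub_str S (power_str S M I) T) A"
    and gh: "\<forall>a\<in>carrier A. g (h a) = a" and hg: "\<forall>b\<in>T. h (g b) = b"
    using emb by (auto simp: str_embedding_def str_iso_def sub_str_def)
  have T': "op_closed S (power_str S M I) T" using T by (simp add: is_substructure_def)
  define J where "J = (\<lambda>i. \<lambda>a\<in>carrier A. h a i) ` I"
  define T' where "T' = {z \<in> J \<rightarrow>\<^sub>E carrier M. (\<lambda>i\<in>I. z (\<lambda>a\<in>carrier A. h a i)) \<in> T}"
  define k where "k = (\<lambda>a\<in>carrier A. \<lambda>j\<in>J. j a)"
  define g' where "g' = (\<lambda>z\<in>T'. g (\<lambda>i\<in>I. z (\<lambda>a\<in>carrier A. h a i)))"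
  note * = reindex_exponent[OF A(1) T' h g gh hg, folded J_def, folded T'_def, folded k_def g'_def]
  have "k a \<in> T'" if "a \<in> carrier A" for a
    using *(2) that by (auto simp: homs_def sub_str_def)
  then have "T' \<noteq> {}" using A(2) by blast
  then have "is_substructure S (power_str S M J) T'"
    using *(1) by (simp add: is_substructure_def)
  moreover have "carrier (sub_str S (power_str S M J) T') = T'" by (simp add: sub_str_def)
  then have "str_iso S A (sub_str S (power_str S M J) T') k"
    unfolding str_iso_def using *(2-5) by metis
  ultimately have "str_embedding S A (power_str S M J) k"
    unfolding str_embedding_def by blast
  then show ?thesis using A unfolding ISP_def by blast
qed

lemma IScP_any_exponent:
  fixes X :: "('u, 'f, 'r) top_struct" and M :: "('m, 'f, 'r) top_struct" and I :: "'i set"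
  assumes X: "is_top_structure S X" and M: "topspace (topo M) = carrier M" and I: "I \<noteq> {}"
    and emb: "top_embedding S X (top_power_str S M I) h"
  shows "X \<in> IScP S M"
proof -
  let ?P = "\<lambda>I. product_topology (\<lambda>_. topo M) I"
  have simps: "homs S Z (top_sub_str S (top_power_str S M K) W) = homs S Z (sub_str S (power_str S M K) W)"
    "homs S (top_sub_str S (top_power_str S M K) W) Z = homs S (sub_str S (power_str S M K) W) Z"
    "op_closed S (top_power_str S M K) W = op_closed S (power_str S M K) W"
    "topo (top_sub_str S (top_power_str S M K) W) = subtopology (product_topology (\<lambda>_. topo M) K) W"
    "topo (top_power_str S M K) = product_topology (\<lambda>_. topo M) K"
    "carrier (top_sub_str S (top_power_str S M K) W) = W"
    for Z :: "('u, 'f, 'r) top_struct" and K :: "'j set" and W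
    by (auto simp: homs_def top_sub_str_def top_power_str_def add_topology_def sub_str_def op_closed_def)
  obtain T g where T: "op_closed S (power_str S M I) T" and clT: "closedin (?P I) T"
    and h: "h \<in> homs S X (sub_str S (power_str S M I) T)"
    and hc: "continuous_map (topo X) (subtopology (?P I) T) h"
    and g: "g \<in> homs S (sub_str S (power_str S M I) T) X"
    and gc: "continuous_map (subtopology (?P I) T) (topo X) g"
    and gh: "\<forall>a\<in>carrier X. g (h a) = a" and hg: "\<forall>b\<in>T. h (g b) = b"
    using emb
    by (auto simp: top_embedding_def top_iso_def is_closed_substructure_def cont_homs_def simps)
  have Xs: "is_structure S X" and Xt: "topspace (topo X) = carrier X"
    using X by (auto simp: is_top_structure_def)
  define p where "p = (\<lambda>i. \<lambda>a\<in>carrier X. h a i)"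
  define J where "J = p ` I"
  define q where "q = (\<lambda>z :: ('u \<Rightarrow> 'm) \<Rightarrow> 'm. \<lambda>i\<in>I. z (p i))"
  define T' where "T' = {z \<in> J \<rightarrow>\<^sub>E carrier M. q z \<in> T}"
  define k where "k = (\<lambda>a\<in>carrier X. \<lambda>j\<in>J. j a)"
  define g' where "g' = (\<lambda>z\<in>T'. g (q z))"
  have p_app: "(\<lambda>a\<in>carrier X. h a i) = p i" for i by (simp add: p_def)
  have q_app: "(\<lambda>i\<in>I. z (p i)) = q z" for z by (simp add: q_def)
  note * = reindex_exponent[OF Xs T h g gh hg,
      unfolded p_app, folded J_def, unfolded q_app, folded T'_def, folded k_def g'_def]
  have kT: "k a \<in> T'" if "a \<in> carrier X" for a
    using *(2) that by (auto simp: homs_def sub_str_def)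
  have qc: "continuous_map (?P J) (?P I) q"
    unfolding q_def
    by (rule continuous_map_componentwise[THEN iffD2])
       (auto simp: J_def intro!: continuous_map_product_projection)
  have "T' = {z \<in> topspace (?P J). q z \<in> T}" by (auto simp: T'_def M)
  then have cl: "closedin (?P J) T'" using closedin_continuous_map_preimage[OF qc clT] by simp
  have "continuous_map (topo X) (?P J) k"
  proof (rule continuous_map_componentwise[THEN iffD2], intro conjI ballI)
    show "k ` topspace (topo X) \<subseteq> extensional J" by (auto simp: k_def Xt)
    fix j assume "j \<in> J"
    then obtain i where i: "i \<in> I" "j = p i" by (auto simp: J_def)
    have "continuous_map (topo X) (topo M) (\<lambda>x. h x i)"
      using hc i by (auto simp: continuous_map_in_subtopology continuous_map_componentwise)
    then show "continuous_map (topo X) (topo M) (\<lambda>x. k x j)"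
      by (rule continuous_map_eq) (use i in \<open>auto simp: Xt k_def p_def J_def\<close>)
  qed
  then have kc: "continuous_map (topo X) (subtopology (?P J) T') k"
    using kT by (auto simp: continuous_map_in_subtopology Xt)
  have "continuous_map (subtopology (?P J) T') (subtopology (?P I) T) q"
    using qc by (auto simp: continuous_map_in_subtopology T'_def intro: continuous_map_from_subtopology)
  then have "continuous_map (subtopology (?P J) T') (topo X) (g \<circ> q)"
    using gc by (rule continuous_map_compose)
  then have g'c: "continuous_map (subtopology (?P J) T') (topo X) g'"
    by (rule continuous_map_eq) (auto simp: g'_def)
  have "top_embedding S X (top_power_str S M J) k"
    unfolding top_embedding_def top_iso_def is_closed_substructure_def cont_homs_def
    unfolding simps using *(1-5) cl kc g'c by blast
  moreover have "J \<noteq> {}" using I by (simp add: J_def)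
  ultimately show ?thesis using X by (auto simp: IScP_def)
qed

end

theory Submission
  imports Defs
begin

text \<open>The separation hypotheses make the sets of maps \<open>\<omega> \<circ> x\<close>, with \<open>x\<close> in \<open>D(A)\<close>, and \<open>\<omega> \<circ> \<alpha>\<close>, with
  \<open>\<alpha>\<close> in \<open>E(X)\<close>, separate the structures \<open>A\<^sup>\<flat>\<close> and \<open>X\<^sup>\<flat>\<close>, and dually make \<open>\<Phi>\<close> and \<open>\<Psi>\<close> embeddings.
  A morphism on \<open>D(A)\<^sup>\<flat>\<close> extends along \<open>\<Phi>\<close> by injectivity, so by the duality for \<open>N\<close> it is \<open>x \<mapsto> \<omega> (x a)\<close> for
  a unique \<open>a\<close>. Thus \<open>A\<^sup>\<flat>\<close> is the codual of \<open>D(A)\<^sup>\<flat>\<close>, and co-duality for \<open>N\<close>, applied to \<open>D(A)\<^sup>\<flat>\<close>, makes \<open>\<Phi>\<close>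
  surjective; \<open>\<Psi>\<close> is treated in the same way with the roles of the two sides exchanged. Applying the
  description of morphisms to \<open>\<omega> \<circ> \<alpha>\<close> for \<open>\<alpha>\<close> on \<open>D(A)\<close>, and removing \<open>\<omega>\<close> by means of the unary term functions,
  gives the duality for \<open>M\<close>; injectivity is pulled back along \<open>\<Phi>\<close> and \<open>\<Psi>\<close>.\<close>

section \<open>Homomorphisms, embeddings and separation\<close>

text \<open>Everything is phrased through \<open>separates_structure\<close>. A homomorphism
  \<open>h\<close> is an embedding iff the singleton \<open>{h}\<close> separates (with topology:
  for compact domain and Hausdorff codomain), membership in the class generated by \<open>M\<close>
  amounts essentially to being separated by the morphisms into \<open>M\<close>, and composites of
  separating families separate. Embeddings into duals, membership of reducts in the classes of
  \<open>N\<close> and the assumptions on \<omega> can thus be chained without handling exponents.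
  The assumptions let \<omega> separate only together with the unary term functions of the partner
  structure. These can be absorbed because terms of \<open>MT\<close> map \<open>D(A)\<close> into
  itself and terms of \<open>M\<close> map \<open>E(X)\<close> into itself. A second obstacle is
  typing: the duality for \<open>N\<close> and both injectivity assumptions are given for one
  carrier type, whereas the argument needs them for \<open>A\<close>, for its dual over
  \<open>M\<close> and for the dual over \<open>N\<close> of its reduct. Isomorphic copies along
  injections of types bridge this gap.\<close>

lemma homs_carrier: "h \<in> homs S A B \<Longrightarrow> a \<in> carrier A \<Longrightarrow> h a \<in> carrier B"
  by (auto simp: homs_def)

lemma homs_ext: "h \<in> homs S A B \<Longrightarrow> h \<in> extensional (carrier A)"
  by (auto simp: homs_def PiE_iff)

lemma homs_fun:
  "h \<in> homs S A B \<Longrightarrow> f \<in> opsyms S \<Longrightarrow> xs \<in> tuples (oarity S f) (carrier A) \<Longrightarrow>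
   h (fun_of A f xs) = fun_of B f (compose {..<oarity S f} h xs)"
  by (auto simp: homs_def)

lemma homs_rel:
  "h \<in> homs S A B \<Longrightarrow> r \<in> relsyms S \<Longrightarrow> xs \<in> rel_of A r \<Longrightarrow>
   compose {..<rarity S r} h xs \<in> rel_of B r"
  by (auto simp: homs_def)

lemma homs_eqI:
  "h \<in> homs S A B \<Longrightarrow> g \<in> homs S A B \<Longrightarrow> (\<And>a. a \<in> carrier A \<Longrightarrow> h a = g a) \<Longrightarrow> h = g"
  by (meson extensionalityI homs_ext)

lemma structure_fun:
  "is_structure S A \<Longrightarrow> f \<in> opsyms S \<Longrightarrow> xs \<in> tuples (oarity S f) (carrier A) \<Longrightarrow>
   fun_of A f xs \<in> carrier A"
  by (auto simp: is_structure_def)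

lemma structure_rel:
  "is_structure S A \<Longrightarrow> r \<in> relsyms S \<Longrightarrow> xs \<in> rel_of A r \<Longrightarrow>
   xs \<in> tuples (rarity S r) (carrier A)"
  unfolding is_structure_def by blast

lemma compose_tuples:
  "(\<And>a. a \<in> A \<Longrightarrow> h a \<in> B) \<Longrightarrow> xs \<in> tuples n A \<Longrightarrow> compose {..<n} h xs \<in> tuples n B"
  by (auto simp: compose_def PiE_iff)

lemma compose_compose_tuples:
  "xs \<in> tuples n A \<Longrightarrow> compose {..<n} (compose A g h) xs = compose {..<n} g (compose {..<n} h xs)"
  by (auto simp: compose_def PiE_iff fun_eq_iff)

lemma compose_cong_tuples:
  "xs \<in> tuples n A \<Longrightarrow> (\<And>a. a \<in> A \<Longrightarrow> g a = h a) \<Longrightarrow> compose {..<n} g xs = compose {..<n} h xs"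
  by (auto simp: compose_def PiE_iff fun_eq_iff)

lemma homs_compose:
  assumes A: "is_structure S A" and h: "h \<in> homs S A B" and g: "g \<in> homs S B C"
  shows "compose (carrier A) g h \<in> homs S A C"
proof (rule homsI)
  show "compose (carrier A) g h a \<in> carrier C" if "a \<in> carrier A" for a
    using that h g by (auto simp: compose_def intro: homs_carrier)
  show "compose (carrier A) g h \<in> extensional (carrier A)" by simp
next
  fix f xs assume f: "f \<in> opsyms S" and xs: "xs \<in> tuples (oarity S f) (carrier A)"
  have "compose {..<oarity S f} h xs \<in> tuples (oarity S f) (carrier B)"
    using h xs by (intro compose_tuples) (auto intro: homs_carrier)
  then show "compose (carrier A) g h (fun_of A f xs) =
      fun_of C f (compose {..<oarity S f} (compose (carrier A) g h) xs)"
    using structure_fun[OF A f xs] homs_fun[OF h f xs] homs_fun[OF g f]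
    by (simp add: compose_compose_tuples[OF xs] compose_eq)
next
  fix r xs assume r: "r \<in> relsyms S" and xs: "xs \<in> rel_of A r"
  show "compose {..<rarity S r} (compose (carrier A) g h) xs \<in> rel_of C r"
    using homs_rel[OF g r homs_rel[OF h r xs]]
    by (simp add: compose_compose_tuples[OF structure_rel[OF A r xs]])
qed

lemma separates_points_singleton: "separates_points {h} A \<longleftrightarrow> inj_on h A"
  by (auto simp: separates_points_def inj_on_def)

lemma separates_structureD:
  assumes "separates_structure S Z A M"
  shows "a \<in> carrier A \<Longrightarrow> b \<in> carrier A \<Longrightarrow> (\<And>z. z \<in> Z \<Longrightarrow> z a = z b) \<Longrightarrow> a = b"
    and "r \<in> relsyms S \<Longrightarrow> xs \<in> tuples (rarity S r) (carrier A) \<Longrightarrow>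
         (\<And>z. z \<in> Z \<Longrightarrow> compose {..<rarity S r} z xs \<in> rel_of M r) \<Longrightarrow> xs \<in> rel_of A r"
proof -
  show "a \<in> carrier A \<Longrightarrow> b \<in> carrier A \<Longrightarrow> (\<And>z. z \<in> Z \<Longrightarrow> z a = z b) \<Longrightarrow> a = b"
    using assms unfolding separates_structure_def separates_points_def by metis
  show "r \<in> relsyms S \<Longrightarrow> xs \<in> tuples (rarity S r) (carrier A) \<Longrightarrow>
         (\<And>z. z \<in> Z \<Longrightarrow> compose {..<rarity S r} z xs \<in> rel_of M r) \<Longrightarrow> xs \<in> rel_of A r"
    using assms unfolding separates_structure_def by (metis DiffI)
qed

lemma separates_structureI:
  assumes "\<And>a b. a \<in> carrier A \<Longrightarrow> b \<in> carrier A \<Longrightarrow> (\<And>z. z \<in> Z \<Longrightarrow> z a = z b) \<Longrightarrow> a = b"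
    and "\<And>r xs. r \<in> relsyms S \<Longrightarrow> xs \<in> tuples (rarity S r) (carrier A) \<Longrightarrow>
         (\<And>z. z \<in> Z \<Longrightarrow> compose {..<rarity S r} z xs \<in> rel_of M r) \<Longrightarrow> xs \<in> rel_of A r"
  shows "separates_structure S Z A M"
  unfolding separates_structure_def separates_points_def
proof (intro conjI ballI impI)
  show "\<exists>z\<in>Z. z a \<noteq> z b" if "a \<in> carrier A" "b \<in> carrier A" "a \<noteq> b" for a b
    using that assms(1) by blast
  show "\<exists>z\<in>Z. compose {..<rarity S r} z xs \<notin> rel_of M r"
    if "r \<in> relsyms S" "xs \<in> tuples (rarity S r) (carrier A) - rel_of A r" for r xs
    using that assms(2)[of r xs] by blast
qed

text \<open>Points and tuples of \<open>A\<close> see only the values on the carrier, so agreement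
  there suffices. This allows arbitrary maps to be replaced by extensional morphisms.\<close>

lemma separates_structure_mono:
  assumes Z: "separates_structure S Z A M"
    and sub: "\<And>z. z \<in> Z \<Longrightarrow> \<exists>z'\<in>Z'. \<forall>a\<in>carrier A. z' a = z a"
  shows "separates_structure S Z' A M"
proof (rule separates_structureI)
  fix a b assume "a \<in> carrier A" "b \<in> carrier A" and eq: "\<And>z. z \<in> Z' \<Longrightarrow> z a = z b"
  then show "a = b" using sub by (intro separates_structureD(1)[OF Z]) metis+
next
  fix r xs assume r: "r \<in> relsyms S" and xs: "xs \<in> tuples (rarity S r) (carrier A)"
    and rel: "\<And>z. z \<in> Z' \<Longrightarrow> compose {..<rarity S r} z xs \<in> rel_of M r"
  show "xs \<in> rel_of A r"
  proof (rule separates_structureD(2)[OF Z r xs])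
    fix z assume "z \<in> Z"
    then obtain z' where "z' \<in> Z'" "\<And>a. a \<in> carrier A \<Longrightarrow> z' a = z a" using sub by blast
    then show "compose {..<rarity S r} z xs \<in> rel_of M r"
      using rel compose_cong_tuples[OF xs] by metis
  qed
qed

text \<open>What holds under all composites holds under every \<open>z\<close> by separation of
  \<open>B\<close>, hence in \<open>A\<close> by separation of \<open>A\<close>. This is how
  separation assumptions about a generating structure are lifted to all members of its
  class.\<close>

lemma separates_structure_compose:
  assumes Z: "separates_structure S Z A B" and W: "separates_structure S W B C"
    and ZB: "\<And>z a. z \<in> Z \<Longrightarrow> a \<in> carrier A \<Longrightarrow> z a \<in> carrier B"
  shows "separates_structure S {compose (carrier A) w z |w z. w \<in> W \<and> z \<in> Z} A C"
proof (rule separates_structureI)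
  fix a b assume ab: "a \<in> carrier A" "b \<in> carrier A"
    and eq: "\<And>y. y \<in> {compose (carrier A) w z |w z. w \<in> W \<and> z \<in> Z} \<Longrightarrow> y a = y b"
  show "a = b"
  proof (rule separates_structureD(1)[OF Z ab])
    fix z assume z: "z \<in> Z"
    show "z a = z b"
    proof (rule separates_structureD(1)[OF W])
      fix w assume "w \<in> W"
      then have "compose (carrier A) w z a = compose (carrier A) w z b" using z eq by blast
      then show "w (z a) = w (z b)" using ab by (simp add: compose_eq)
    qed (use ZB z ab in auto)
  qed
next
  fix r xs assume r: "r \<in> relsyms S" and xs: "xs \<in> tuples (rarity S r) (carrier A)"
    and rel: "\<And>y. y \<in> {compose (carrier A) w z |w z. w \<in> W \<and> z \<in> Z} \<Longrightarrow>
      compose {..<rarity S r} y xs \<in> rel_of C r"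
  show "xs \<in> rel_of A r"
  proof (rule separates_structureD(2)[OF Z r xs])
    fix z assume z: "z \<in> Z"
    show "compose {..<rarity S r} z xs \<in> rel_of B r"
    proof (rule separates_structureD(2)[OF W r])
      show "compose {..<rarity S r} z xs \<in> tuples (rarity S r) (carrier B)"
        using ZB[OF z] xs by (rule compose_tuples)
      fix w assume "w \<in> W"
      then have "compose {..<rarity S r} (compose (carrier A) w z) xs \<in> rel_of C r"
        using z rel by blast
      then show "compose {..<rarity S r} w (compose {..<rarity S r} z xs) \<in> rel_of C r"
        by (simp add: compose_compose_tuples[OF xs])
    qed
  qed
qed

lemma embedding_compose:
  assumes "separates_structure S {h} A B" "separates_structure S {g} B C"
    and "\<And>a. a \<in> carrier A \<Longrightarrow> h a \<in> carrier B"
  shows "separates_structure S {compose (carrier A) g h} A C"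
  using separates_structure_compose[OF assms(1,2)] assms(3) by simp

text \<open>The inverse of a bijective homomorphism may fail to preserve relations; separation by
  \<open>{h}\<close> supplies, besides injectivity, exactly the missing reflection of
  relations.\<close>

lemma inverse_hom:
  assumes A: "is_structure S A" and B: "is_structure S B" and h: "h \<in> homs S A B"
    and sep: "separates_structure S {h} A B" and surj: "h ` carrier A = carrier B"
  obtains g where "g \<in> homs S B A" "\<And>a. a \<in> carrier A \<Longrightarrow> g (h a) = a"
    "\<And>b. b \<in> carrier B \<Longrightarrow> h (g b) = b"
proof -
  have inj: "inj_on h (carrier A)"
    using sep by (simp add: separates_structure_def separates_points_singleton)
  define g where "g = restrict (inv_into (carrier A) h) (carrier B)"
  have gA: "g b \<in> carrier A" if "b \<in> carrier B" for b
    using that surj by (auto simp: g_def inv_into_into)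
  have hg: "h (g b) = b" if "b \<in> carrier B" for b
    using that surj by (simp add: g_def f_inv_into_f)
  have gh: "g (h a) = a" if "a \<in> carrier A" for a
    using that inj surj by (auto simp: g_def)
  have tup: "compose {..<n} g ys \<in> tuples n (carrier A)"
    and hgt: "compose {..<n} h (compose {..<n} g ys) = ys" if "ys \<in> tuples n (carrier B)" for n ys
  proof -
    show "compose {..<n} g ys \<in> tuples n (carrier A)" using gA that by (rule compose_tuples)
    show "compose {..<n} h (compose {..<n} g ys) = ys"
      by (rule ext) (use that hg in \<open>auto simp: compose_def PiE_iff extensional_def\<close>)
  qed
  have "g \<in> homs S B A"
  proof (rule homsI)
    show "g \<in> extensional (carrier B)" by (simp add: g_def)
  next
    fix f ys assume f: "f \<in> opsyms S" and ys: "ys \<in> tuples (oarity S f) (carrier B)"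
    have "h (fun_of A f (compose {..<oarity S f} g ys)) = fun_of B f ys"
      using homs_fun[OF h f tup[OF ys]] hgt[OF ys] by simp
    then show "g (fun_of B f ys) = fun_of A f (compose {..<oarity S f} g ys)"
      using gh structure_fun[OF A f tup[OF ys]] by metis
  next
    fix r ys assume r: "r \<in> relsyms S" and ys: "ys \<in> rel_of B r"
    note t = structure_rel[OF B r ys]
    show "compose {..<rarity S r} g ys \<in> rel_of A r"
      by (rule separates_structureD(2)[OF sep r tup[OF t]]) (use hgt[OF t] ys in auto)
  qed (rule gA)
  then show ?thesis using that gh hg by blast
qed

text \<open>A homomorphic left inverse recovers points and carries relations back; of
  \<open>h\<close> itself only the mapping of carriers is used.\<close>

lemma separates_structure_left_inverse:
  assumes h: "\<And>a. a \<in> carrier A \<Longrightarrow> h a \<in> carrier B"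
    and g: "g \<in> homs S B A" and gh: "\<And>a. a \<in> carrier A \<Longrightarrow> g (h a) = a"
  shows "separates_structure S {h} A B"
proof (rule separates_structureI)
  fix a b assume "a \<in> carrier A" "b \<in> carrier A" "\<And>z. z \<in> {h} \<Longrightarrow> z a = z b"
  then show "a = b" using gh by (metis singletonI)
next
  fix r xs assume r: "r \<in> relsyms S" and xs: "xs \<in> tuples (rarity S r) (carrier A)"
    and rel: "\<And>z. z \<in> {h} \<Longrightarrow> compose {..<rarity S r} z xs \<in> rel_of B r"
  have "compose {..<rarity S r} g (compose {..<rarity S r} h xs) = xs"
    by (rule ext) (use xs gh in \<open>auto simp: compose_def PiE_iff extensional_def\<close>)
  then show "xs \<in> rel_of A r" using homs_rel[OF g r rel[OF singletonI]] by simp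
qed

lemma str_isoI:
  assumes "is_structure S A" "is_structure S B" "h \<in> homs S A B"
    "separates_structure S {h} A B" "carrier B \<subseteq> h ` carrier A"
  shows "str_iso S A B h"
proof -
  have "h ` carrier A = carrier B" using assms(3,5) by (auto intro: homs_carrier)
  from inverse_hom[OF assms(1-4) this] show ?thesis
    using assms(3) unfolding str_iso_def by metis
qed

lemma carrier_sub_str [simp]: "carrier (sub_str S B T) = T"
  and fun_of_sub_str [simp]: "fun_of (sub_str S B T) = fun_of B"
  and rel_of_sub_str: "rel_of (sub_str S B T) r = rel_of B r \<inter> tuples (rarity S r) T"
  by (simp_all add: sub_str_def)

lemma structure_sub_str: "op_closed S B T \<Longrightarrow> is_structure S (sub_str S B T)"
  by (auto simp: op_closed_def is_structure_def rel_of_sub_str)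

lemma homs_sub_str:
  assumes "is_structure S A" "T \<subseteq> carrier B"
  shows "h \<in> homs S A (sub_str S B T) \<longleftrightarrow> h \<in> homs S A B \<and> h ` carrier A \<subseteq> T"
proof
  show "h \<in> homs S A B \<and> h ` carrier A \<subseteq> T" if "h \<in> homs S A (sub_str S B T)"
    using that assms(2) by (auto simp: homs_def rel_of_sub_str PiE_iff)
  assume h: "h \<in> homs S A B \<and> h ` carrier A \<subseteq> T"
  show "h \<in> homs S A (sub_str S B T)"
  proof (rule homsI)
    fix r xs assume "r \<in> relsyms S" "xs \<in> rel_of A r"
    then show "compose {..<rarity S r} h xs \<in> rel_of (sub_str S B T) r"
      using h compose_tuples[OF _ structure_rel[OF assms(1), of r xs], of h T]
      by (auto simp only: rel_of_sub_str image_subset_iff intro: homs_rel)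
  qed (use h in \<open>auto intro: homs_fun homs_ext\<close>)
qed

lemma separates_structure_sub_str:
  assumes "\<And>a. a \<in> carrier A \<Longrightarrow> h a \<in> T"
  shows "separates_structure S {h} A (sub_str S B T) \<longleftrightarrow> separates_structure S {h} A B"
  using assms compose_tuples[of "carrier A" h T]
  by (auto simp: separates_structure_def rel_of_sub_str)

lemma image_op_closed:
  assumes A: "is_structure S A" and h: "h \<in> homs S A B"
  shows "op_closed S B (h ` carrier A)"
  unfolding op_closed_def
proof (intro conjI ballI)
  show "h ` carrier A \<subseteq> carrier B" using h by (auto intro: homs_carrier)
  fix f ys assume f: "f \<in> opsyms S" and ys: "ys \<in> tuples (oarity S f) (h ` carrier A)"
  define xs where "xs = (\<lambda>k\<in>{..<oarity S f}. inv_into (carrier A) h (ys k))"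
  have xs: "xs \<in> tuples (oarity S f) (carrier A)"
    using ys by (auto simp: xs_def PiE_iff inv_into_into)
  have "compose {..<oarity S f} h xs = ys"
    by (rule ext) (use ys in \<open>auto simp: compose_def xs_def PiE_iff extensional_def f_inv_into_f\<close>)
  then have "fun_of B f ys = h (fun_of A f xs)" using homs_fun[OF h f xs] by simp
  then show "fun_of B f ys \<in> h ` carrier A" using structure_fun[OF A f xs] by blast
qed

text \<open>The substructure in the definition of an embedding can be taken to be the image of
  \<open>h\<close>, which is non-empty because \<open>A\<close> is.\<close>

lemma str_embedding_iff:
  assumes A: "is_structure S A" "carrier A \<noteq> {}"
  shows "str_embedding S A B h \<longleftrightarrow> h \<in> homs S A B \<and> separates_structure S {h} A B"
proof
  assume "str_embedding S A B h"
  then obtain T where "is_substructure S B T" and iso: "str_iso S A (sub_str S B T) h"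
    unfolding str_embedding_def by blast
  then have T: "T \<subseteq> carrier B" by (simp add: is_substructure_def op_closed_def)
  from iso obtain g where h: "h \<in> homs S A (sub_str S B T)"
    and g: "g \<in> homs S (sub_str S B T) A" "\<And>a. a \<in> carrier A \<Longrightarrow> g (h a) = a"
    unfolding str_iso_def by blast
  have hT: "h a \<in> T" if "a \<in> carrier A" for a using homs_carrier[OF h that] by simp
  have "separates_structure S {h} A (sub_str S B T)"
    using g by (intro separates_structure_left_inverse) (auto simp: hT)
  then have "separates_structure S {h} A B"
    using separates_structure_sub_str[of A h T S B, OF hT] by simp
  then show "h \<in> homs S A B \<and> separates_structure S {h} A B"
    using h homs_sub_str[OF A(1) T] by simp
next
  assume h: "h \<in> homs S A B \<and> separates_structure S {h} A B"
  let ?T = "h ` carrier A"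
  have cl: "op_closed S B ?T" using image_op_closed[OF A(1) conjunct1[OF h]] .
  then have sub: "?T \<subseteq> carrier B" by (simp add: op_closed_def)
  have "str_iso S A (sub_str S B ?T) h"
    using A h cl sub
    by (intro str_isoI structure_sub_str) (auto simp: homs_sub_str separates_structure_sub_str)
  then show "str_embedding S A B h"
    using cl A by (auto simp: str_embedding_def is_substructure_def)
qed

section \<open>Substructures of powers\<close>

lemma carrier_power_str [simp]: "carrier (power_str S M I) = I \<rightarrow>\<^sub>E carrier M"
  and fun_of_power_str: "fun_of (power_str S M I) f xs =
        (\<lambda>i\<in>I. fun_of M f (\<lambda>k\<in>{..<oarity S f}. xs k i))"
  and rel_of_power_str: "rel_of (power_str S M I) r =
        {xs \<in> tuples (rarity S r) (I \<rightarrow>\<^sub>E carrier M). \<forall>i\<in>I. (\<lambda>k\<in>{..<rarity S r}. xs k i) \<in> rel_of M r}"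
  by (simp_all add: power_str_def)

lemma op_closed_power: "is_structure S M \<Longrightarrow> op_closed S (power_str S M I) (I \<rightarrow>\<^sub>E carrier M)"
  by (auto simp: op_closed_def fun_of_power_str PiE_iff intro!: structure_fun)

lemma structure_power: "is_structure S M \<Longrightarrow> is_structure S (power_str S M I)"
  using op_closed_power[of S M I] by (auto simp: is_structure_def op_closed_def rel_of_power_str)

lemma coordinate_hom:
  assumes "T \<subseteq> I \<rightarrow>\<^sub>E carrier M" "i \<in> I" and T: "op_closed S (power_str S M I) T"
  shows "(\<lambda>t\<in>T. t i) \<in> homs S (sub_str S (power_str S M I) T) M"
proof (rule homsI)
  fix f xs assume "f \<in> opsyms S" "xs \<in> tuples (oarity S f) (carrier (sub_str S (power_str S M I) T))"
  then show "(\<lambda>t\<in>T. t i) (fun_of (sub_str S (power_str S M I) T) f xs) =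
    fun_of M f (compose {..<oarity S f} (\<lambda>t\<in>T. t i) xs)"
    using assms
    by (auto simp: op_closed_def fun_of_power_str compose_def PiE_iff intro!: arg_cong[where f="fun_of M f"])
next
  fix r xs assume "xs \<in> rel_of (sub_str S (power_str S M I) T) r"
  then show "compose {..<rarity S r} (\<lambda>t\<in>T. t i) xs \<in> rel_of M r"
    using assms by (auto simp: rel_of_power_str rel_of_sub_str compose_def PiE_iff cong: restrict_cong)
qed (use assms in auto)

text \<open>Operations and relations of a power are coordinatewise, so the coordinates decide. Maps
  into duals and coduals are built in this way, since their coordinates are known morphisms.\<close>

lemma hom_into_power:
  assumes A: "is_structure S A" and T: "T \<subseteq> I \<rightarrow>\<^sub>E carrier M"
    and h: "h \<in> carrier A \<rightarrow>\<^sub>E T" and hi: "\<And>i. i \<in> I \<Longrightarrow> (\<lambda>a\<in>carrier A. h a i) \<in> homs S A M"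
  shows "h \<in> homs S A (sub_str S (power_str S M I) T)"
proof (rule homsI)
  fix f xs assume f: "f \<in> opsyms S" and xs: "xs \<in> tuples (oarity S f) (carrier A)"
  have fx: "fun_of A f xs \<in> carrier A" using structure_fun[OF A f xs] .
  show "h (fun_of A f xs) = fun_of (sub_str S (power_str S M I) T) f (compose {..<oarity S f} h xs)"
  proof (rule extensionalityI[of _ I])
    show "h (fun_of A f xs) \<in> extensional I" using h T fx by (auto simp: PiE_iff)
    fix i assume i: "i \<in> I"
    have "(\<lambda>a\<in>carrier A. h a i) (fun_of A f xs) =
        fun_of M f (compose {..<oarity S f} (\<lambda>a\<in>carrier A. h a i) xs)"
      using homs_fun[OF hi[OF i] f xs] .
    then have "h (fun_of A f xs) i = fun_of M f (compose {..<oarity S f} (\<lambda>a\<in>carrier A. h a i) xs)"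
      using fx by simp
    also have "compose {..<oarity S f} (\<lambda>a\<in>carrier A. h a i) xs =
        (\<lambda>k\<in>{..<oarity S f}. compose {..<oarity S f} h xs k i)"
      using xs by (auto simp: compose_def PiE_iff fun_eq_iff)
    finally show "h (fun_of A f xs) i =
        fun_of (sub_str S (power_str S M I) T) f (compose {..<oarity S f} h xs) i"
      using i by (simp only: fun_of_power_str fun_of_sub_str restrict_apply' if_True)
  qed (simp add: fun_of_power_str)
next
  fix r xs assume r: "r \<in> relsyms S" and xs: "xs \<in> rel_of A r"
  note xt = structure_rel[OF A r xs]
  have "compose {..<rarity S r} h xs \<in> tuples (rarity S r) T"
    using h xt by (intro compose_tuples) auto
  moreover have "(\<lambda>k\<in>{..<rarity S r}. compose {..<rarity S r} h xs k i) \<in> rel_of M r" if "i \<in> I" for i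
  proof -
    have "(\<lambda>k\<in>{..<rarity S r}. compose {..<rarity S r} h xs k i) =
        compose {..<rarity S r} (\<lambda>a\<in>carrier A. h a i) xs"
      using xt by (auto simp: compose_def PiE_iff fun_eq_iff)
    then show ?thesis using homs_rel[OF hi[OF that] r xs] by simp
  qed
  ultimately show "compose {..<rarity S r} h xs \<in> rel_of (sub_str S (power_str S M I) T) r"
    using T by (auto simp: rel_of_sub_str rel_of_power_str PiE_iff)
qed (use h in \<open>auto simp: PiE_iff\<close>)

lemma coordinates_separate:
  assumes T: "T \<subseteq> I \<rightarrow>\<^sub>E carrier M"
  shows "separates_structure S {\<lambda>t\<in>T. t i |i. i \<in> I} (sub_str S (power_str S M I) T) M"
proof (rule separates_structureI)
  fix a b assume ab: "a \<in> carrier (sub_str S (power_str S M I) T)"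
    "b \<in> carrier (sub_str S (power_str S M I) T)"
    and eq: "\<And>z. z \<in> {\<lambda>t\<in>T. t i |i. i \<in> I} \<Longrightarrow> z a = z b"
  show "a = b"
  proof (rule extensionalityI[of _ I])
    fix i assume "i \<in> I"
    then have "(\<lambda>t\<in>T. t i) a = (\<lambda>t\<in>T. t i) b" using eq by blast
    then show "a i = b i" using ab by simp
  qed (use ab T in \<open>auto simp: PiE_iff\<close>)
next
  fix r xs assume xs: "xs \<in> tuples (rarity S r) (carrier (sub_str S (power_str S M I) T))"
    and rel: "\<And>z. z \<in> {\<lambda>t\<in>T. t i |i. i \<in> I} \<Longrightarrow> compose {..<rarity S r} z xs \<in> rel_of M r"
  have "(\<lambda>k\<in>{..<rarity S r}. xs k i) \<in> rel_of M r" if "i \<in> I" for i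
  proof -
    have "compose {..<rarity S r} (\<lambda>t\<in>T. t i) xs = (\<lambda>k\<in>{..<rarity S r}. xs k i)"
      using xs by (auto simp: compose_def PiE_iff fun_eq_iff)
    moreover have "compose {..<rarity S r} (\<lambda>t\<in>T. t i) xs \<in> rel_of M r" using rel that by blast
    ultimately show ?thesis by simp
  qed
  then show "xs \<in> rel_of (sub_str S (power_str S M I) T) r"
    using xs T by (auto simp: rel_of_sub_str rel_of_power_str PiE_iff)
qed

text \<open>It is enough that some of the coordinates of \<open>h\<close> reproduce a separating
  family; the remaining coordinates are arbitrary.\<close>

lemma embedding_into_power:
  assumes Z: "separates_structure S Z A M" and T: "T \<subseteq> I \<rightarrow>\<^sub>E carrier M"
    and h: "\<And>a. a \<in> carrier A \<Longrightarrow> h a \<in> T"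
    and hi: "\<And>z. z \<in> Z \<Longrightarrow> \<exists>i\<in>I. \<forall>a\<in>carrier A. h a i = z a"
  shows "separates_structure S {h} A (sub_str S (power_str S M I) T)"
proof (rule separates_structureI)
  fix a b assume "a \<in> carrier A" "b \<in> carrier A" "\<And>z. z \<in> {h} \<Longrightarrow> z a = z b"
  then show "a = b" using hi by (metis separates_structureD(1)[OF Z] singletonI)
next
  fix r xs assume r: "r \<in> relsyms S" and xs: "xs \<in> tuples (rarity S r) (carrier A)"
    and rel: "\<And>z. z \<in> {h} \<Longrightarrow> compose {..<rarity S r} z xs \<in> rel_of (sub_str S (power_str S M I) T) r"
  show "xs \<in> rel_of A r"
  proof (rule separates_structureD(2)[OF Z r xs])
    fix z assume "z \<in> Z"
    then obtain i where i: "i \<in> I" and hz: "\<And>a. a \<in> carrier A \<Longrightarrow> h a i = z a" using hi by blast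
    have "(\<lambda>k\<in>{..<rarity S r}. compose {..<rarity S r} h xs k i) \<in> rel_of M r"
      using rel[of h] i by (simp add: rel_of_sub_str rel_of_power_str)
    moreover have "(\<lambda>k\<in>{..<rarity S r}. compose {..<rarity S r} h xs k i) = compose {..<rarity S r} z xs"
      using xs hz by (auto simp: compose_def PiE_iff fun_eq_iff)
    ultimately show "compose {..<rarity S r} z xs \<in> rel_of M r" by simp
  qed
qed

text \<open>From left to right, the coordinate projections composed with the embedding are
  homomorphisms into \<open>M\<close>. Conversely the hom-set itself serves as exponent, with
  evaluation as the embedding. The hom-set may be empty, which corresponds to the empty
  power.\<close>

lemma ISP_iff:
  fixes A :: "('u, 'f, 'r) struct" and M :: "('m, 'f, 'r) struct"
  assumes M: "is_structure S M"
  shows "A \<in> ISP S M \<longleftrightarrow>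
    is_structure S A \<and> carrier A \<noteq> {} \<and> separates_structure S (homs S A M) A M"
    (is "?L \<longleftrightarrow> ?R")
proof
  assume ?L
  then obtain I :: "('u \<Rightarrow> 'm) set" and h where A: "is_structure S A" "carrier A \<noteq> {}"
    and emb: "str_embedding S A (power_str S M I) h" by (auto simp: ISP_def)
  let ?T = "I \<rightarrow>\<^sub>E carrier M" and ?P = "power_str S M I"
  have h: "h \<in> homs S A ?P" "separates_structure S {h} A ?P"
    using emb str_embedding_iff[OF A] by auto
  have hP: "h \<in> homs S A (sub_str S ?P ?T)" "separates_structure S {h} A (sub_str S ?P ?T)"
    using h homs_carrier[OF h(1)] homs_sub_str[OF A(1), of ?T ?P h] separates_structure_sub_str[of A h ?T S ?P]
    by auto
  have "separates_structure S {compose (carrier A) w z |w z. w \<in> {\<lambda>t\<in>?T. t i |i. i \<in> I} \<and> z \<in> {h}} A M"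
    by (rule separates_structure_compose[OF hP(2) coordinates_separate])
       (use homs_carrier[OF hP(1)] in auto)
  then have "separates_structure S (homs S A M) A M"
  proof (rule separates_structure_mono)
    fix y assume "y \<in> {compose (carrier A) w z |w z. w \<in> {\<lambda>t\<in>?T. t i |i. i \<in> I} \<and> z \<in> {h}}"
    then obtain i where "i \<in> I" "y = compose (carrier A) (\<lambda>t\<in>?T. t i) h" by auto
    then have "y \<in> homs S A M"
      using homs_compose[OF A(1) hP(1) coordinate_hom[OF _ _ op_closed_power[OF M]]] by auto
    then show "\<exists>z'\<in>homs S A M. \<forall>a\<in>carrier A. z' a = y a" by blast
  qed
  then show ?R using A by blast
next
  assume R: ?R
  let ?I = "homs S A M" let ?T = "?I \<rightarrow>\<^sub>E carrier M" and ?P = "power_str S M ?I"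
  define k where "k = (\<lambda>a\<in>carrier A. \<lambda>x\<in>?I. x a)"
  have kT: "k a \<in> ?T" if "a \<in> carrier A" for a using that by (auto simp: k_def intro: homs_carrier)
  have "k \<in> homs S A (sub_str S ?P ?T)"
  proof (rule hom_into_power)
    show "k \<in> carrier A \<rightarrow>\<^sub>E ?T" using kT by (auto simp: k_def)
    fix x assume x: "x \<in> ?I"
    then have "(\<lambda>a\<in>carrier A. k a x) = x"
      by (intro extensionalityI[of _ "carrier A"]) (auto simp: k_def homs_ext)
    then show "(\<lambda>a\<in>carrier A. k a x) \<in> homs S A M" using x by simp
  qed (use R in auto)
  moreover have "separates_structure S {k} A (sub_str S ?P ?T)"
    by (rule embedding_into_power[where Z = ?I]) (use R kT in \<open>auto simp: k_def\<close>)
  ultimately have "k \<in> homs S A ?P" "separates_structure S {k} A ?P"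
    using R homs_sub_str[of S A ?T ?P k] separates_structure_sub_str[of A k ?T S ?P] kT by auto
  then have "str_embedding S A ?P k" using R str_embedding_iff by blast
  then show ?L using R by (intro ISP_any_exponent) auto
qed

section \<open>Structures with topology\<close>

lemma add_topology_simps [simp]:
  "carrier (add_topology A T) = carrier A" "fun_of (add_topology A T) = fun_of A"
  "rel_of (add_topology A T) = rel_of A" "topo (add_topology A T) = T"
  by (simp_all add: add_topology_def)

lemma structure_add_topology [simp]:
  "is_structure S (add_topology A T) \<longleftrightarrow> is_structure S A"
  by (simp add: is_structure_def)

lemma homs_add_topology [simp]:
  "homs S (add_topology A T) B = homs S A B" "homs S B (add_topology A T) = homs S B A"
  by (simp_all add: homs_def)

lemma separates_structure_add_topology [simp]:
  "separates_structure S Z (add_topology A T) M \<longleftrightarrow> separates_structure S Z A M"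
  "separates_structure S W M (add_topology A T) \<longleftrightarrow> separates_structure S W M A"
  by (simp_all add: separates_structure_def)

lemma cont_homsD:
  "h \<in> cont_homs S X Y \<Longrightarrow> h \<in> homs S X Y"
  "h \<in> cont_homs S X Y \<Longrightarrow> continuous_map (topo X) (topo Y) h"
  by (simp_all add: cont_homs_def)

lemma top_structureD:
  "is_top_structure S X \<Longrightarrow> is_structure S X"
  "is_top_structure S X \<Longrightarrow> topspace (topo X) = carrier X"
  by (simp_all add: is_top_structure_def)

lemma total_top_structureD:
  assumes "total_top_structure S M"
  shows "is_structure S M" "carrier M \<noteq> {}" "topspace (topo M) = carrier M"
    "compact_space (topo M)" "Hausdorff_space (topo M)"
  using assms by (auto simp: total_top_structure_def total_structure_def is_top_structure_def)

lemma cont_homs_compose: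
  assumes "is_top_structure S X" "h \<in> cont_homs S X Y" "g \<in> cont_homs S Y Z"
  shows "compose (carrier X) g h \<in> cont_homs S X Z"
proof -
  have "continuous_map (topo X) (topo Z) (g \<circ> h)"
    using assms by (auto simp: cont_homs_def intro: continuous_map_compose)
  then have "continuous_map (topo X) (topo Z) (compose (carrier X) g h)"
    using assms(1) by (auto simp: top_structureD compose_def elim!: continuous_map_eq)
  then show ?thesis
    using assms by (auto simp: cont_homs_def top_structureD intro: homs_compose)
qed

text \<open>A continuous map from a compact space to a Hausdorff space is closed, and the inverse of
  a closed bijection is continuous.\<close>

lemma continuous_inverse:
  assumes "compact_space T" "Hausdorff_space U" "continuous_map T U h" "topspace U = Y"
    and "\<And>x. x \<in> topspace T \<Longrightarrow> g (h x) = x" "\<And>y. y \<in> Y \<Longrightarrow> g y \<in> topspace T \<and> h (g y) = y"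
  shows "continuous_map U T g"
proof -
  have "closed_map T U h" using assms(1-3) by (intro T1_Spaces.continuous_imp_closed_map)
  moreover have "\<And>x. x \<in> topspace T \<Longrightarrow> h x \<in> topspace U"
    using assms(3) by (auto simp: continuous_map_def)
  ultimately show ?thesis
    using closed_eq_continuous_inverse_map[of T h U g] assms(4-6) by blast
qed

lemma inverse_cont_hom:
  assumes X: "is_top_structure S X" "compact_space (topo X)"
    and Y: "is_top_structure S Y" "Hausdorff_space (topo Y)" and h: "h \<in> cont_homs S X Y"
    and sep: "separates_structure S {h} X Y" and surj: "carrier Y \<subseteq> h ` carrier X"
  obtains g where "g \<in> cont_homs S Y X" "\<And>a. a \<in> carrier X \<Longrightarrow> g (h a) = a"
    "\<And>b. b \<in> carrier Y \<Longrightarrow> h (g b) = b"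
proof -
  have "h ` carrier X = carrier Y" using surj homs_carrier[OF cont_homsD(1)[OF h]] by blast
  then obtain g where g: "g \<in> homs S Y X" "\<And>a. a \<in> carrier X \<Longrightarrow> g (h a) = a"
    "\<And>b. b \<in> carrier Y \<Longrightarrow> h (g b) = b"
    using inverse_hom[OF top_structureD(1)[OF X(1)] top_structureD(1)[OF Y(1)] cont_homsD(1)[OF h] sep]
    by metis
  have "continuous_map (topo Y) (topo X) g"
    using g X Y cont_homsD(2)[OF h] homs_carrier[OF g(1)]
    by (intro continuous_inverse[where h = h]) (auto simp: top_structureD)
  then show ?thesis using g that by (simp add: cont_homs_def)
qed

lemma top_isoI:
  assumes "is_top_structure S X" "compact_space (topo X)"
    and "is_top_structure S Y" "Hausdorff_space (topo Y)" "h \<in> cont_homs S X Y"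
    and "separates_structure S {h} X Y" "carrier Y \<subseteq> h ` carrier X"
  shows "top_iso S X Y h"
  using inverse_cont_hom[OF assms] assms(5) unfolding top_iso_def by metis

lemma structure_top_sub_str:
  assumes "is_top_structure S Y" "op_closed S Y T"
  shows "is_top_structure S (top_sub_str S Y T)"
  using assms
  by (auto simp: is_top_structure_def top_sub_str_def structure_sub_str op_closed_def)

text \<open>Compactness of \<open>X\<close> and the Hausdorff property of \<open>Y\<close> make the
  image closed and the bijection onto it a homeomorphism, so continuity is the only topological
  condition that remains.\<close>

lemma top_embedding_iff:
  assumes X: "is_top_structure S X" "compact_space (topo X)"
    and Y: "is_top_structure S Y" "Hausdorff_space (topo Y)"
  shows "top_embedding S X Y h \<longleftrightarrow> h \<in> cont_homs S X Y \<and> separates_structure S {h} X Y"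
proof
  note Xs = top_structureD[OF X(1)]
  assume "top_embedding S X Y h"
  then obtain T where "is_closed_substructure S Y T" and iso: "top_iso S X (top_sub_str S Y T) h"
    unfolding top_embedding_def by blast
  then have T: "T \<subseteq> carrier Y" by (simp add: is_closed_substructure_def op_closed_def)
  from iso obtain g where h: "h \<in> cont_homs S X (top_sub_str S Y T)"
    and "g \<in> cont_homs S (top_sub_str S Y T) X" and gh: "\<And>a. a \<in> carrier X \<Longrightarrow> g (h a) = a"
    unfolding top_iso_def by blast
  then have hh: "h \<in> homs S X (sub_str S Y T)" and g: "g \<in> homs S (sub_str S Y T) X"
    by (simp_all add: cont_homs_def top_sub_str_def)
  have hT: "h a \<in> T" if "a \<in> carrier X" for a using homs_carrier[OF hh that] by simp
  have "separates_structure S {h} X (sub_str S Y T)"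
    using g gh by (intro separates_structure_left_inverse) (auto simp: hT)
  then have "separates_structure S {h} X Y"
    using separates_structure_sub_str[of X h T S Y, OF hT] by simp
  moreover have "continuous_map (topo X) (topo Y) h"
    using h by (simp add: cont_homs_def top_sub_str_def continuous_map_in_subtopology)
  ultimately show "h \<in> cont_homs S X Y \<and> separates_structure S {h} X Y"
    using hh homs_sub_str[OF Xs(1) T] by (simp add: cont_homs_def)
next
  note Xs = top_structureD[OF X(1)]
  assume h: "h \<in> cont_homs S X Y \<and> separates_structure S {h} X Y"
  let ?T = "h ` carrier X"
  have hY: "h \<in> homs S X Y" "continuous_map (topo X) (topo Y) h" using h by (simp_all add: cont_homs_def)
  have cl: "op_closed S Y ?T" using image_op_closed[OF Xs(1) hY(1)] .
  then have sub: "?T \<subseteq> carrier Y" by (simp add: op_closed_def)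
  have "compactin (topo Y) ?T"
    using image_compactin[OF _ hY(2)] X(2) Xs(2) by (metis compact_space_def)
  then have closed: "closedin (topo Y) ?T" using Y(2) compactin_imp_closedin by blast
  have "h \<in> cont_homs S X (top_sub_str S Y ?T)"
    using hY homs_sub_str[OF Xs(1) sub, of h] Xs(2)
    by (simp add: cont_homs_def top_sub_str_def continuous_map_in_subtopology)
  moreover have "separates_structure S {h} X (top_sub_str S Y ?T)"
    using h separates_structure_sub_str[of X h ?T S Y] by (simp add: top_sub_str_def)
  moreover have "Hausdorff_space (topo (top_sub_str S Y ?T))"
    using Y(2) by (simp add: top_sub_str_def Hausdorff_space_subtopology)
  moreover have "carrier (top_sub_str S Y ?T) = ?T" by (simp add: top_sub_str_def)
  ultimately have "top_iso S X (top_sub_str S Y ?T) h"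
    using X structure_top_sub_str[OF Y(1) cl] by (intro top_isoI) auto
  then show "top_embedding S X Y h"
    using cl closed by (auto simp: top_embedding_def is_closed_substructure_def)
qed

lemma top_sub_power:
  "top_sub_str S (top_power_str S M I) T =
     add_topology (sub_str S (power_str S M I) T) (subtopology (product_topology (\<lambda>_. topo M) I) T)"
  by (simp add: top_sub_str_def top_power_str_def sub_str_def)

lemma coordinate_cont_hom:
  assumes "T \<subseteq> I \<rightarrow>\<^sub>E carrier M" "i \<in> I" "op_closed S (power_str S M I) T"
    and top: "topspace (topo M) = carrier M"
  shows "(\<lambda>t\<in>T. t i) \<in> cont_homs S (top_sub_str S (top_power_str S M I) T) M"
proof -
  have "continuous_map (subtopology (product_topology (\<lambda>_. topo M) I) T) (topo M) (\<lambda>t\<in>T. t i)"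
    by (rule continuous_map_eq[where f = "\<lambda>t. t i"])
       (use assms(2) in \<open>auto intro: continuous_map_from_subtopology continuous_map_product_projection\<close>)
  then show ?thesis
    using coordinate_hom[OF assms(1-3)] by (simp add: cont_homs_def top_sub_power)
qed

lemma cont_hom_into_power:
  assumes X: "is_top_structure S X" and T: "T \<subseteq> I \<rightarrow>\<^sub>E carrier M"
    and h: "h \<in> carrier X \<rightarrow>\<^sub>E T"
    and hi: "\<And>i. i \<in> I \<Longrightarrow> (\<lambda>x\<in>carrier X. h x i) \<in> cont_homs S X M"
  shows "h \<in> cont_homs S X (top_sub_str S (top_power_str S M I) T)"
proof -
  note Xs = top_structureD[OF X]
  have "continuous_map (topo X) (product_topology (\<lambda>_. topo M) I) h"
  proof (rule continuous_map_coordinatewise_then_product)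
    fix i assume i: "i \<in> I"
    show "continuous_map (topo X) (topo M) (\<lambda>x. h x i)"
      using cont_homsD(2)[OF hi[OF i]] by (rule continuous_map_eq) (simp add: Xs)
  next
    fix i x assume "i \<notin> I" "x \<in> topspace (topo X)"
    then have "h x \<in> I \<rightarrow>\<^sub>E carrier M" using h T Xs by auto
    then show "h x i = undefined" using \<open>i \<notin> I\<close> by auto
  qed
  then have "continuous_map (topo X) (subtopology (product_topology (\<lambda>_. topo M) I) T) h"
    using h Xs by (auto simp: continuous_map_in_subtopology)
  moreover have "h \<in> homs S X (sub_str S (power_str S M I) T)"
    using cont_homsD(1)[OF hi] by (intro hom_into_power Xs T h)
  ultimately show ?thesis by (simp add: cont_homs_def top_sub_power)
qed

lemma power_top:
  assumes "total_top_structure S M"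
  shows "is_top_structure S (top_power_str S M I)" "compact_space (topo (top_power_str S M I))"
    "Hausdorff_space (topo (top_power_str S M I))"
  using total_top_structureD[OF assms] structure_power[of S M I]
  by (auto simp: is_top_structure_def top_power_str_def compact_space_product_topology
      Hausdorff_space_product_topology)

text \<open>Evaluation embeds \<open>X\<close> into the power whose exponent is the set of its
  morphisms. That this set is non-empty mirrors the non-empty exponent in the class; the empty map
  qualifies when \<open>X\<close> is empty.\<close>

lemma IScP_iff:
  fixes X :: "('u, 'f, 'r) top_struct" and M :: "('m, 'f, 'r) top_struct"
  assumes M: "total_top_structure S M"
  shows "X \<in> IScP S M \<longleftrightarrow> is_top_structure S X \<and> compact_space (topo X) \<and>
    cont_homs S X M \<noteq> {} \<and> separates_structure S (cont_homs S X M) X M"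
    (is "?L \<longleftrightarrow> ?R")
proof
  note Ms = total_top_structureD[OF M]
  assume ?L
  then obtain I :: "('u \<Rightarrow> 'm) set" and h where X: "is_top_structure S X" and I: "I \<noteq> {}"
    and emb: "top_embedding S X (top_power_str S M I) h" by (auto simp: IScP_def)
  let ?T = "I \<rightarrow>\<^sub>E carrier M" and ?P = "top_power_str S M I"
  note Xs = top_structureD[OF X]
  obtain T g where T: "closedin (topo ?P) T"
    and h: "h \<in> cont_homs S X (top_sub_str S ?P T)"
    and g: "g \<in> cont_homs S (top_sub_str S ?P T) X"
    and gh: "\<forall>a\<in>carrier X. g (h a) = a" and hg: "\<forall>b\<in>carrier (top_sub_str S ?P T). h (g b) = b"
    using emb unfolding top_embedding_def is_closed_substructure_def top_iso_def by blast
  \<comment> \<open>Compactness of \<open>X\<close> must be known before the embedding criterion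
    applies. It is read off the inverse \<open>g\<close>, which maps the closed, hence compact, set
    \<open>T\<close> continuously onto \<open>X\<close>.\<close>
  have "compactin (topo ?P) T" using T power_top(2)[OF M] closedin_compact_space by blast
  then have "compact_space (subtopology (topo ?P) T)" by (rule compact_space_subtopology)
  moreover have "topspace (subtopology (topo ?P) T) = T"
    using T closedin_subset by (metis topspace_subtopology_subset)
  ultimately have "compactin (subtopology (topo ?P) T) T" by (metis compact_space_def)
  moreover have "continuous_map (subtopology (topo ?P) T) (topo X) g"
    using g by (simp add: cont_homs_def top_sub_str_def)
  ultimately have "compactin (topo X) (g ` T)" by (rule image_compactin)
  moreover have "g ` T = carrier X"
    using homs_carrier[OF cont_homsD(1)[OF g]] homs_carrier[OF cont_homsD(1)[OF h]] gh
    by (force simp: top_sub_str_def)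
  ultimately have comp: "compact_space (topo X)" by (simp add: compact_space_def Xs)
  have hP: "h \<in> cont_homs S X ?P" "separates_structure S {h} X ?P"
    using emb top_embedding_iff[OF X comp power_top(1,3)[OF M]] by auto
  have hT: "h a \<in> ?T" if "a \<in> carrier X" for a
    using homs_carrier[OF cont_homsD(1)[OF hP(1)] that] by (simp add: top_power_str_def)
  have coord: "compose (carrier X) (\<lambda>t\<in>?T. t i) h \<in> cont_homs S X M" if "i \<in> I" for i
  proof (rule cont_homs_compose[OF X])
    show "(\<lambda>t\<in>?T. t i) \<in> cont_homs S (top_sub_str S ?P ?T) M"
      using coordinate_cont_hom[OF _ that op_closed_power[OF Ms(1)] Ms(3)] by simp
    show "h \<in> cont_homs S X (top_sub_str S ?P ?T)"
    proof -
      have "h \<in> homs S X (sub_str S (power_str S M I) ?T)"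
        using hP(1) hT homs_sub_str[OF Xs(1), of ?T "power_str S M I" h]
        by (auto simp: cont_homs_def top_power_str_def)
      moreover have "continuous_map (topo X) (subtopology (product_topology (\<lambda>_. topo M) I) ?T) h"
        using hP(1) hT by (auto simp: cont_homs_def top_power_str_def continuous_map_in_subtopology Xs)
      ultimately show ?thesis by (simp add: cont_homs_def top_sub_power)
    qed
  qed
  have "separates_structure S {h} X (sub_str S (power_str S M I) ?T)"
    using hP(2) separates_structure_sub_str[of X h ?T S "power_str S M I"] hT
    by (simp add: top_power_str_def)
  from separates_structure_compose[OF this coordinates_separate]
  have "separates_structure S
      {compose (carrier X) w z |w z. w \<in> {\<lambda>t\<in>?T. t i |i. i \<in> I} \<and> z \<in> {h}} X M"
    using hT by auto
  then have "separates_structure S (cont_homs S X M) X M"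
    by (rule separates_structure_mono) (use coord in blast)
  moreover have "cont_homs S X M \<noteq> {}" using coord I by blast
  ultimately show ?R using X comp by blast
next
  note Ms = total_top_structureD[OF M]
  assume R: ?R
  let ?I = "cont_homs S X M" let ?T = "?I \<rightarrow>\<^sub>E carrier M" and ?P = "top_power_str S M (cont_homs S X M)"
  define k where "k = (\<lambda>a\<in>carrier X. \<lambda>x\<in>?I. x a)"
  have X: "is_top_structure S X" using R by blast
  have kT: "k a \<in> ?T" if "a \<in> carrier X" for a
    using that by (auto simp: k_def intro: homs_carrier[OF cont_homsD(1)])
  have k: "k \<in> cont_homs S X (top_sub_str S ?P ?T)"
  proof (rule cont_hom_into_power[OF X])
    show "k \<in> carrier X \<rightarrow>\<^sub>E ?T" using kT by (auto simp: k_def)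
    fix x assume x: "x \<in> ?I"
    then have "(\<lambda>a\<in>carrier X. k a x) = x"
      by (intro extensionalityI[of _ "carrier X"]) (auto simp: k_def homs_ext[OF cont_homsD(1)])
    then show "(\<lambda>a\<in>carrier X. k a x) \<in> cont_homs S X M" using x by simp
  qed auto
  have sep: "separates_structure S {k} X (sub_str S (power_str S M ?I) ?T)"
    by (rule embedding_into_power[where Z = ?I]) (use R kT in \<open>auto simp: k_def\<close>)
  have "k \<in> homs S X (power_str S M ?I)"
    using cont_homsD(1)[OF k] homs_sub_str[OF top_structureD(1)[OF X], of ?T "power_str S M ?I" k]
    by (simp add: top_sub_power)
  then have "k \<in> homs S X ?P" by (simp add: top_power_str_def)
  moreover have "continuous_map (topo X) (topo ?P) k"
    using cont_homsD(2)[OF k] by (simp add: top_sub_str_def continuous_map_in_subtopology)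
  ultimately have "k \<in> cont_homs S X ?P" by (simp add: cont_homs_def[of S X ?P])
  moreover have "separates_structure S {k} X ?P"
    using sep separates_structure_sub_str[of X k ?T S "power_str S M ?I"] kT
    by (simp add: top_power_str_def)
  ultimately have "top_embedding S X ?P k"
    using top_embedding_iff[OF X _ power_top(1,3)[OF M]] R by blast
  then show ?L using R Ms(3) by (intro IScP_any_exponent) auto
qed

text \<open>Distinct points are told apart by a continuous morphism into the Hausdorff space
  \<open>M\<close>; disjoint neighbourhoods are pulled back along it.\<close>

lemma IScP_Hausdorff:
  assumes M: "total_top_structure S M" and X: "X \<in> IScP S M"
  shows "Hausdorff_space (topo X)"
  unfolding Hausdorff_space_def
proof (intro allI impI)
  fix x y assume xy: "x \<in> topspace (topo X) \<and> y \<in> topspace (topo X) \<and> x \<noteq> y"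
  have "topspace (topo X) = carrier X" "separates_structure S (cont_homs S X M) X M"
    using X unfolding IScP_iff[OF M] is_top_structure_def by simp_all
  then obtain z where z: "z \<in> cont_homs S X M" "z x \<noteq> z y"
    using xy separates_structureD(1) by metis
  note cont = cont_homsD(2)[OF z(1)]
  have "z x \<in> topspace (topo M)" "z y \<in> topspace (topo M)"
    using xy cont by (auto simp: continuous_map_def)
  then obtain U V where UV: "openin (topo M) U" "openin (topo M) V" "z x \<in> U" "z y \<in> V" "disjnt U V"
    using z(2) total_top_structureD(5)[OF M] unfolding Hausdorff_space_def by blast
  let ?P = "\<lambda>W. {a \<in> topspace (topo X). z a \<in> W}"
  have "openin (topo X) (?P U)" "openin (topo X) (?P V)"
    using UV(1,2) cont by (auto intro: openin_continuous_map_preimage)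
  moreover have "disjnt (?P U) (?P V)" using UV(5) by (auto simp: disjnt_iff)
  ultimately show "\<exists>U V. openin (topo X) U \<and> openin (topo X) V \<and> x \<in> U \<and> y \<in> V \<and> disjnt U V"
    using xy UV(3,4) by (intro exI[of _ "?P U"] exI[of _ "?P V"]) auto
qed

section \<open>Terms and reducts\<close>

lemma list_tuple_in: "set xs \<subseteq> C \<Longrightarrow> list_tuple xs \<in> tuples (length xs) C"
  by (auto simp: list_tuple_def)

lemma compose_list_tuple:
  "compose {..<length ts} h (list_tuple (map f ts)) = list_tuple (map (\<lambda>t. h (f t)) ts)"
  by (auto simp: list_tuple_def compose_def fun_eq_iff)

lemma eval_trm_closed:
  assumes "is_structure S A"
  shows "wf_trm S n t \<Longrightarrow> (\<And>i. i < n \<Longrightarrow> v i \<in> carrier A) \<Longrightarrow> eval_trm A v t \<in> carrier A"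
proof (induction t)
  case (App f ts)
  then have "list_tuple (map (eval_trm A v) ts) \<in> tuples (length (map (eval_trm A v) ts)) (carrier A)"
    by (intro list_tuple_in) auto
  then show ?case using App.prems structure_fun[OF assms, of f] by simp
qed simp

lemma hom_eval_trm:
  assumes A: "is_structure S A" and h: "h \<in> homs S A B"
    and v: "\<And>i. i < n \<Longrightarrow> v i \<in> carrier A" "\<And>i. i < n \<Longrightarrow> w i = h (v i)"
  shows "wf_trm S n t \<Longrightarrow> h (eval_trm A v t) = eval_trm B w t"
proof (induction t)
  case (App f ts)
  have "list_tuple (map (eval_trm A v) ts) \<in> tuples (length (map (eval_trm A v) ts)) (carrier A)"
    using App.prems v eval_trm_closed[OF A] by (intro list_tuple_in) auto
  then have "h (eval_trm A v (App f ts)) =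
      fun_of B f (compose {..<oarity S f} h (list_tuple (map (eval_trm A v) ts)))"
    using homs_fun[OF h, of f] App.prems by simp
  also have "compose {..<oarity S f} h (list_tuple (map (eval_trm A v) ts)) =
      list_tuple (map (\<lambda>t. h (eval_trm A v t)) ts)"
    using App.prems compose_list_tuple[of ts h "eval_trm A v"] by simp
  also have "\<dots> = list_tuple (map (eval_trm B w) ts)"
    using App by (intro arg_cong[where f = list_tuple] map_cong) auto
  finally show ?case by simp
qed (use v in simp)

lemma hom_holds_atom:
  assumes A: "is_structure S A" and h: "h \<in> homs S A B"
    and v: "\<And>i. i < n \<Longrightarrow> v i \<in> carrier A" "\<And>i. i < n \<Longrightarrow> w i = h (v i)"
    and p: "wf_atom S n p" "holds_atom A v p"
  shows "holds_atom B w p"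
proof (cases p)
  case (Eq s t)
  then show ?thesis
    using p hom_eval_trm[of S A h B n v w s, OF A h v] hom_eval_trm[of S A h B n v w t, OF A h v]
    by simp
next
  case (Rel r ts)
  have "list_tuple (map (\<lambda>t. h (eval_trm A v t)) ts) = list_tuple (map (eval_trm B w) ts)"
    using p Rel hom_eval_trm[OF A h v] by (intro arg_cong[where f = list_tuple] map_cong) auto
  moreover have "compose {..<rarity S r} h (list_tuple (map (eval_trm A v) ts)) \<in> rel_of B r"
    using p Rel by (intro homs_rel[OF h]) auto
  ultimately show ?thesis
    using p Rel compose_list_tuple[of ts h "eval_trm A v"] by simp
qed

text \<open>Terms commute with every \<open>z\<close>, and equality and the basic relations are what
  a separating family reflects jointly. This is what makes relations defined by conjunctions of
  atomic formulas compatible with separation.\<close>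

lemma separates_atom:
  assumes A: "is_structure S A" and Z: "Z \<subseteq> homs S A M" "separates_structure S Z A M"
    and v: "\<And>i. i < n \<Longrightarrow> v i \<in> carrier A" and p: "wf_atom S n p"
    and holds: "\<And>z. z \<in> Z \<Longrightarrow> holds_atom M (compose {..<n} z v) p"
  shows "holds_atom A v p"
proof -
  have eval: "z (eval_trm A v t) = eval_trm M (compose {..<n} z v) t" if "z \<in> Z" "wf_trm S n t" for z t
    by (rule hom_eval_trm[OF A _ _ _ that(2)]) (use Z that v in \<open>auto simp: compose_def\<close>)
  show ?thesis
  proof (cases p)
    case (Eq s t)
    then have "eval_trm A v s = eval_trm A v t"
      using p eval holds v
      by (intro separates_structureD(1)[OF Z(2)] eval_trm_closed[OF A]) auto
    then show ?thesis using Eq by simp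
  next
    case (Rel r ts)
    have "list_tuple (map (eval_trm A v) ts) \<in> rel_of A r"
    proof (rule separates_structureD(2)[OF Z(2)])
      show "r \<in> relsyms S" using p Rel by simp
      have "list_tuple (map (eval_trm A v) ts) \<in> tuples (length (map (eval_trm A v) ts)) (carrier A)"
        using p Rel v eval_trm_closed[OF A] by (intro list_tuple_in) auto
      then show "list_tuple (map (eval_trm A v) ts) \<in> tuples (rarity S r) (carrier A)"
        using p Rel by simp
      fix z assume z: "z \<in> Z"
      have "compose {..<rarity S r} z (list_tuple (map (eval_trm A v) ts)) =
          list_tuple (map (\<lambda>t. z (eval_trm A v t)) ts)"
        using p Rel compose_list_tuple[of ts z "eval_trm A v"] by simp
      also have "\<dots> = list_tuple (map (eval_trm M (compose {..<n} z v)) ts)"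
        using p Rel eval[OF z] by (intro arg_cong[where f = list_tuple] map_cong) auto
      finally show "compose {..<rarity S r} z (list_tuple (map (eval_trm A v) ts)) \<in> rel_of M r"
        using holds[OF z] Rel by simp
    qed
    then show ?thesis using Rel by simp
  qed
qed

section \<open>Structural reducts and their morphisms\<close>

lemma reduct_simps [simp]:
  "carrier (reduct R J A) = carrier A"
  "fun_of (reduct R J A) g xs = eval_trm A xs (int_trm J g)"
  by (simp_all add: reduct_def)

lemma rel_of_reduct:
  "rel_of (reduct R J A) s = {xs \<in> tuples (rarity R s) (carrier A). \<forall>p\<in>set (int_fml J s). holds_atom A xs p}"
  by (simp add: reduct_def)

lemma structure_reduct:
  assumes "is_structure S A" "wf_interp S R J"
  shows "is_structure R (reduct R J A)"
  unfolding is_structure_def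
proof (intro conjI ballI)
  fix g xs assume "g \<in> opsyms R" "xs \<in> tuples (oarity R g) (carrier (reduct R J A))"
  then show "fun_of (reduct R J A) g xs \<in> carrier (reduct R J A)"
    using assms(2) by (auto simp: wf_interp_def intro!: eval_trm_closed[OF assms(1)])
qed (auto simp: rel_of_reduct)

lemma homs_reduct:
  assumes A: "is_structure S A" and J: "wf_interp S R J" and h: "h \<in> homs S A B"
  shows "h \<in> homs R (reduct R J A) (reduct R J B)"
proof (rule homsI)
  fix g xs assume "g \<in> opsyms R" "xs \<in> tuples (oarity R g) (carrier (reduct R J A))"
  then show "h (fun_of (reduct R J A) g xs) = fun_of (reduct R J B) g (compose {..<oarity R g} h xs)"
    using J by (auto simp: wf_interp_def compose_def PiE_iff intro!: hom_eval_trm[OF A h, where n = "oarity R g"])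
next
  fix r xs assume r: "r \<in> relsyms R" and xs: "xs \<in> rel_of (reduct R J A) r"
  then have t: "xs \<in> tuples (rarity R r) (carrier A)" by (simp add: rel_of_reduct)
  have "holds_atom B (compose {..<rarity R r} h xs) p" if "p \<in> set (int_fml J r)" for p
    by (rule hom_holds_atom[OF A h, where n = "rarity R r" and v = xs])
       (use that r xs t J in \<open>auto simp: rel_of_reduct wf_interp_def compose_def\<close>)
  moreover have "compose {..<rarity R r} h xs \<in> tuples (rarity R r) (carrier B)"
    using homs_carrier[OF h] t by (rule compose_tuples)
  ultimately show "compose {..<rarity R r} h xs \<in> rel_of (reduct R J B) r"
    by (simp add: rel_of_reduct)
qed (use h in \<open>auto intro: homs_carrier homs_ext\<close>)

text \<open>For \<open>Z = {h}\<close> this says that embeddings remain embeddings between reducts;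
  for the set of all morphisms into \<open>M\<close> it is half of the proof that reducts lie in the
  classes generated by \<open>N\<close>.\<close>

lemma separates_reduct:
  assumes A: "is_structure S A" and J: "wf_interp S R J"
    and Z: "Z \<subseteq> homs S A M" "separates_structure S Z A M"
  shows "separates_structure R Z (reduct R J A) (reduct R J M)"
proof (rule separates_structureI)
  fix a b assume "a \<in> carrier (reduct R J A)" "b \<in> carrier (reduct R J A)" "\<And>z. z \<in> Z \<Longrightarrow> z a = z b"
  then show "a = b" by (intro separates_structureD(1)[OF Z(2)]) auto
next
  fix r xs assume r: "r \<in> relsyms R" and xs: "xs \<in> tuples (rarity R r) (carrier (reduct R J A))"
    and rel: "\<And>z. z \<in> Z \<Longrightarrow> compose {..<rarity R r} z xs \<in> rel_of (reduct R J M) r"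
  have "holds_atom A xs p" if "p \<in> set (int_fml J r)" for p
    by (rule separates_atom[OF A Z, where n = "rarity R r"])
       (use that r xs rel J in \<open>auto simp: rel_of_reduct wf_interp_def\<close>)
  then show "xs \<in> rel_of (reduct R J A) r" using xs by (simp add: rel_of_reduct)
qed

lemma top_structure_reduct:
  "is_top_structure S X \<Longrightarrow> wf_interp S R J \<Longrightarrow> is_top_structure R (top_reduct R J X)"
  using structure_reduct[of S X R J] by (simp add: is_top_structure_def top_reduct_def)

lemma cont_homs_reduct:
  "is_structure S X \<Longrightarrow> wf_interp S R J \<Longrightarrow> h \<in> cont_homs S X Y \<Longrightarrow>
   h \<in> cont_homs R (top_reduct R J X) (top_reduct R J Y)"
  using homs_reduct[of S X R J h Y] by (simp add: cont_homs_def top_reduct_def)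

lemma Clo1_trm:
  assumes "u \<in> Clo1 S A"
  obtains t where "wf_trm S 1 t" "u = (\<lambda>a\<in>carrier A. eval_trm A (\<lambda>k\<in>{..<1}. a) t)"
  using assms by (auto simp: Clo1_def)

section \<open>Dual structures\<close>

text \<open>Instantiated twice in the piggyback argument, for \<open>M\<close> with
  \<open>MT\<close> and for \<open>N\<close> with \<open>NT\<close>, so that facts about duals are
  available on both sides.\<close>

locale alter_ego_pair =
  fixes S1 :: "('f1, 'r1) signature" and M :: "('m, 'f1, 'r1) struct"
    and S2 :: "('f2, 'r2) signature" and MT :: "('m, 'f2, 'r2) top_struct"
  assumes total_M: "total_structure S1 M" and total_MT: "total_top_structure S2 MT"
    and ego: "alter_ego S1 M S2 MT"
begin

lemma M_structure: "is_structure S1 M"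
  using total_M by (simp add: total_structure_def)

lemmas MT_compact = total_top_structureD(4)[OF total_MT]
  and MT_Hausdorff = total_top_structureD(5)[OF total_MT]

lemma carrier_MT: "carrier MT = carrier M"
  using ego by (simp add: alter_ego_def)

lemma topspace_MT: "topspace (topo MT) = carrier M"
  using total_top_structureD(3)[OF total_MT] carrier_MT by simp

text \<open>An operation \<open>g\<close> of \<open>MT\<close> applied pointwise to homomorphisms is
  the composite of \<open>g\<close> with the map \<open>q\<close> that bundles them into one
  homomorphism from \<open>A\<close> to a finite power of \<open>M\<close>; the alter ego condition
  makes \<open>g\<close> a homomorphism on that power.\<close>

lemma homs_op_closed:
  assumes A: "is_structure S1 A"
  shows "op_closed S2 (power_str S2 MT (carrier A)) (homs S1 A M)"
  unfolding op_closed_def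
proof (intro conjI ballI)
  show "homs S1 A M \<subseteq> carrier (power_str S2 MT (carrier A))"
    by (auto simp: homs_def carrier_MT)
  fix g xs assume g: "g \<in> opsyms S2" and xs: "xs \<in> tuples (oarity S2 g) (homs S1 A M)"
  let ?n = "oarity S2 g" let ?T = "tuples ?n (carrier M)"
  define q where "q = (\<lambda>a\<in>carrier A. \<lambda>k\<in>{..<?n}. xs k a)"
  have q: "q \<in> homs S1 A (sub_str S1 (power_str S1 M {..<?n}) ?T)"
  proof (rule hom_into_power[OF A])
    show "q \<in> carrier A \<rightarrow>\<^sub>E ?T"
      using xs by (auto simp: q_def PiE_iff intro: homs_carrier[of _ S1 A])
    fix k assume k: "k \<in> {..<?n}"
    then have "xs k \<in> homs S1 A M" using xs by auto
    moreover from this have "(\<lambda>a\<in>carrier A. q a k) = xs k"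
      using k by (intro extensionalityI[of _ "carrier A"]) (auto simp: q_def homs_ext)
    ultimately show "(\<lambda>a\<in>carrier A. q a k) \<in> homs S1 A M" by simp
  qed simp
  then have "q \<in> homs S1 A (power_str S1 M {..<?n})"
    using homs_sub_str[OF A, of ?T "power_str S1 M {..<?n}" q] by simp
  moreover have "restrict (fun_of MT g) ?T \<in> homs S1 (power_str S1 M {..<?n}) M"
    using ego g by (simp add: alter_ego_def)
  ultimately have "compose (carrier A) (restrict (fun_of MT g) ?T) q \<in> homs S1 A M"
    by (rule homs_compose[OF A])
  moreover have "compose (carrier A) (restrict (fun_of MT g) ?T) q = fun_of (power_str S2 MT (carrier A)) g xs"
    using homs_carrier[OF q]
    by (auto simp: compose_def fun_of_power_str fun_eq_iff) (auto simp: q_def)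
  ultimately show "fun_of (power_str S2 MT (carrier A)) g xs \<in> homs S1 A M" by simp
qed

text \<open>Each single homomorphism condition is closed in the product topology: preservation of an
  operation is an equation between continuous maps into a Hausdorff space, preservation of a
  relation is a preimage of a closed set.\<close>

lemma closedin_homs:
  assumes A: "is_structure S1 A"
  shows "closedin (product_topology (\<lambda>_. topo MT) (carrier A)) (homs S1 A M)"
proof -
  let ?T = "product_topology (\<lambda>_. topo MT) (carrier A)"
  have cont: "continuous_map ?T (product_topology (\<lambda>_. topo MT) {..<n}) (\<lambda>x. compose {..<n} x xs)"
    if "xs \<in> tuples n (carrier A)" for n xs
  proof (rule continuous_map_coordinatewise_then_product)
    fix k assume "k \<in> {..<n}"
    then show "continuous_map ?T (topo MT) (\<lambda>x. compose {..<n} x xs k)"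
      using that by (auto simp: compose_def intro!: continuous_map_product_projection)
  qed (simp add: compose_def)
  define F where "F = (\<lambda>(f, xs). {x \<in> topspace ?T. x (fun_of A f xs) =
      fun_of M f (compose {..<oarity S1 f} x xs)}) ` (SIGMA f:opsyms S1. tuples (oarity S1 f) (carrier A))"
  define R where "R = (\<lambda>(r, xs). {x \<in> topspace ?T. compose {..<rarity S1 r} x xs \<in> rel_of M r}) `
      (SIGMA r:relsyms S1. rel_of A r)"
  \<comment> \<open>The whole space is inserted so that the family is non-empty even for an empty
    type, where the intersection would otherwise be the universe.\<close>
  have "homs S1 A M = \<Inter>(insert (topspace ?T) (F \<union> R))"
    unfolding F_def R_def homs_def by (auto simp: topspace_MT)
  also have "closedin ?T \<dots>"
  proof (rule closedin_Inter)
    fix C assume "C \<in> insert (topspace ?T) (F \<union> R)"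
    then consider "C = topspace ?T" | "C \<in> F" | "C \<in> R" by blast
    then show "closedin ?T C"
    proof cases
      case 1
      show ?thesis unfolding 1 by (rule closedin_topspace)
    next
      case 2
      then obtain f xs where f: "f \<in> opsyms S1" and xs: "xs \<in> tuples (oarity S1 f) (carrier A)"
        and C: "C = {x \<in> topspace ?T. x (fun_of A f xs) = fun_of M f (compose {..<oarity S1 f} x xs)}"
        by (auto simp: F_def)
      have "continuous_map ?T (topo MT) (fun_of M f \<circ> (\<lambda>x. compose {..<oarity S1 f} x xs))"
        using cont[OF xs] ego f
        by (auto simp: alter_ego_def op_continuous_def intro: continuous_map_compose)
      then show ?thesis
        unfolding C using structure_fun[OF A f xs] MT_Hausdorff
        by (intro closedin_continuous_maps_eq) (auto simp: o_def intro: continuous_map_product_projection)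
    next
      case 3
      then obtain r xs where r: "r \<in> relsyms S1" and xs: "xs \<in> rel_of A r"
        and C: "C = {x \<in> topspace ?T. compose {..<rarity S1 r} x xs \<in> rel_of M r}"
        by (auto simp: R_def)
      show ?thesis
        unfolding C using ego r
        by (intro closedin_continuous_map_preimage[OF cont[OF structure_rel[OF A r xs]]])
           (auto simp: alter_ego_def)
    qed
  qed simp
  finally show ?thesis .
qed

text \<open>The three parts of the alter ego condition that concern \<open>f\<close> correspond to
  three claims: operations of \<open>MT\<close> commute with \<open>f\<close>, relations of
  \<open>MT\<close> are closed under \<open>f\<close>, and \<open>f\<close> is continuous.\<close>

lemma cont_homs_op_closed:
  assumes X: "is_top_structure S2 X"
  shows "op_closed S1 (power_str S1 M (carrier X)) (cont_homs S2 X MT)"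
  unfolding op_closed_def
proof (intro conjI ballI)
  note Xs = top_structureD[OF X]
  show "cont_homs S2 X MT \<subseteq> carrier (power_str S1 M (carrier X))"
    by (auto simp: cont_homs_def homs_def carrier_MT)
  fix f xs assume f: "f \<in> opsyms S1" and xs: "xs \<in> tuples (oarity S1 f) (cont_homs S2 X MT)"
  let ?n = "oarity S1 f"
  define h where "h = fun_of (power_str S1 M (carrier X)) f xs"
  have h: "h x = fun_of M f (\<lambda>k\<in>{..<?n}. xs k x)" if "x \<in> carrier X" for x
    using that by (simp add: h_def fun_of_power_str)
  have xk: "xs k \<in> homs S2 X MT" "continuous_map (topo X) (topo MT) (xs k)" if "k < ?n" for k
    using xs that by (auto simp: cont_homs_def)
  have hX: "h x \<in> carrier M" if "x \<in> carrier X" for x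
    using that xk homs_carrier[OF xk(1)]
    by (auto simp: h carrier_MT intro!: structure_fun[OF M_structure f] split: if_splits)
  \<comment> \<open>Interchange of the two indices: \<open>f\<close> applied in the power to the
    images of \<open>ys\<close> under the \<open>xs k\<close> is the image of \<open>ys\<close>
    under \<open>h\<close>.\<close>
  have power: "fun_of (power_str S1 M {..<m}) f (\<lambda>k\<in>{..<?n}. compose {..<m} (xs k) ys) =
      compose {..<m} h ys" if "ys \<in> tuples m (carrier X)" for m ys
    using that by (auto simp: fun_of_power_str compose_def fun_eq_iff h PiE_iff intro!: arg_cong[where f = "fun_of M f"])
  have "h \<in> homs S2 X MT"
  proof (rule homsI)
    show "h x \<in> carrier MT" if "x \<in> carrier X" for x using hX that by (simp add: carrier_MT)
    show "h \<in> extensional (carrier X)" by (simp add: h_def fun_of_power_str)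
  next
    fix g ys assume g: "g \<in> opsyms S2" and ys: "ys \<in> tuples (oarity S2 g) (carrier X)"
    let ?m = "oarity S2 g" and ?G = "restrict (fun_of MT g) (tuples (oarity S2 g) (carrier M))"
    let ?zs = "\<lambda>k\<in>{..<?n}. compose {..<?m} (xs k) ys"
    have G: "?G \<in> homs S1 (power_str S1 M {..<?m}) M" using ego g by (simp add: alter_ego_def)
    have xt: "compose {..<?m} (xs k) ys \<in> tuples ?m (carrier M)" if "k < ?n" for k
      using homs_carrier[OF xk(1)[OF that]] ys by (intro compose_tuples) (auto simp: carrier_MT)
    have zs: "?zs \<in> tuples ?n (carrier (power_str S1 M {..<?m}))"
      using xt by auto
    have "h (fun_of X g ys) = fun_of M f (\<lambda>k\<in>{..<?n}. xs k (fun_of X g ys))"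
      using structure_fun[OF Xs(1) g ys] by (rule h)
    also have "(\<lambda>k\<in>{..<?n}. xs k (fun_of X g ys)) = compose {..<?n} ?G ?zs"
      using xt homs_fun[OF xk(1) g ys] by (auto simp: compose_def fun_eq_iff)
    \<comment> \<open>That \<open>g\<close> is a homomorphism for \<open>f\<close> is a symmetric
      statement: it equally says that \<open>f\<close> preserves \<open>g\<close>, and it is used
      here in this second reading.\<close>
    also have "fun_of M f \<dots> = ?G (fun_of (power_str S1 M {..<?m}) f ?zs)"
      using homs_fun[OF G f zs] by simp
    also have "\<dots> = ?G (compose {..<?m} h ys)" using power[OF ys] by simp
    also have "\<dots> = fun_of MT g (compose {..<?m} h ys)"
      using compose_tuples[of "carrier X" h "carrier M", OF hX ys] by simp
    finally show "h (fun_of X g ys) = fun_of MT g (compose {..<?m} h ys)" .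
  next
    fix r ys assume r: "r \<in> relsyms S2" and ys: "ys \<in> rel_of X r"
    note yt = structure_rel[OF Xs(1) r ys]
    let ?m = "rarity S2 r"
    have "(\<lambda>k\<in>{..<?n}. compose {..<?m} (xs k) ys) \<in> tuples ?n (rel_of MT r)"
      using homs_rel[OF xk(1) r ys] by auto
    moreover have "op_closed S1 (power_str S1 M {..<?m}) (rel_of MT r)"
      using ego r by (simp add: alter_ego_def is_substructure_def)
    ultimately show "compose {..<?m} h ys \<in> rel_of MT r"
      using power[OF yt] f unfolding op_closed_def by metis
  qed
  moreover have "continuous_map (topo X) (topo MT) h"
  proof -
    have "continuous_map (topo X) (product_topology (\<lambda>_. topo MT) {..<?n}) (\<lambda>x. \<lambda>k\<in>{..<?n}. xs k x)"
      using xk(2) by (intro continuous_map_coordinatewise_then_product) auto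
    then have "continuous_map (topo X) (topo MT) (fun_of M f \<circ> (\<lambda>x. \<lambda>k\<in>{..<?n}. xs k x))"
      using ego f by (auto simp: alter_ego_def op_continuous_def intro: continuous_map_compose)
    then show ?thesis by (rule continuous_map_eq) (simp add: h Xs)
  qed
  ultimately show "fun_of (power_str S1 M (carrier X)) f xs \<in> cont_homs S2 X MT"
    by (simp add: cont_homs_def h_def)
qed

section \<open>Duals and coduals as members of the two classes\<close>

lemma carrier_Dual [simp]: "carrier (Dual S1 M S2 MT A) = homs S1 A M"
  by (simp add: Dual_def top_sub_power)

lemma carrier_Codual [simp]: "carrier (Codual S1 M S2 MT X) = cont_homs S2 X MT"
  by (simp add: Codual_def)

lemma homs_subset: "homs S1 A M \<subseteq> carrier A \<rightarrow>\<^sub>E carrier MT"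
  by (auto simp: homs_def carrier_MT)

lemma cont_homs_subset: "cont_homs S2 X MT \<subseteq> carrier X \<rightarrow>\<^sub>E carrier M"
  by (auto simp: cont_homs_def homs_def carrier_MT)

lemma Dual_top:
  assumes "is_structure S1 A"
  shows "is_top_structure S2 (Dual S1 M S2 MT A)" "compact_space (topo (Dual S1 M S2 MT A))"
    "Hausdorff_space (topo (Dual S1 M S2 MT A))"
proof -
  show "is_top_structure S2 (Dual S1 M S2 MT A)"
    unfolding Dual_def using power_top[OF total_MT] homs_op_closed[OF assms]
    by (intro structure_top_sub_str) (simp_all add: top_power_str_def op_closed_def)
  have "compact_space (product_topology (\<lambda>_. topo MT) (carrier A))"
    using MT_compact by (simp add: compact_space_product_topology)
  then show "compact_space (topo (Dual S1 M S2 MT A))"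
    using closedin_homs[OF assms]
    by (simp add: Dual_def top_sub_power closedin_compact_space compact_space_subtopology)
  show "Hausdorff_space (topo (Dual S1 M S2 MT A))"
    using MT_Hausdorff
    by (simp add: Dual_def top_sub_power Hausdorff_space_subtopology Hausdorff_space_product_topology)
qed

lemma evaluation_cont_hom:
  assumes "is_structure S1 A" "a \<in> carrier A"
  shows "(\<lambda>x\<in>homs S1 A M. x a) \<in> cont_homs S2 (Dual S1 M S2 MT A) MT"
  unfolding Dual_def
  using assms homs_subset homs_op_closed topspace_MT carrier_MT by (intro coordinate_cont_hom) auto

lemma evaluations_separate_Dual:
  "separates_structure S2 {\<lambda>x\<in>homs S1 A M. x a |a. a \<in> carrier A} (Dual S1 M S2 MT A) MT"
  using coordinates_separate[OF homs_subset] by (simp add: Dual_def top_sub_power)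

lemma cont_hom_into_Dual:
  assumes "is_top_structure S2 X" "h \<in> carrier X \<rightarrow>\<^sub>E homs S1 A M"
    and "\<And>a. a \<in> carrier A \<Longrightarrow> (\<lambda>x\<in>carrier X. h x a) \<in> cont_homs S2 X MT"
  shows "h \<in> cont_homs S2 X (Dual S1 M S2 MT A)"
  unfolding Dual_def using assms homs_subset by (intro cont_hom_into_power)

lemma embedding_into_Dual:
  assumes "separates_structure S2 Z X MT" "\<And>x. x \<in> carrier X \<Longrightarrow> h x \<in> homs S1 A M"
    and "\<And>z. z \<in> Z \<Longrightarrow> \<exists>a\<in>carrier A. \<forall>x\<in>carrier X. h x a = z x"
  shows "separates_structure S2 {h} X (Dual S1 M S2 MT A)"
  using embedding_into_power[OF assms(1) homs_subset, of h A] assms(2,3)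
  by (simp add: Dual_def top_sub_power)

text \<open>The evaluations at elements of \<open>A\<close> separate the dual, and a non-empty
  \<open>A\<close> provides at least one of them, as the non-empty exponent requires.\<close>

lemma Dual_in_IScP:
  assumes "is_structure S1 A" "carrier A \<noteq> {}"
  shows "Dual S1 M S2 MT A \<in> IScP S2 MT"
proof -
  have "separates_structure S2 (cont_homs S2 (Dual S1 M S2 MT A) MT) (Dual S1 M S2 MT A) MT"
    by (rule separates_structure_mono[OF evaluations_separate_Dual])
       (use evaluation_cont_hom[OF assms(1)] in blast)
  then show ?thesis
    using Dual_top[OF assms(1)] evaluation_cont_hom[OF assms(1)] assms(2)
    unfolding IScP_iff[OF total_MT] by blast
qed

lemma Codual_structure:
  assumes "is_top_structure S2 X"
  shows "is_structure S1 (Codual S1 M S2 MT X)"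
  unfolding Codual_def using cont_homs_op_closed[OF assms] by (rule structure_sub_str)

lemma evaluation_hom:
  assumes "is_top_structure S2 X" "x \<in> carrier X"
  shows "(\<lambda>\<alpha>\<in>cont_homs S2 X MT. \<alpha> x) \<in> homs S1 (Codual S1 M S2 MT X) M"
  unfolding Codual_def
  using assms cont_homs_subset cont_homs_op_closed by (intro coordinate_hom) auto

lemma evaluations_separate_Codual:
  "separates_structure S1 {\<lambda>\<alpha>\<in>cont_homs S2 X MT. \<alpha> x |x. x \<in> carrier X} (Codual S1 M S2 MT X) M"
  unfolding Codual_def using cont_homs_subset by (rule coordinates_separate)

lemma hom_into_Codual:
  assumes "is_structure S1 A" "h \<in> carrier A \<rightarrow>\<^sub>E cont_homs S2 X MT"
    and "\<And>x. x \<in> carrier X \<Longrightarrow> (\<lambda>a\<in>carrier A. h a x) \<in> homs S1 A M"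
  shows "h \<in> homs S1 A (Codual S1 M S2 MT X)"
  unfolding Codual_def using assms cont_homs_subset by (intro hom_into_power)

lemma embedding_into_Codual:
  assumes "separates_structure S1 Z A M" "\<And>a. a \<in> carrier A \<Longrightarrow> h a \<in> cont_homs S2 X MT"
    and "\<And>z. z \<in> Z \<Longrightarrow> \<exists>x\<in>carrier X. \<forall>a\<in>carrier A. h a x = z a"
  shows "separates_structure S1 {h} A (Codual S1 M S2 MT X)"
  unfolding Codual_def using assms cont_homs_subset by (intro embedding_into_power)

lemma Codual_in_ISP:
  assumes "is_top_structure S2 X" "cont_homs S2 X MT \<noteq> {}"
  shows "Codual S1 M S2 MT X \<in> ISP S1 M"
proof -
  have "separates_structure S1 (homs S1 (Codual S1 M S2 MT X) M) (Codual S1 M S2 MT X) M"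
    by (rule separates_structure_mono[OF evaluations_separate_Codual])
       (use evaluation_hom[OF assms(1)] in blast)
  then show ?thesis
    using Codual_structure assms unfolding ISP_iff[OF M_structure] by simp
qed

end

section \<open>Change of the carrier type\<close>

text \<open>Transport of structure along a map of carrier types. Tuples are pulled back with
  \<open>inv \<phi>\<close>, which undoes an injective \<phi> on its whole type.\<close>

definition image_str ::
  "('f, 'r) signature \<Rightarrow> ('a \<Rightarrow> 'b) \<Rightarrow> ('a, 'f, 'r, 'z) struct_scheme \<Rightarrow> ('b, 'f, 'r) struct" where
  "image_str S \<phi> A =
     \<lparr>carrier = \<phi> ` carrier A,
      fun_of = (\<lambda>f ys. \<phi> (fun_of A f (compose {..<oarity S f} (inv \<phi>) ys))),
      rel_of = (\<lambda>r. compose {..<rarity S r} \<phi> ` rel_of A r)\<rparr>"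

lemma image_str:
  assumes A: "is_structure S A" and \<phi>: "inj \<phi>"
  shows "is_structure S (image_str S \<phi> A)"
    and "restrict \<phi> (carrier A) \<in> homs S A (image_str S \<phi> A)"
    and "restrict (inv \<phi>) (\<phi> ` carrier A) \<in> homs S (image_str S \<phi> A) A"
proof -
  have inv_tuples: "compose {..<n} (inv \<phi>) ys \<in> tuples n (carrier A)"
    if "ys \<in> tuples n (\<phi> ` carrier A)" for n ys
    using \<phi> by (intro compose_tuples[OF _ that]) auto
  have restr: "compose {..<n} (restrict \<phi> (carrier A)) xs = compose {..<n} \<phi> xs"
    and inv: "compose {..<n} (inv \<phi>) (compose {..<n} \<phi> xs) = xs"
    if xs: "xs \<in> tuples n (carrier A)" for n xs
  proof -
    show "compose {..<n} (restrict \<phi> (carrier A)) xs = compose {..<n} \<phi> xs"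
      by (rule compose_cong_tuples[OF xs]) simp
    show "compose {..<n} (inv \<phi>) (compose {..<n} \<phi> xs) = xs"
      by (rule extensionalityI[of _ "{..<n}"]) (use xs \<phi> in \<open>auto simp: compose_eq PiE_iff\<close>)
  qed
  have cong: "compose {..<n} (restrict (inv \<phi>) (\<phi> ` carrier A)) ys = compose {..<n} (inv \<phi>) ys"
    if "ys \<in> tuples n (\<phi> ` carrier A)" for n ys
    using that by (rule compose_cong_tuples) simp
  show "is_structure S (image_str S \<phi> A)"
    unfolding is_structure_def
  proof (intro conjI ballI subsetI)
    fix f ys assume f: "f \<in> opsyms S" and "ys \<in> tuples (oarity S f) (carrier (image_str S \<phi> A))"
    then have "ys \<in> tuples (oarity S f) (\<phi> ` carrier A)" by (simp add: image_str_def)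
    then show "fun_of (image_str S \<phi> A) f ys \<in> carrier (image_str S \<phi> A)"
      using structure_fun[OF A f inv_tuples] by (simp add: image_str_def)
  next
    fix r ys assume r: "r \<in> relsyms S" and "ys \<in> rel_of (image_str S \<phi> A) r"
    then obtain xs where "xs \<in> rel_of A r" "ys = compose {..<rarity S r} \<phi> xs"
      by (auto simp: image_str_def)
    then show "ys \<in> tuples (rarity S r) (carrier (image_str S \<phi> A))"
      using structure_rel[OF A r] compose_tuples[of "carrier A" \<phi> "\<phi> ` carrier A"]
      by (simp add: image_str_def)
  qed
  show "restrict \<phi> (carrier A) \<in> homs S A (image_str S \<phi> A)"
  proof (rule homsI)
    fix f xs assume f: "f \<in> opsyms S" and xs: "xs \<in> tuples (oarity S f) (carrier A)"
    show "restrict \<phi> (carrier A) (fun_of A f xs) =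
        fun_of (image_str S \<phi> A) f (compose {..<oarity S f} (restrict \<phi> (carrier A)) xs)"
      using structure_fun[OF A f xs] restr[OF xs] inv[OF xs] by (simp add: image_str_def)
  next
    fix r xs assume r: "r \<in> relsyms S" and xs: "xs \<in> rel_of A r"
    then show "compose {..<rarity S r} (restrict \<phi> (carrier A)) xs \<in> rel_of (image_str S \<phi> A) r"
      using restr[OF structure_rel[OF A r xs]] by (simp add: image_str_def)
  qed (auto simp: image_str_def)
  show "restrict (inv \<phi>) (\<phi> ` carrier A) \<in> homs S (image_str S \<phi> A) A"
  proof (rule homsI)
    fix f ys assume f: "f \<in> opsyms S" and "ys \<in> tuples (oarity S f) (carrier (image_str S \<phi> A))"
    then have ys: "ys \<in> tuples (oarity S f) (\<phi> ` carrier A)" by (simp add: image_str_def)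
    show "restrict (inv \<phi>) (\<phi> ` carrier A) (fun_of (image_str S \<phi> A) f ys) =
        fun_of A f (compose {..<oarity S f} (restrict (inv \<phi>) (\<phi> ` carrier A)) ys)"
      using structure_fun[OF A f inv_tuples[OF ys]] \<phi> cong[OF ys] by (simp add: image_str_def)
  next
    fix r ys assume r: "r \<in> relsyms S" and "ys \<in> rel_of (image_str S \<phi> A) r"
    then obtain xs where xs: "xs \<in> rel_of A r" and ys: "ys = compose {..<rarity S r} \<phi> xs"
      by (auto simp: image_str_def)
    note xt = structure_rel[OF A r xs]
    have "ys \<in> tuples (rarity S r) (\<phi> ` carrier A)"
      unfolding ys using compose_tuples[OF imageI xt] .
    then show "compose {..<rarity S r} (restrict (inv \<phi>) (\<phi> ` carrier A)) ys \<in> rel_of A r"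
      using cong inv[OF xt] ys xs by metis
  qed (use \<phi> in \<open>auto simp: image_str_def\<close>)
qed

text \<open>The separating morphisms of \<open>A\<close>, composed with the inverse of the
  transport, separate the copy, so the copy belongs to the class over its own carrier type.\<close>

lemma ISP_copy:
  fixes A :: "('a, 'f, 'r) struct" and M :: "('m, 'f, 'r) struct" and \<phi> :: "'a \<Rightarrow> 'v"
  assumes M: "is_structure S M" and A: "A \<in> ISP S M" and \<phi>: "inj \<phi>"
  shows "\<exists>A' :: ('v, 'f, 'r) struct. A' \<in> ISP S M \<and> (\<exists>p\<in>homs S A A'. \<exists>q\<in>homs S A' A.
    (\<forall>a\<in>carrier A. q (p a) = a) \<and> (\<forall>b\<in>carrier A'. p (q b) = b))"
proof -
  have As: "is_structure S A" "carrier A \<noteq> {}" "separates_structure S (homs S A M) A M"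
    using A unfolding ISP_iff[OF M] by simp_all
  let ?A = "image_str S \<phi> A" and ?p = "restrict \<phi> (carrier A)" and ?q = "restrict (inv \<phi>) (\<phi> ` carrier A)"
  note im = image_str[OF As(1) \<phi>]
  have car: "carrier ?A = \<phi> ` carrier A" by (simp add: image_str_def)
  have qp: "?q (?p a) = a" if "a \<in> carrier A" for a using that \<phi> by simp
  have pq: "?p (?q b) = b" if "b \<in> carrier ?A" for b using that \<phi> by (auto simp: car)
  have "separates_structure S {?q} ?A A"
    using im(2) pq homs_carrier[OF im(3)] by (intro separates_structure_left_inverse)
  from separates_structure_compose[OF this As(3)]
  have "separates_structure S {compose (carrier ?A) w z |w z. w \<in> homs S A M \<and> z \<in> {?q}} ?A M"
    using homs_carrier[OF im(3)] by auto
  then have "separates_structure S (homs S ?A M) ?A M"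
    by (rule separates_structure_mono) (use homs_compose[OF im(1,3)] in blast)
  then have "?A \<in> ISP S M" using im(1) As(2) unfolding ISP_iff[OF M] by (simp add: car)
  then show ?thesis using im(2,3) qp pq by blast
qed

lemma IScP_copy:
  fixes X :: "('a, 'f, 'r) top_struct" and M :: "('m, 'f, 'r) top_struct" and \<phi> :: "'a \<Rightarrow> 'v"
  assumes M: "total_top_structure S M" and X: "X \<in> IScP S M" and \<phi>: "inj \<phi>"
  shows "\<exists>X' :: ('v, 'f, 'r) top_struct. X' \<in> IScP S M \<and> (\<exists>p\<in>cont_homs S X X'. \<exists>q\<in>cont_homs S X' X.
    (\<forall>a\<in>carrier X. q (p a) = a) \<and> (\<forall>b\<in>carrier X'. p (q b) = b))"
proof -
  have X1: "is_top_structure S X" "compact_space (topo X)" "cont_homs S X M \<noteq> {}"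
    and sep: "separates_structure S (cont_homs S X M) X M"
    using X unfolding IScP_iff[OF M] by simp_all
  note Xs = top_structureD[OF X1(1)]
  let ?A = "image_str S \<phi> X" and ?p = "restrict \<phi> (carrier X)" and ?q = "restrict (inv \<phi>) (\<phi> ` carrier X)"
  \<comment> \<open>Pulling the topology back along \<open>inv \<phi>\<close> makes the transport a
    homeomorphism onto the copy.\<close>
  let ?T = "pullback_topology (\<phi> ` carrier X) (inv \<phi>) (topo X)"
  let ?X = "add_topology ?A ?T"
  note im = image_str[OF Xs(1) \<phi>]
  have car: "carrier ?A = \<phi> ` carrier X" by (simp add: image_str_def)
  have top: "topspace ?T = \<phi> ` carrier X"
    using \<phi> by (auto simp: topspace_pullback_topology Xs)
  have qp: "?q (?p a) = a" if "a \<in> carrier X" for a using that \<phi> by simp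
  have pq: "?p (?q b) = b" if "b \<in> carrier ?X" for b using that \<phi> by (auto simp: car)
  have "continuous_map ?T (topo X) (id \<circ> inv \<phi>)" by (rule continuous_map_pullback) simp
  then have "continuous_map ?T (topo X) ?q" by (rule continuous_map_eq) (simp add: top)
  then have q: "?q \<in> cont_homs S ?X X" using im(3) by (simp add: cont_homs_def)
  have "continuous_map (topo X) ?T ?p"
  proof (rule continuous_map_pullback')
    show "continuous_map (topo X) (topo X) (inv \<phi> \<circ> ?p)"
      by (rule continuous_map_eq[where f = id]) (use \<phi> in \<open>auto simp: Xs\<close>)
  qed (auto simp: Xs)
  then have p: "?p \<in> cont_homs S X ?X" using im(2) by (simp add: cont_homs_def)
  have topX: "is_top_structure S ?X" using im(1) by (simp add: is_top_structure_def top car)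
  have "compactin ?T (?p ` carrier X)"
    using image_compactin[OF _ cont_homsD(2)[OF p], of "carrier X"] X1(2) by (simp add: compact_space_def Xs)
  then have comp: "compact_space (topo ?X)" by (simp add: compact_space_def top)
  have "separates_structure S {?q} ?X X"
    using cont_homsD(1)[OF p] pq homs_carrier[OF cont_homsD(1)[OF q]]
    by (intro separates_structure_left_inverse)
  from separates_structure_compose[OF this sep]
  have "separates_structure S {compose (carrier ?X) w z |w z. w \<in> cont_homs S X M \<and> z \<in> {?q}} ?X M"
    using homs_carrier[OF cont_homsD(1)[OF q]] by auto
  then have "separates_structure S (cont_homs S ?X M) ?X M"
    by (rule separates_structure_mono) (use cont_homs_compose[OF topX q] in blast)
  moreover have "cont_homs S ?X M \<noteq> {}" using cont_homs_compose[OF topX q] X1(3) by blast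
  ultimately have "?X \<in> IScP S M" using topX comp unfolding IScP_iff[OF M] by blast
  then show ?thesis using p q qp pq by blast
qed

text \<open>Injectivity is available over the carrier type \<open>'v\<close> only. Both structures
  are copied into \<open>'v\<close>, the extension is made there and then pulled back. In particular
  \<open>A\<close> and \<open>B\<close> may have different carrier types.\<close>

lemma injective_in_ISP_extend:
  fixes A :: "('a, 'f, 'r) struct" and B :: "('b, 'f, 'r) struct"
    and \<phi> :: "'a \<Rightarrow> 'v" and \<psi> :: "'b \<Rightarrow> 'v" and U :: "'v itself"
  assumes inj: "injective_in_ISP U S M" and M: "is_structure S M" and \<phi>: "inj \<phi>" "inj \<psi>"
    and A: "A \<in> ISP S M" and B: "B \<in> ISP S M"
    and h: "h \<in> homs S A B" "separates_structure S {h} A B" and x: "x \<in> homs S A M"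
  obtains y where "y \<in> homs S B M" "\<And>a. a \<in> carrier A \<Longrightarrow> y (h a) = x a"
proof -
  obtain A' :: "('v, 'f, 'r) struct" and p q where A': "A' \<in> ISP S M" and p: "p \<in> homs S A A'"
    and q: "q \<in> homs S A' A" and qp: "\<And>a. a \<in> carrier A \<Longrightarrow> q (p a) = a"
    and pq: "\<And>b. b \<in> carrier A' \<Longrightarrow> p (q b) = b"
    using ISP_copy[OF M A \<phi>(1)] by blast
  obtain B' :: "('v, 'f, 'r) struct" and p' q' where B': "B' \<in> ISP S M" and p': "p' \<in> homs S B B'"
    and q': "q' \<in> homs S B' B" and qp': "\<And>b. b \<in> carrier B \<Longrightarrow> q' (p' b) = b"
    using ISP_copy[OF M B \<phi>(2)] by blast
  note Bs = B[unfolded ISP_iff[OF M]] and As' = A'[unfolded ISP_iff[OF M]]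
  have sq: "separates_structure S {q} A' A"
    using p pq homs_carrier[OF q] by (intro separates_structure_left_inverse)
  have sp: "separates_structure S {p'} B B'"
    using q' qp' homs_carrier[OF p'] by (intro separates_structure_left_inverse)
  let ?hq = "compose (carrier A') h q" and ?h = "compose (carrier A') p' (compose (carrier A') h q)"
  have hq: "?hq \<in> homs S A' B" using As' homs_compose[OF _ q h(1)] by blast
  have h': "?h \<in> homs S A' B'" using As' homs_compose[OF _ hq p'] by blast
  have "separates_structure S {?hq} A' B"
    using embedding_compose[OF sq h(2)] homs_carrier[OF q] by blast
  then have "separates_structure S {?h} A' B'"
    using embedding_compose[OF _ sp] homs_carrier[OF hq] by blast
  then have "str_embedding S A' B' ?h" using h' As' str_embedding_iff by blast
  moreover have "compose (carrier A') x q \<in> homs S A' M" using As' homs_compose[OF _ q x] by blast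
  ultimately obtain y where y: "y \<in> homs S B' M"
    and yh: "\<And>a. a \<in> carrier A' \<Longrightarrow> y (?h a) = compose (carrier A') x q a"
    using inj A' B' unfolding injective_in_ISP_def by blast
  have "compose (carrier B) y p' \<in> homs S B M" using Bs homs_compose[OF _ p' y] by blast
  moreover have "compose (carrier B) y p' (h a) = x a" if a: "a \<in> carrier A" for a
    using yh[OF homs_carrier[OF p a]] homs_carrier[OF p a] homs_carrier[OF h(1) a] qp[OF a]
    by (simp add: compose_eq)
  ultimately show ?thesis using that by blast
qed

lemma injective_in_IScP_extend:
  fixes X :: "('a, 'f, 'r) top_struct" and Y :: "('b, 'f, 'r) top_struct"
    and \<phi> :: "'a \<Rightarrow> 'v" and \<psi> :: "'b \<Rightarrow> 'v" and U :: "'v itself"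
  assumes inj: "injective_in_IScP U S M" and M: "total_top_structure S M"
    and \<phi>: "inj \<phi>" "inj \<psi>" and X: "X \<in> IScP S M" and Y: "Y \<in> IScP S M"
    and h: "h \<in> cont_homs S X Y" "separates_structure S {h} X Y" and x: "\<alpha> \<in> cont_homs S X M"
  obtains \<beta> where "\<beta> \<in> cont_homs S Y M" "\<And>a. a \<in> carrier X \<Longrightarrow> \<beta> (h a) = \<alpha> a"
proof -
  obtain X' :: "('v, 'f, 'r) top_struct" and p q where X': "X' \<in> IScP S M" and p: "p \<in> cont_homs S X X'"
    and q: "q \<in> cont_homs S X' X" and qp: "\<And>a. a \<in> carrier X \<Longrightarrow> q (p a) = a"
    and pq: "\<And>b. b \<in> carrier X' \<Longrightarrow> p (q b) = b"
    using IScP_copy[OF M X \<phi>(1)] by blast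
  obtain Y' :: "('v, 'f, 'r) top_struct" and p' q' where Y': "Y' \<in> IScP S M" and p': "p' \<in> cont_homs S Y Y'"
    and q': "q' \<in> cont_homs S Y' Y" and qp': "\<And>b. b \<in> carrier Y \<Longrightarrow> q' (p' b) = b"
    using IScP_copy[OF M Y \<phi>(2)] by blast
  note Ys = Y[unfolded IScP_iff[OF M]] and Xs' = X'[unfolded IScP_iff[OF M]]
    and Ys' = Y'[unfolded IScP_iff[OF M]]
  note homs = p[THEN cont_homsD(1)] q[THEN cont_homsD(1)] p'[THEN cont_homsD(1)] q'[THEN cont_homsD(1)]
  have sq: "separates_structure S {q} X' X"
    using homs(1) pq homs_carrier[OF homs(2)] by (intro separates_structure_left_inverse)
  have sp: "separates_structure S {p'} Y Y'"
    using homs(4) qp' homs_carrier[OF homs(3)] by (intro separates_structure_left_inverse)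
  let ?hq = "compose (carrier X') h q" and ?h = "compose (carrier X') p' (compose (carrier X') h q)"
  have hq: "?hq \<in> cont_homs S X' Y" using Xs' cont_homs_compose[OF _ q h(1)] by blast
  have h': "?h \<in> cont_homs S X' Y'" using Xs' cont_homs_compose[OF _ hq p'] by blast
  have "separates_structure S {?hq} X' Y"
    using embedding_compose[OF sq h(2)] homs_carrier[OF homs(2)] by blast
  then have "separates_structure S {?h} X' Y'"
    using embedding_compose[OF _ sp] homs_carrier[OF cont_homsD(1)[OF hq]] by blast
  \<comment> \<open>Being in the class gives the Hausdorff property, which turns separation by
    \<open>?h\<close> into an embedding.\<close>
  moreover have "Hausdorff_space (topo Y')" using IScP_Hausdorff[OF M Y'] .
  ultimately have "top_embedding S X' Y' ?h" using h' Xs' Ys' top_embedding_iff by blast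
  moreover have "compose (carrier X') \<alpha> q \<in> cont_homs S X' M" using Xs' cont_homs_compose[OF _ q x] by blast
  ultimately obtain \<beta> where \<beta>: "\<beta> \<in> cont_homs S Y' M"
    and \<beta>h: "\<And>a. a \<in> carrier X' \<Longrightarrow> \<beta> (?h a) = compose (carrier X') \<alpha> q a"
    using inj X' Y' unfolding injective_in_IScP_def by blast
  have "compose (carrier Y) \<beta> p' \<in> cont_homs S Y M" using Ys cont_homs_compose[OF _ p' \<beta>] by blast
  moreover have "compose (carrier Y) \<beta> p' (h a) = \<alpha> a" if a: "a \<in> carrier X" for a
    using \<beta>h[OF homs_carrier[OF homs(1) a]] homs_carrier[OF homs(1) a]
      homs_carrier[OF cont_homsD(1)[OF h(1)] a] qp[OF a]
    by (simp add: compose_eq)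
  ultimately show ?thesis using that by blast
qed

section \<open>Dualities applied to carriers of another type\<close>

context alter_ego_pair
begin

text \<open>Surjectivity of the evaluation map is extracted from the duality. For \<open>A\<close>
  over another type, \<alpha> is moved to the dual of a copy, and the evaluation point found there
  is brought back.\<close>

lemma dualises_evaluation:
  fixes A :: "('a, 'f1, 'r1) struct" and \<phi> :: "'a \<Rightarrow> 'v" and U :: "'v itself"
  assumes dual: "dualises U S1 M S2 MT" and \<phi>: "inj \<phi>" and A: "A \<in> ISP S1 M"
    and \<alpha>: "\<alpha> \<in> cont_homs S2 (Dual S1 M S2 MT A) MT"
  obtains a where "a \<in> carrier A" "\<And>x. x \<in> homs S1 A M \<Longrightarrow> \<alpha> x = x a"
proof -
  obtain A' :: "('v, 'f1, 'r1) struct" and p q where A': "A' \<in> ISP S1 M" and p: "p \<in> homs S1 A A'"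
    and q: "q \<in> homs S1 A' A" and qp: "\<And>a. a \<in> carrier A \<Longrightarrow> q (p a) = a"
    using ISP_copy[OF M_structure A \<phi>] by blast
  have As: "is_structure S1 A" "is_structure S1 A'" using A A' by (auto simp: ISP_def)
  \<comment> \<open>\<open>P\<close> is the dual of the copying isomorphism \<open>p\<close>, namely
    precomposition with \<open>p\<close>; its coordinate at \<open>a\<close> is evaluation at
    \<open>p a\<close>.\<close>
  define P where "P = (\<lambda>x\<in>homs S1 A' M. compose (carrier A) x p)"
  have "P \<in> cont_homs S2 (Dual S1 M S2 MT A') (Dual S1 M S2 MT A)"
  proof (rule cont_hom_into_Dual[OF Dual_top(1)[OF As(2)]])
    show "P \<in> carrier (Dual S1 M S2 MT A') \<rightarrow>\<^sub>E homs S1 A M"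
      using homs_compose[OF As(1) p] by (auto simp: P_def)
    fix a assume a: "a \<in> carrier A"
    then have "(\<lambda>x\<in>carrier (Dual S1 M S2 MT A'). P x a) = (\<lambda>x\<in>homs S1 A' M. x (p a))"
      by (auto simp: P_def compose_eq fun_eq_iff)
    then show "(\<lambda>x\<in>carrier (Dual S1 M S2 MT A'). P x a) \<in> cont_homs S2 (Dual S1 M S2 MT A') MT"
      using evaluation_cont_hom[OF As(2) homs_carrier[OF p a]] by simp
  qed
  from cont_homs_compose[OF Dual_top(1)[OF As(2)] this \<alpha>]
  have \<alpha>': "compose (homs S1 A' M) \<alpha> P \<in> cont_homs S2 (Dual S1 M S2 MT A') MT" by simp
  have "str_iso S1 A' (Codual S1 M S2 MT (Dual S1 M S2 MT A')) (eval_alg S1 M A')"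
    using dual A' by (simp add: dualises_def)
  then obtain g where g: "g \<in> homs S1 (Codual S1 M S2 MT (Dual S1 M S2 MT A')) A'"
    and eg: "\<And>b. b \<in> carrier (Codual S1 M S2 MT (Dual S1 M S2 MT A')) \<Longrightarrow> eval_alg S1 M A' (g b) = b"
    unfolding str_iso_def by blast
  \<comment> \<open>The map \<open>g\<close> inverts the evaluation map of the copy, so the
    transported \<alpha> is evaluation at this element; for the original structure the point is
    \<open>q a\<close>.\<close>
  define a where "a = g (compose (homs S1 A' M) \<alpha> P)"
  have a: "a \<in> carrier A'" using homs_carrier[OF g] \<alpha>' by (simp add: a_def)
  have ev: "eval_alg S1 M A' a = compose (homs S1 A' M) \<alpha> P" using eg \<alpha>' by (simp add: a_def)
  have "\<alpha> x = x (q a)" if x: "x \<in> homs S1 A M" for x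
  proof -
    have xq: "compose (carrier A') x q \<in> homs S1 A' M" using homs_compose[OF As(2) q x] .
    have "compose (carrier A) (compose (carrier A') x q) p = x"
      using homs_carrier[OF p] qp homs_ext[OF x]
      by (intro extensionalityI[of _ "carrier A"]) (auto simp: compose_eq)
    then have "\<alpha> x = compose (homs S1 A' M) \<alpha> P (compose (carrier A') x q)"
      using xq by (simp add: compose_eq P_def)
    also have "\<dots> = x (q a)" using xq a by (simp flip: ev add: eval_alg_def compose_eq)
    finally show ?thesis .
  qed
  then show ?thesis using that homs_carrier[OF q a] by blast
qed

text \<open>The mirror image: surjectivity of the evaluation map of a copy of \<open>X\<close>, with
  the point carried back along \<open>q\<close>.\<close>

lemma codualises_evaluation:
  fixes X :: "('a, 'f2, 'r2) top_struct" and \<phi> :: "'a \<Rightarrow> 'v" and U :: "'v itself"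
  assumes dual: "codualises U S1 M S2 MT" and \<phi>: "inj \<phi>" and X: "X \<in> IScP S2 MT"
    and h: "h \<in> homs S1 (Codual S1 M S2 MT X) M"
  obtains x where "x \<in> carrier X" "\<And>\<alpha>. \<alpha> \<in> cont_homs S2 X MT \<Longrightarrow> h \<alpha> = \<alpha> x"
proof -
  obtain X' :: "('v, 'f2, 'r2) top_struct" and p q where X': "X' \<in> IScP S2 MT"
    and p: "p \<in> cont_homs S2 X X'"
    and q: "q \<in> cont_homs S2 X' X" and qp: "\<And>a. a \<in> carrier X \<Longrightarrow> q (p a) = a"
    using IScP_copy[OF total_MT X \<phi>] by blast
  have Xs: "is_top_structure S2 X" "is_top_structure S2 X'" using X X' by (auto simp: IScP_def)
  define P where "P = (\<lambda>\<alpha>\<in>cont_homs S2 X' MT. compose (carrier X) \<alpha> p)"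
  have "P \<in> homs S1 (Codual S1 M S2 MT X') (Codual S1 M S2 MT X)"
  proof (rule hom_into_Codual[OF Codual_structure[OF Xs(2)]])
    show "P \<in> carrier (Codual S1 M S2 MT X') \<rightarrow>\<^sub>E cont_homs S2 X MT"
      using cont_homs_compose[OF Xs(1) p] by (auto simp: P_def)
    fix x assume x: "x \<in> carrier X"
    then have "(\<lambda>\<alpha>\<in>carrier (Codual S1 M S2 MT X'). P \<alpha> x) = (\<lambda>\<alpha>\<in>cont_homs S2 X' MT. \<alpha> (p x))"
      by (auto simp: P_def compose_eq fun_eq_iff)
    then show "(\<lambda>\<alpha>\<in>carrier (Codual S1 M S2 MT X'). P \<alpha> x) \<in> homs S1 (Codual S1 M S2 MT X') M"
      using evaluation_hom[OF Xs(2) homs_carrier[OF cont_homsD(1)[OF p] x]] by simp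
  qed
  from homs_compose[OF Codual_structure[OF Xs(2)] this h]
  have h': "compose (cont_homs S2 X' MT) h P \<in> homs S1 (Codual S1 M S2 MT X') M" by simp
  have "top_iso S2 X' (Dual S1 M S2 MT (Codual S1 M S2 MT X')) (eval_top S2 MT X')"
    using dual X' by (simp add: codualises_def)
  then obtain g where g: "g \<in> cont_homs S2 (Dual S1 M S2 MT (Codual S1 M S2 MT X')) X'"
    and eg: "\<And>b. b \<in> carrier (Dual S1 M S2 MT (Codual S1 M S2 MT X')) \<Longrightarrow> eval_top S2 MT X' (g b) = b"
    unfolding top_iso_def by blast
  define x where "x = g (compose (cont_homs S2 X' MT) h P)"
  have x: "x \<in> carrier X'" using homs_carrier[OF cont_homsD(1)[OF g]] h' by (simp add: x_def)
  have ev: "eval_top S2 MT X' x = compose (cont_homs S2 X' MT) h P" using eg h' by (simp add: x_def)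
  have "h \<alpha> = \<alpha> (q x)" if \<alpha>: "\<alpha> \<in> cont_homs S2 X MT" for \<alpha>
  proof -
    have \<alpha>q: "compose (carrier X') \<alpha> q \<in> cont_homs S2 X' MT" using cont_homs_compose[OF Xs(2) q \<alpha>] .
    have "compose (carrier X) (compose (carrier X') \<alpha> q) p = \<alpha>"
      using homs_carrier[OF cont_homsD(1)[OF p]] qp homs_ext[OF cont_homsD(1)[OF \<alpha>]]
      by (intro extensionalityI[of _ "carrier X"]) (auto simp: compose_eq)
    then have "h \<alpha> = compose (cont_homs S2 X' MT) h P (compose (carrier X') \<alpha> q)"
      using \<alpha>q by (simp add: compose_eq P_def)
    also have "\<dots> = \<alpha> (q x)" using \<alpha>q x by (simp flip: ev add: eval_top_def compose_eq)
    finally show ?thesis .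
  qed
  then show ?thesis using that homs_carrier[OF cont_homsD(1)[OF q] x] by blast
qed

end

section \<open>The piggyback argument\<close>

lemma unary_term_closed:
  "is_structure S A \<Longrightarrow> wf_trm S 1 t \<Longrightarrow> a \<in> carrier A \<Longrightarrow> eval_trm A (\<lambda>k\<in>{..<1}. a) t \<in> carrier A"
  by (rule eval_trm_closed) auto

lemma hom_unary_term:
  "is_structure S A \<Longrightarrow> wf_trm S 1 t \<Longrightarrow> a \<in> carrier A \<Longrightarrow> h \<in> homs S A B \<Longrightarrow>
   h (eval_trm A (\<lambda>k\<in>{..<1}. a) t) = eval_trm B (\<lambda>k\<in>{..<1}. h a) t"
  by (rule hom_eval_trm) auto

text \<open>If \<open>Z\<close> is closed under composition with the unary term functions of \<open>M'\<close>, then these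
  may be absorbed in the hypothesis that \<open>\<omega>\<close> separates.\<close>

lemma separates_absorb_terms:
  assumes A: "is_structure S A" and J: "wf_interp S R J"
    and Z: "Z \<subseteq> homs S A M" "separates_structure S Z A M"
    and W: "separates_structure R ((\<circ>) \<omega> ` Clo1 S' M') (reduct R J M) N"
    and M': "carrier M' = carrier M"
    and closed: "\<And>t z. wf_trm S' 1 t \<Longrightarrow> z \<in> Z \<Longrightarrow>
      \<exists>z'\<in>Z. \<forall>a\<in>carrier A. z' a = eval_trm M' (\<lambda>k\<in>{..<1}. z a) t"
  shows "separates_structure R {\<lambda>a\<in>carrier A. \<omega> (z a) |z. z \<in> Z} (reduct R J A) N"
proof -
  have ZM: "z a \<in> carrier M" if "z \<in> Z" "a \<in> carrier A" for z a
    using that Z(1) homs_carrier[of z S A M a] by auto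
  \<comment> \<open>Two families are composed: \<open>Z\<close> separates the reduct of
    \<open>A\<close> with values in the reduct of \<open>M\<close>, and the maps \<omega> after a
    unary term function separate the latter with values in \<open>N\<close>.\<close>
  have "separates_structure R
      {compose (carrier (reduct R J A)) w z |w z. w \<in> (\<circ>) \<omega> ` Clo1 S' M' \<and> z \<in> Z} (reduct R J A) N"
    using ZM by (intro separates_structure_compose[OF separates_reduct[OF A J Z] W]) simp
  then show ?thesis
  proof (rule separates_structure_mono)
    fix y assume "y \<in> {compose (carrier (reduct R J A)) w z |w z. w \<in> (\<circ>) \<omega> ` Clo1 S' M' \<and> z \<in> Z}"
    then obtain u z where u: "u \<in> Clo1 S' M'" and z: "z \<in> Z" and y: "y = compose (carrier A) (\<omega> \<circ> u) z"
      by auto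
    obtain t where t: "wf_trm S' 1 t" and ut: "u = (\<lambda>a\<in>carrier M'. eval_trm M' (\<lambda>k\<in>{..<1}. a) t)"
      using u by (rule Clo1_trm)
    obtain z' where z': "z' \<in> Z" "\<forall>a\<in>carrier A. z' a = eval_trm M' (\<lambda>k\<in>{..<1}. z a) t"
      using closed[OF t z] by blast
    have "(\<lambda>a\<in>carrier A. \<omega> (z' a)) a = y a" if "a \<in> carrier A" for a
      using that z' ZM[OF z that] by (simp add: y compose_eq ut M')
    then show "\<exists>z'\<in>{\<lambda>a\<in>carrier A. \<omega> (z a) |z. z \<in> Z}. \<forall>a\<in>carrier (reduct R J A). z' a = y a"
      using z'(1) by (intro bexI[of _ "\<lambda>a\<in>carrier A. \<omega> (z' a)"]) auto
  qed
qed

text \<open>An element is coded as the indicator function of its singleton; the two values needed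
  are furnished by \<open>Inl\<close> and \<open>Inr\<close>, which always differ.\<close>

lemma inj_singleton_map: "inj (\<lambda>u v :: 'a. if v = u then Inl undefined else Inr undefined)"
  by (rule injI) (metis sum.distinct(1))

text \<open>The first injection serves duals and coduals over \<open>M\<close>, the second those
  over \<open>N\<close>.\<close>

lemma inj_comp_Inl: "inj (\<lambda>f. Inl \<circ> f)" and inj_comp_Inr: "inj (\<lambda>f. Inr \<circ> f)"
  by (auto simp: inj_on_def fun_eq_iff)

lemma carrier_top_reduct [simp]: "carrier (top_reduct R J X) = carrier X"
  and topo_top_reduct [simp]: "topo (top_reduct R J X) = topo X"
  by (simp_all add: top_reduct_def)

text \<open>The duality for \<open>N\<close> is applied to structures whose elements have type \<open>'u\<close>, \<open>'u \<Rightarrow> 'm\<close> and \<open>'u \<Rightarrow> 'n\<close>;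
  all three types embed in \<open>'u \<Rightarrow> 'm + 'n\<close>.\<close>

locale piggyback =
  base: alter_ego_pair S1 M S2 MT + target: alter_ego_pair R1 N R2 NT
  for S1 :: "('f1, 'r1) signature" and M :: "('m, 'f1, 'r1) struct"
    and S2 :: "('f2, 'r2) signature" and MT :: "('m, 'f2, 'r2) top_struct"
    and R1 :: "('g1, 's1) signature" and N :: "('n, 'g1, 's1) struct"
    and R2 :: "('g2, 's2) signature" and NT :: "('n, 'g2, 's2) top_struct" +
  fixes U :: "('u \<Rightarrow> 'm + 'n) itself"
    and J1 :: "('f1, 'r1, 'g1, 's1) interp" and J2 :: "('f2, 'r2, 'g2, 's2) interp"
    and \<omega> :: "'m \<Rightarrow> 'n"
  assumes dual_N: "dualises U R1 N R2 NT" and codual_N: "codualises U R1 N R2 NT"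
    and inj_NT: "injective_in_IScP U R2 NT" and inj_N: "injective_in_ISP U R1 N"
    and J1: "wf_interp S1 R1 J1" and J2: "wf_interp S2 R2 J2"
    and \<omega>_hom: "\<omega> \<in> homs R1 (reduct R1 J1 M) N"
    and \<omega>_cont_hom: "\<omega> \<in> cont_homs R2 (top_reduct R2 J2 MT) NT"
    and separates_M: "separates_structure R1 ((\<circ>) \<omega> ` Clo1 S2 MT) (reduct R1 J1 M) N"
    and separates_MT: "separates_structure R2 ((\<circ>) \<omega> ` Clo1 S1 M) (top_reduct R2 J2 MT) NT"
begin

abbreviation "D \<equiv> Dual S1 M S2 MT"
abbreviation "E \<equiv> Codual S1 M S2 MT"
abbreviation "H \<equiv> Dual R1 N R2 NT"
abbreviation "K \<equiv> Codual R1 N R2 NT"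
abbreviation flat :: "('a, 'f1, 'r1) struct \<Rightarrow> ('a, 'g1, 's1) struct" where
  "flat \<equiv> reduct R1 J1"
abbreviation tflat :: "('a, 'f2, 'r2) top_struct \<Rightarrow> ('a, 'g2, 's2) top_struct" where
  "tflat \<equiv> top_reduct R2 J2"

definition \<Phi> :: "('a, 'f1, 'r1) struct \<Rightarrow> ('a \<Rightarrow> 'm) \<Rightarrow> 'a \<Rightarrow> 'n" where
  "\<Phi> A = (\<lambda>x\<in>homs S1 A M. compose (carrier A) \<omega> x)"

definition \<Psi> :: "('a, 'f2, 'r2) top_struct \<Rightarrow> ('a \<Rightarrow> 'm) \<Rightarrow> 'a \<Rightarrow> 'n" where
  "\<Psi> X = (\<lambda>\<alpha>\<in>cont_homs S2 X MT. compose (carrier X) \<omega> \<alpha>)"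

section \<open>Composition with \<omega>, and unary terms acting on duals and coduals\<close>

lemma compose_\<omega>_hom:
  assumes "is_structure S1 A" "x \<in> homs S1 A M"
  shows "compose (carrier A) \<omega> x \<in> homs R1 (flat A) N"
  using homs_compose[OF structure_reduct[OF assms(1) J1] homs_reduct[OF assms(1) J1 assms(2)] \<omega>_hom]
  by simp

lemma compose_\<omega>_cont_hom:
  assumes "is_top_structure S2 X" "\<alpha> \<in> cont_homs S2 X MT"
  shows "compose (carrier X) \<omega> \<alpha> \<in> cont_homs R2 (tflat X) NT"
  using cont_homs_compose[OF top_structure_reduct[OF assms(1) J2]
      cont_homs_reduct[OF top_structureD(1)[OF assms(1)] J2 assms(2)] \<omega>_cont_hom]
  by simp

lemma ISP_structure: "A \<in> ISP S1 M \<Longrightarrow> is_structure S1 A" "A \<in> ISP S1 M \<Longrightarrow> carrier A \<noteq> {}"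
  by (auto simp: ISP_def)

lemma IScP_structure: "X \<in> IScP S2 MT \<Longrightarrow> is_top_structure S2 X"
  by (auto simp: IScP_def)

text \<open>Evaluating the term inside \<open>D A\<close> shows at once that the result is again a
  homomorphism. Evaluations and \<alpha> are morphisms on \<open>D A\<close>, so both commute with
  the term; the last claim is what later removes \<omega> from an equation.\<close>

lemma term_on_Dual:
  assumes "is_structure S1 A" "wf_trm S2 1 t" "x \<in> homs S1 A M"
  defines "x' \<equiv> eval_trm (D A) (\<lambda>k\<in>{..<1}. x) t"
  shows "x' \<in> homs S1 A M" "a \<in> carrier A \<Longrightarrow> x' a = eval_trm MT (\<lambda>k\<in>{..<1}. x a) t"
    "\<alpha> \<in> cont_homs S2 (D A) MT \<Longrightarrow> \<alpha> x' = eval_trm MT (\<lambda>k\<in>{..<1}. \<alpha> x) t"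
proof -
  note DA = top_structureD(1)[OF base.Dual_top(1)[OF assms(1)]]
  show x': "x' \<in> homs S1 A M"
    using unary_term_closed[OF DA assms(2), of x] assms(3) by (simp add: x'_def)
  show "x' a = eval_trm MT (\<lambda>k\<in>{..<1}. x a) t" if "a \<in> carrier A"
    using hom_unary_term[OF DA assms(2) _ cont_homsD(1)[OF base.evaluation_cont_hom[OF assms(1) that]], of x]
      assms(3) x' by (simp add: x'_def)
  show "\<alpha> x' = eval_trm MT (\<lambda>k\<in>{..<1}. \<alpha> x) t" if "\<alpha> \<in> cont_homs S2 (D A) MT"
    using hom_unary_term[OF DA assms(2) _ cont_homsD(1)[OF that], of x] assms(3) by (simp add: x'_def)
qed

lemma term_on_Codual:
  assumes "is_top_structure S2 X" "wf_trm S1 1 t" "\<alpha> \<in> cont_homs S2 X MT"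
  defines "\<alpha>' \<equiv> eval_trm (E X) (\<lambda>k\<in>{..<1}. \<alpha>) t"
  shows "\<alpha>' \<in> cont_homs S2 X MT" "x \<in> carrier X \<Longrightarrow> \<alpha>' x = eval_trm M (\<lambda>k\<in>{..<1}. \<alpha> x) t"
    "h \<in> homs S1 (E X) M \<Longrightarrow> h \<alpha>' = eval_trm M (\<lambda>k\<in>{..<1}. h \<alpha>) t"
proof -
  note EX = base.Codual_structure[OF assms(1)]
  show \<alpha>': "\<alpha>' \<in> cont_homs S2 X MT"
    using unary_term_closed[OF EX assms(2), of \<alpha>] assms(3) by (simp add: \<alpha>'_def)
  show "\<alpha>' x = eval_trm M (\<lambda>k\<in>{..<1}. \<alpha> x) t" if "x \<in> carrier X"
    using hom_unary_term[OF EX assms(2) _ base.evaluation_hom[OF assms(1) that], of \<alpha>]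
      assms(3) \<alpha>' by (simp add: \<alpha>'_def)
  show "h \<alpha>' = eval_trm M (\<lambda>k\<in>{..<1}. h \<alpha>) t" if "h \<in> homs S1 (E X) M"
    using hom_unary_term[OF EX assms(2) _ that, of \<alpha>] assms(3) by (simp add: \<alpha>'_def)
qed

text \<open>Terms of \<open>MT\<close> are absorbed by the homomorphisms: applying such a term to
  \<open>x\<close> in \<open>D A\<close> gives another member of \<open>D A\<close>.\<close>

lemma separates_flat:
  assumes "A \<in> ISP S1 M"
  shows "separates_structure R1 {\<lambda>a\<in>carrier A. \<omega> (x a) |x. x \<in> homs S1 A M} (flat A) N"
proof (rule separates_absorb_terms[OF _ J1 _ _ separates_M base.carrier_MT])
  show A: "is_structure S1 A" using ISP_structure assms by blast
  show "separates_structure S1 (homs S1 A M) A M"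
    using assms unfolding ISP_iff[OF base.M_structure] by simp
  show "\<exists>x'\<in>homs S1 A M. \<forall>a\<in>carrier A. x' a = eval_trm MT (\<lambda>k\<in>{..<1}. x a) t"
    if "wf_trm S2 1 t" "x \<in> homs S1 A M" for t x
    using term_on_Dual[OF A that] by blast
qed simp

text \<open>Here the separating maps are evaluations, and a term of \<open>MT\<close> is absorbed by
  moving the point: every \<alpha> commutes with it, so applying the term to
  \<open>\<alpha> x\<close> is evaluating \<alpha> at the term applied to \<open>x\<close>.\<close>

lemma separates_flat_Codual:
  assumes X: "is_top_structure S2 X"
  shows "separates_structure R1 {\<lambda>\<alpha>\<in>cont_homs S2 X MT. \<omega> (\<alpha> x) |x. x \<in> carrier X} (flat (E X)) N"
proof -
  let ?Z = "{\<lambda>\<alpha>\<in>cont_homs S2 X MT. \<alpha> x |x. x \<in> carrier X}"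
  have "separates_structure R1 {\<lambda>\<alpha>\<in>carrier (E X). \<omega> (z \<alpha>) |z. z \<in> ?Z} (flat (E X)) N"
  proof (rule separates_absorb_terms[OF base.Codual_structure[OF X] J1 _
        base.evaluations_separate_Codual separates_M base.carrier_MT])
    show "?Z \<subseteq> homs S1 (E X) M" using base.evaluation_hom[OF X] by blast
    fix t z assume t: "wf_trm S2 1 t" and "z \<in> ?Z"
    then obtain x where x: "x \<in> carrier X" and z: "z = (\<lambda>\<alpha>\<in>cont_homs S2 X MT. \<alpha> x)" by blast
    let ?x = "eval_trm X (\<lambda>k\<in>{..<1}. x) t"
    have x': "?x \<in> carrier X" using unary_term_closed[OF top_structureD(1)[OF X] t x] .
    have "(\<lambda>\<alpha>\<in>cont_homs S2 X MT. \<alpha> ?x) \<alpha> = eval_trm MT (\<lambda>k\<in>{..<1}. z \<alpha>) t"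
      if "\<alpha> \<in> carrier (E X)" for \<alpha>
      using that hom_unary_term[OF top_structureD(1)[OF X] t x cont_homsD(1), of \<alpha> MT] by (simp add: z)
    then show "\<exists>z'\<in>?Z. \<forall>\<alpha>\<in>carrier (E X). z' \<alpha> = eval_trm MT (\<lambda>k\<in>{..<1}. z \<alpha>) t"
      using x' by blast
  qed
  then show ?thesis
    by (rule separates_structure_mono) (auto intro!: bexI)
qed

lemma separates_tflat:
  assumes "X \<in> IScP S2 MT"
  shows "separates_structure R2 {\<lambda>x\<in>carrier X. \<omega> (\<alpha> x) |\<alpha>. \<alpha> \<in> cont_homs S2 X MT} (tflat X) NT"
proof -
  have X: "is_top_structure S2 X" using IScP_structure assms by blast
  have W: "separates_structure R2 ((\<circ>) \<omega> ` Clo1 S1 M) (reduct R2 J2 MT) NT"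
    using separates_MT by (simp add: top_reduct_def)
  have "separates_structure R2 {\<lambda>x\<in>carrier X. \<omega> (\<alpha> x) |\<alpha>. \<alpha> \<in> cont_homs S2 X MT} (reduct R2 J2 X) NT"
  proof (rule separates_absorb_terms[OF top_structureD(1)[OF X] J2 _ _ W base.carrier_MT[symmetric]])
    show "separates_structure S2 (cont_homs S2 X MT) X MT"
      using assms unfolding IScP_iff[OF base.total_MT] by simp
    show "\<exists>\<alpha>'\<in>cont_homs S2 X MT. \<forall>x\<in>carrier X. \<alpha>' x = eval_trm M (\<lambda>k\<in>{..<1}. \<alpha> x) t"
      if "wf_trm S1 1 t" "\<alpha> \<in> cont_homs S2 X MT" for t \<alpha>
      using term_on_Codual[OF X that] by blast
  qed (auto simp: cont_homs_def)
  then show ?thesis by (simp add: top_reduct_def)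
qed

text \<open>Terms of \<open>M\<close> commute with every homomorphism \<open>x\<close>, so they are
  absorbed by moving the point \<open>a\<close> inside \<open>A\<close>.\<close>

lemma separates_tflat_Dual:
  assumes A: "is_structure S1 A"
  shows "separates_structure R2 {\<lambda>x\<in>homs S1 A M. \<omega> (x a) |a. a \<in> carrier A} (tflat (D A)) NT"
proof -
  let ?Z = "{\<lambda>x\<in>homs S1 A M. x a |a. a \<in> carrier A}"
  note DA = top_structureD(1)[OF base.Dual_top(1)[OF A]]
  have W: "separates_structure R2 ((\<circ>) \<omega> ` Clo1 S1 M) (reduct R2 J2 MT) NT"
    using separates_MT by (simp add: top_reduct_def)
  have "separates_structure R2 {\<lambda>x\<in>carrier (D A). \<omega> (z x) |z. z \<in> ?Z} (reduct R2 J2 (D A)) NT"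
  proof (rule separates_absorb_terms[OF DA J2 _
        base.evaluations_separate_Dual W base.carrier_MT[symmetric]])
    show "?Z \<subseteq> homs S2 (D A) MT" using cont_homsD(1)[OF base.evaluation_cont_hom[OF A]] by blast
    fix t z assume t: "wf_trm S1 1 t" and "z \<in> ?Z"
    then obtain a where a: "a \<in> carrier A" and z: "z = (\<lambda>x\<in>homs S1 A M. x a)" by blast
    let ?a = "eval_trm A (\<lambda>k\<in>{..<1}. a) t"
    have a': "?a \<in> carrier A" using unary_term_closed[OF A t a] .
    have "(\<lambda>x\<in>homs S1 A M. x ?a) x = eval_trm M (\<lambda>k\<in>{..<1}. z x) t" if "x \<in> carrier (D A)" for x
      using that hom_unary_term[OF A t a, of x M] by (simp add: z)
    then show "\<exists>z'\<in>?Z. \<forall>x\<in>carrier (D A). z' x = eval_trm M (\<lambda>k\<in>{..<1}. z x) t"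
      using a' by blast
  qed
  then have "separates_structure R2 {\<lambda>x\<in>carrier (D A). \<omega> (z x) |z. z \<in> ?Z} (tflat (D A)) NT"
    by (simp add: top_reduct_def)
  then show ?thesis
    by (rule separates_structure_mono) (auto intro!: bexI)
qed

section \<open>Reducts in the classes of \<open>N\<close>, and the embeddings \<Phi> and
  \<Psi>\<close>

lemma flat_in_ISP:
  assumes "A \<in> ISP S1 M"
  shows "flat A \<in> ISP R1 N"
proof -
  note A = ISP_structure[OF assms]
  have "separates_structure R1 (homs R1 (flat A) N) (flat A) N"
    by (rule separates_structure_mono[OF separates_flat[OF assms]])
       (use compose_\<omega>_hom[OF A(1)] in \<open>auto simp: compose_def\<close>)
  then show ?thesis
    using A structure_reduct[OF A(1) J1] unfolding ISP_iff[OF target.M_structure] by simp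
qed

lemma tflat_in_IScP:
  assumes "X \<in> IScP S2 MT"
  shows "tflat X \<in> IScP R2 NT"
proof -
  have X: "is_top_structure S2 X" "compact_space (topo X)" "cont_homs S2 X MT \<noteq> {}"
    using assms unfolding IScP_iff[OF base.total_MT] by simp_all
  have "separates_structure R2 (cont_homs R2 (tflat X) NT) (tflat X) NT"
    by (rule separates_structure_mono[OF separates_tflat[OF assms]])
       (use compose_\<omega>_cont_hom[OF X(1)] in \<open>auto simp: compose_def\<close>)
  moreover have "cont_homs R2 (tflat X) NT \<noteq> {}" using compose_\<omega>_cont_hom[OF X(1)] X(3) by blast
  ultimately show ?thesis
    using X top_structure_reduct[OF X(1) J2] unfolding IScP_iff[OF target.total_MT] by simp
qed

text \<open>The coordinate at \<open>a\<close> is \<omega> after evaluation at \<open>a\<close>.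
  Evaluation is a morphism from \<open>D A\<close> to \<open>MT\<close>, hence also between the
  reducts, where \<omega> can follow it.\<close>

lemma \<Phi>_cont_hom:
  assumes A: "is_structure S1 A"
  shows "\<Phi> A \<in> cont_homs R2 (tflat (D A)) (H (flat A))"
proof (rule target.cont_hom_into_Dual)
  note DA = base.Dual_top(1)[OF A]
  show "is_top_structure R2 (tflat (D A))" using DA J2 by (rule top_structure_reduct)
  show "\<Phi> A \<in> carrier (tflat (D A)) \<rightarrow>\<^sub>E homs R1 (flat A) N"
    using compose_\<omega>_hom[OF A] by (auto simp: \<Phi>_def)
  fix a assume "a \<in> carrier (flat A)"
  then have a: "a \<in> carrier A" by simp
  have "(\<lambda>x\<in>carrier (tflat (D A)). \<Phi> A x a) = compose (homs S1 A M) \<omega> (\<lambda>x\<in>homs S1 A M. x a)"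
    using a by (auto simp: \<Phi>_def compose_def fun_eq_iff)
  then show "(\<lambda>x\<in>carrier (tflat (D A)). \<Phi> A x a) \<in> cont_homs R2 (tflat (D A)) NT"
    using compose_\<omega>_cont_hom[OF DA base.evaluation_cont_hom[OF A a]] by simp
qed

text \<open>The coordinates of \<open>\<Phi> A\<close> are precisely the maps, \<omega> after
  evaluation at a point, that have been shown to separate the reduct of \<open>D A\<close>.\<close>

lemma \<Phi>_embedding:
  assumes A: "is_structure S1 A"
  shows "separates_structure R2 {\<Phi> A} (tflat (D A)) (H (flat A))"
proof (rule target.embedding_into_Dual[OF separates_tflat_Dual[OF A]])
  show "\<Phi> A x \<in> homs R1 (flat A) N" if "x \<in> carrier (tflat (D A))" for x
    using that compose_\<omega>_hom[OF A] by (simp add: \<Phi>_def)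
qed (auto simp: \<Phi>_def compose_def)

lemma \<Psi>_hom:
  assumes X: "is_top_structure S2 X"
  shows "\<Psi> X \<in> homs R1 (flat (E X)) (K (tflat X))"
proof (rule target.hom_into_Codual)
  note EX = base.Codual_structure[OF X]
  show "is_structure R1 (flat (E X))" using EX J1 by (rule structure_reduct)
  show "\<Psi> X \<in> carrier (flat (E X)) \<rightarrow>\<^sub>E cont_homs R2 (tflat X) NT"
    using compose_\<omega>_cont_hom[OF X] by (auto simp: \<Psi>_def)
  fix x assume "x \<in> carrier (tflat X)"
  then have x: "x \<in> carrier X" by simp
  have "(\<lambda>\<alpha>\<in>carrier (flat (E X)). \<Psi> X \<alpha> x) = compose (cont_homs S2 X MT) \<omega> (\<lambda>\<alpha>\<in>cont_homs S2 X MT. \<alpha> x)"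
    using x by (auto simp: \<Psi>_def compose_def fun_eq_iff)
  then show "(\<lambda>\<alpha>\<in>carrier (flat (E X)). \<Psi> X \<alpha> x) \<in> homs R1 (flat (E X)) N"
    using compose_\<omega>_hom[OF EX base.evaluation_hom[OF X x]] by simp
qed

lemma \<Psi>_embedding:
  assumes X: "is_top_structure S2 X"
  shows "separates_structure R1 {\<Psi> X} (flat (E X)) (K (tflat X))"
proof (rule target.embedding_into_Codual[OF separates_flat_Codual[OF X]])
  show "\<Psi> X \<alpha> \<in> cont_homs R2 (tflat X) NT" if "\<alpha> \<in> carrier (flat (E X))" for \<alpha>
    using that compose_\<omega>_cont_hom[OF X] by (simp add: \<Psi>_def)
qed (auto simp: \<Psi>_def compose_def)

section \<open>Morphisms on reducts of duals and coduals\<close>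

lemma cont_hom_on_tflat_Dual:
  fixes A :: "('u, 'f1, 'r1) struct"
  assumes A: "A \<in> ISP S1 M" and \<beta>: "\<beta> \<in> cont_homs R2 (tflat (D A)) NT"
  obtains a where "a \<in> carrier A" "\<And>x. x \<in> homs S1 A M \<Longrightarrow> \<beta> x = \<omega> (x a)"
proof -
  note As = ISP_structure[OF A]
  have fA: "flat A \<in> ISP R1 N" using A by (rule flat_in_ISP)
  have "tflat (D A) \<in> IScP R2 NT" using base.Dual_in_IScP[OF As] by (rule tflat_in_IScP)
  moreover have "H (flat A) \<in> IScP R2 NT"
    using target.Dual_in_IScP[OF structure_reduct[OF As(1) J1]] As(2) by simp
  \<comment> \<open>The elements of the two structures have types \<open>'u \<Rightarrow> 'm\<close>
    and \<open>'u \<Rightarrow> 'n\<close>, hence the two different injections.\<close>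
  ultimately obtain \<beta>' where \<beta>': "\<beta>' \<in> cont_homs R2 (H (flat A)) NT"
    and ext: "\<And>x. x \<in> carrier (tflat (D A)) \<Longrightarrow> \<beta>' (\<Phi> A x) = \<beta> x"
    using injective_in_IScP_extend[OF inj_NT target.total_MT inj_comp_Inl inj_comp_Inr _ _
        \<Phi>_cont_hom[OF As(1)] \<Phi>_embedding[OF As(1)] \<beta>] by metis
  obtain a where a: "a \<in> carrier (flat A)" "\<And>y. y \<in> homs R1 (flat A) N \<Longrightarrow> \<beta>' y = y a"
    using target.dualises_evaluation[OF dual_N inj_singleton_map fA \<beta>'] by metis
  have "\<beta> x = \<omega> (x a)" if "x \<in> homs S1 A M" for x
    using that ext[of x] a(1) a(2)[OF compose_\<omega>_hom[OF As(1) that]] by (simp add: \<Phi>_def compose_eq)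
  then show ?thesis using that a(1) by simp
qed

lemma hom_on_flat_Codual:
  fixes X :: "('u, 'f2, 'r2) top_struct"
  assumes X: "X \<in> IScP S2 MT" and h: "h \<in> homs R1 (flat (E X)) N"
  obtains x where "x \<in> carrier X" "\<And>\<alpha>. \<alpha> \<in> cont_homs S2 X MT \<Longrightarrow> h \<alpha> = \<omega> (\<alpha> x)"
proof -
  note Xs = IScP_structure[OF X]
  have fX: "tflat X \<in> IScP R2 NT" using X by (rule tflat_in_IScP)
  \<comment> \<open>The non-empty exponent in the class of \<open>X\<close> makes \<open>E X\<close>
    non-empty, which membership in the algebraic class demands.\<close>
  have "cont_homs S2 X MT \<noteq> {}" using X unfolding IScP_iff[OF base.total_MT] by simp
  then have "flat (E X) \<in> ISP R1 N" using base.Codual_in_ISP[OF Xs] by (intro flat_in_ISP)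
  moreover have "K (tflat X) \<in> ISP R1 N"
    using target.Codual_in_ISP[OF top_structure_reduct[OF Xs J2]] fX
    unfolding IScP_iff[OF target.total_MT] by simp
  ultimately obtain h' where h': "h' \<in> homs R1 (K (tflat X)) N"
    and ext: "\<And>\<alpha>. \<alpha> \<in> carrier (flat (E X)) \<Longrightarrow> h' (\<Psi> X \<alpha>) = h \<alpha>"
    using injective_in_ISP_extend[OF inj_N target.M_structure inj_comp_Inl inj_comp_Inr _ _
        \<Psi>_hom[OF Xs] \<Psi>_embedding[OF Xs] h] by metis
  obtain x where x: "x \<in> carrier (tflat X)" "\<And>\<beta>. \<beta> \<in> cont_homs R2 (tflat X) NT \<Longrightarrow> h' \<beta> = \<beta> x"
    using target.codualises_evaluation[OF codual_N inj_singleton_map fX h'] by metis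
  have "h \<alpha> = \<omega> (\<alpha> x)" if "\<alpha> \<in> cont_homs S2 X MT" for \<alpha>
    using that ext[of \<alpha>] x(1) x(2)[OF compose_\<omega>_cont_hom[OF Xs that]] by (simp add: \<Psi>_def compose_eq)
  then show ?thesis using that x(1) by simp
qed

text \<open>The previous two lemmas say that \<open>\<omega>\<close> makes \<open>flat A\<close> the codual of \<open>tflat (D A)\<close>, and \<open>tflat X\<close>
  the dual of \<open>flat (E X)\<close>; transporting a morphism along these isomorphisms and applying the
  duality for \<open>N\<close> shows that it factors through \<open>\<omega>\<close>.\<close>

lemma \<Phi>_surj:
  fixes A :: "('u, 'f1, 'r1) struct"
  assumes A: "A \<in> ISP S1 M" and y: "y \<in> homs R1 (flat A) N"
  obtains x where "x \<in> homs S1 A M" "y = compose (carrier A) \<omega> x"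
proof -
  note As = ISP_structure[OF A]
  note fA = structure_reduct[OF As(1) J1]
  have DA: "is_top_structure S2 (D A)" using base.Dual_top(1)[OF As(1)] .
  have tDA: "tflat (D A) \<in> IScP R2 NT" using base.Dual_in_IScP[OF As] by (rule tflat_in_IScP)
  then have tDA_top: "is_top_structure R2 (tflat (D A))" by (simp add: IScP_def)
  \<comment> \<open>\<open>T a\<close> is the evaluation of the reduct of \<open>A\<close> at
    \<open>a\<close>, restricted along \<open>\<Phi> A\<close> from its dual over \<open>N\<close>
    to \<open>D A\<close>.\<close>
  define T where "T = (\<lambda>a\<in>carrier A. \<lambda>x\<in>homs S1 A M. \<omega> (x a))"
  have Tc: "T a \<in> cont_homs R2 (tflat (D A)) NT" if a: "a \<in> carrier A" for a
  proof -
    have "T a = compose (homs S1 A M) \<omega> (\<lambda>x\<in>homs S1 A M. x a)"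
      using a by (auto simp: T_def compose_def fun_eq_iff)
    then show ?thesis
      using compose_\<omega>_cont_hom[OF DA base.evaluation_cont_hom[OF As(1) a]] by simp
  qed
  have T: "T \<in> homs R1 (flat A) (K (tflat (D A)))"
  proof (rule target.hom_into_Codual[OF fA])
    show "T \<in> carrier (flat A) \<rightarrow>\<^sub>E cont_homs R2 (tflat (D A)) NT" using Tc by (auto simp: T_def)
    fix x assume "x \<in> carrier (tflat (D A))"
    then have x: "x \<in> homs S1 A M" by simp
    then have "(\<lambda>a\<in>carrier (flat A). T a x) = compose (carrier A) \<omega> x"
      by (auto simp: T_def compose_def fun_eq_iff)
    then show "(\<lambda>a\<in>carrier (flat A). T a x) \<in> homs R1 (flat A) N"
      using compose_\<omega>_hom[OF As(1) x] by simp
  qed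
  have sep: "separates_structure R1 {T} (flat A) (K (tflat (D A)))"
    by (rule target.embedding_into_Codual[OF separates_flat[OF A]]) (use Tc in \<open>auto simp: T_def\<close>)
  have "\<beta> \<in> T ` carrier A" if \<beta>: "\<beta> \<in> cont_homs R2 (tflat (D A)) NT" for \<beta>
  proof -
    obtain a where a: "a \<in> carrier A" "\<And>x. x \<in> homs S1 A M \<Longrightarrow> \<beta> x = \<omega> (x a)"
      using cont_hom_on_tflat_Dual[OF A \<beta>] by metis
    have "\<beta> = T a"
      by (rule homs_eqI[OF cont_homsD(1)[OF \<beta>] cont_homsD(1)[OF Tc[OF a(1)]]])
         (use a in \<open>simp add: T_def\<close>)
    then show ?thesis using a(1) by blast
  qed
  then have surj: "T ` carrier (flat A) = carrier (K (tflat (D A)))" using Tc by auto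
  obtain g where g: "g \<in> homs R1 (K (tflat (D A))) (flat A)"
    and gT: "\<And>a. a \<in> carrier (flat A) \<Longrightarrow> g (T a) = a"
    using inverse_hom[OF fA target.Codual_structure[OF tDA_top] T sep surj] by metis
  have "compose (carrier (K (tflat (D A)))) y g \<in> homs R1 (K (tflat (D A))) N"
    using homs_compose[OF target.Codual_structure[OF tDA_top] g y] .
  \<comment> \<open>The point provided by co-duality is an element of the reduct of
    \<open>D A\<close>, thus itself a homomorphism from \<open>A\<close> to \<open>M\<close>; it is
    the required preimage.\<close>
  then obtain x where x: "x \<in> carrier (tflat (D A))"
    and ev: "\<And>\<beta>. \<beta> \<in> cont_homs R2 (tflat (D A)) NT \<Longrightarrow> compose (carrier (K (tflat (D A)))) y g \<beta> = \<beta> x"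
    using target.codualises_evaluation[OF codual_N inj_comp_Inl tDA] by metis
  have "y a = compose (carrier A) \<omega> x a" if a: "a \<in> carrier A" for a
    using ev[OF Tc[OF a]] Tc[OF a] gT a x by (simp add: compose_eq) (simp add: T_def)
  then have "y = compose (carrier A) \<omega> x"
    using homs_ext[OF y] by (intro extensionalityI[of _ "carrier A"]) auto
  then show ?thesis using that x by simp
qed

lemma \<Psi>_surj:
  fixes X :: "('u, 'f2, 'r2) top_struct"
  assumes X: "X \<in> IScP S2 MT" and \<gamma>: "\<gamma> \<in> cont_homs R2 (tflat X) NT"
  obtains \<alpha> where "\<alpha> \<in> cont_homs S2 X MT" "\<gamma> = compose (carrier X) \<omega> \<alpha>"
proof -
  note Xs = IScP_structure[OF X]
  note tX = top_structure_reduct[OF Xs J2]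
  have comp: "compact_space (topo (tflat X))" and ne: "cont_homs S2 X MT \<noteq> {}"
    using X unfolding IScP_iff[OF base.total_MT] by simp_all
  note EX = base.Codual_structure[OF Xs]
  have fEX: "flat (E X) \<in> ISP R1 N" using base.Codual_in_ISP[OF Xs ne] by (rule flat_in_ISP)
  then have fEX_str: "is_structure R1 (flat (E X))" by (simp add: ISP_def)
  \<comment> \<open>\<open>T x\<close> is the evaluation of the reduct of \<open>X\<close> at
    \<open>x\<close>, restricted along \<open>\<Psi> X\<close>.\<close>
  define T where "T = (\<lambda>x\<in>carrier X. \<lambda>\<alpha>\<in>cont_homs S2 X MT. \<omega> (\<alpha> x))"
  have Tc: "T x \<in> homs R1 (flat (E X)) N" if x: "x \<in> carrier X" for x
  proof -
    have "T x = compose (cont_homs S2 X MT) \<omega> (\<lambda>\<alpha>\<in>cont_homs S2 X MT. \<alpha> x)"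
      using x by (auto simp: T_def compose_def fun_eq_iff)
    then show ?thesis using compose_\<omega>_hom[OF EX base.evaluation_hom[OF Xs x]] by simp
  qed
  have T: "T \<in> cont_homs R2 (tflat X) (H (flat (E X)))"
  proof (rule target.cont_hom_into_Dual[OF tX])
    show "T \<in> carrier (tflat X) \<rightarrow>\<^sub>E homs R1 (flat (E X)) N" using Tc by (auto simp: T_def)
    fix \<alpha> assume "\<alpha> \<in> carrier (flat (E X))"
    then have \<alpha>: "\<alpha> \<in> cont_homs S2 X MT" by simp
    then have "(\<lambda>x\<in>carrier (tflat X). T x \<alpha>) = compose (carrier X) \<omega> \<alpha>"
      by (auto simp: T_def compose_def fun_eq_iff)
    then show "(\<lambda>x\<in>carrier (tflat X). T x \<alpha>) \<in> cont_homs R2 (tflat X) NT"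
      using compose_\<omega>_cont_hom[OF Xs \<alpha>] by simp
  qed
  have sep: "separates_structure R2 {T} (tflat X) (H (flat (E X)))"
    by (rule target.embedding_into_Dual[OF separates_tflat[OF X]]) (use Tc in \<open>auto simp: T_def\<close>)
  have "h \<in> T ` carrier X" if h: "h \<in> homs R1 (flat (E X)) N" for h
  proof -
    obtain x where x: "x \<in> carrier X" "\<And>\<alpha>. \<alpha> \<in> cont_homs S2 X MT \<Longrightarrow> h \<alpha> = \<omega> (\<alpha> x)"
      using hom_on_flat_Codual[OF X h] by metis
    have "h = T x" by (rule homs_eqI[OF h Tc[OF x(1)]]) (use x in \<open>simp add: T_def\<close>)
    then show ?thesis using x(1) by blast
  qed
  then have surj: "carrier (H (flat (E X))) \<subseteq> T ` carrier (tflat X)" by auto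
  \<comment> \<open>The inverse is continuous because the reduct of \<open>X\<close> is compact and
    duals are Hausdorff; without continuity \<gamma> after \<open>g\<close> could not be fed into
    the duality for \<open>N\<close>.\<close>
  obtain g where g: "g \<in> cont_homs R2 (H (flat (E X))) (tflat X)"
    and gT: "\<And>x. x \<in> carrier (tflat X) \<Longrightarrow> g (T x) = x"
    using inverse_cont_hom[OF tX comp target.Dual_top(1,3)[OF fEX_str] T sep surj] by metis
  have "compose (carrier (H (flat (E X)))) \<gamma> g \<in> cont_homs R2 (H (flat (E X))) NT"
    using cont_homs_compose[OF target.Dual_top(1)[OF fEX_str] g \<gamma>] .
  \<comment> \<open>The element at which this morphism evaluates lies in \<open>E X\<close>, so it
    is a continuous morphism from \<open>X\<close> to \<open>MT\<close>.\<close>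
  then obtain \<alpha> where \<alpha>: "\<alpha> \<in> carrier (flat (E X))"
    and ev: "\<And>h. h \<in> homs R1 (flat (E X)) N \<Longrightarrow> compose (carrier (H (flat (E X)))) \<gamma> g h = h \<alpha>"
    using target.dualises_evaluation[OF dual_N inj_comp_Inl fEX] by metis
  have "\<gamma> x = compose (carrier X) \<omega> \<alpha> x" if x: "x \<in> carrier X" for x
    using ev[OF Tc[OF x]] Tc[OF x] gT x \<alpha> by (simp add: compose_eq) (simp add: T_def)
  then have "\<gamma> = compose (carrier X) \<omega> \<alpha>"
    using homs_ext[OF cont_homsD(1)[OF \<gamma>]] by (intro extensionalityI[of _ "carrier X"]) auto
  then show ?thesis using that \<alpha> by simp
qed

section \<open>The natural isomorphisms between reducts of duals and duals of reducts\<close>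

lemma \<Phi>_top_iso:
  fixes A :: "('u, 'f1, 'r1) struct"
  assumes A: "A \<in> ISP S1 M"
  shows "top_iso R2 (tflat (D A)) (H (flat A)) (\<Phi> A)"
proof (rule top_isoI)
  note As = ISP_structure[OF A]
  note fA = structure_reduct[OF As(1) J1]
  show "is_top_structure R2 (tflat (D A))"
    using base.Dual_top(1)[OF As(1)] J2 by (rule top_structure_reduct)
  show "compact_space (topo (tflat (D A)))" using base.Dual_top(2)[OF As(1)] by simp
  show "is_top_structure R2 (H (flat A))" "Hausdorff_space (topo (H (flat A)))"
    using target.Dual_top[OF fA] by auto
  show "\<Phi> A \<in> cont_homs R2 (tflat (D A)) (H (flat A))" using As(1) by (rule \<Phi>_cont_hom)
  show "separates_structure R2 {\<Phi> A} (tflat (D A)) (H (flat A))" using As(1) by (rule \<Phi>_embedding)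
  show "carrier (H (flat A)) \<subseteq> \<Phi> A ` carrier (tflat (D A))"
  proof
    fix y assume "y \<in> carrier (H (flat A))"
    then obtain x where "x \<in> homs S1 A M" "y = compose (carrier A) \<omega> x" using \<Phi>_surj[OF A] by auto
    then show "y \<in> \<Phi> A ` carrier (tflat (D A))" by (auto simp: \<Phi>_def)
  qed
qed

lemma \<Psi>_str_iso:
  fixes X :: "('u, 'f2, 'r2) top_struct"
  assumes X: "X \<in> IScP S2 MT"
  shows "str_iso R1 (flat (E X)) (K (tflat X)) (\<Psi> X)"
proof (rule str_isoI)
  note Xs = IScP_structure[OF X]
  show "is_structure R1 (flat (E X))"
    using base.Codual_structure[OF Xs] J1 by (rule structure_reduct)
  show "is_structure R1 (K (tflat X))"
    using top_structure_reduct[OF Xs J2] by (rule target.Codual_structure)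
  show "\<Psi> X \<in> homs R1 (flat (E X)) (K (tflat X))" using Xs by (rule \<Psi>_hom)
  show "separates_structure R1 {\<Psi> X} (flat (E X)) (K (tflat X))" using Xs by (rule \<Psi>_embedding)
  show "carrier (K (tflat X)) \<subseteq> \<Psi> X ` carrier (flat (E X))"
  proof
    fix \<gamma> assume "\<gamma> \<in> carrier (K (tflat X))"
    then obtain \<alpha> where "\<alpha> \<in> cont_homs S2 X MT" "\<gamma> = compose (carrier X) \<omega> \<alpha>" using \<Psi>_surj[OF X] by auto
    then show "\<gamma> \<in> \<Psi> X ` carrier (flat (E X))" by (auto simp: \<Psi>_def)
  qed
qed

text \<open>The device for cancelling \<omega>: it need not be injective, but equality under
  \<omega> after every unary term function forces equality.\<close>

lemma eq_by_terms_M: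
  assumes "a \<in> carrier M" "b \<in> carrier M"
    and "\<And>t. wf_trm S2 1 t \<Longrightarrow>
      \<omega> (eval_trm MT (\<lambda>k\<in>{..<1}. a) t) = \<omega> (eval_trm MT (\<lambda>k\<in>{..<1}. b) t)"
  shows "a = b"
proof (rule separates_structureD(1)[OF separates_M])
  fix z assume "z \<in> (\<circ>) \<omega> ` Clo1 S2 MT"
  then obtain t where "wf_trm S2 1 t" "z = \<omega> \<circ> (\<lambda>a\<in>carrier MT. eval_trm MT (\<lambda>k\<in>{..<1}. a) t)"
    by (auto simp: Clo1_def)
  then show "z a = z b" using assms by (simp add: base.carrier_MT)
qed (use assms in auto)

lemma eq_by_terms_MT:
  assumes "a \<in> carrier M" "b \<in> carrier M"
    and "\<And>t. wf_trm S1 1 t \<Longrightarrow>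
      \<omega> (eval_trm M (\<lambda>k\<in>{..<1}. a) t) = \<omega> (eval_trm M (\<lambda>k\<in>{..<1}. b) t)"
  shows "a = b"
proof (rule separates_structureD(1)[OF separates_MT])
  fix z assume "z \<in> (\<circ>) \<omega> ` Clo1 S1 M"
  then obtain t where "wf_trm S1 1 t" "z = \<omega> \<circ> (\<lambda>a\<in>carrier M. eval_trm M (\<lambda>k\<in>{..<1}. a) t)"
    by (auto simp: Clo1_def)
  then show "z a = z b" using assms by simp
qed (use assms base.carrier_MT in auto)

section \<open>Duality, co-duality and injectivity for \<open>M\<close>\<close>

lemma dualises: "dualises TYPE('u) S1 M S2 MT"
  unfolding dualises_def
proof
  fix A :: "('u, 'f1, 'r1) struct" assume A: "A \<in> ISP S1 M"
  note As = ISP_structure[OF A]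
  have DA: "is_top_structure S2 (D A)" using base.Dual_top(1)[OF As(1)] .
  have ev: "eval_alg S1 M A a \<in> cont_homs S2 (D A) MT" if "a \<in> carrier A" for a
    using base.evaluation_cont_hom[OF As(1) that] that by (simp add: eval_alg_def)
  show "str_iso S1 A (E (D A)) (eval_alg S1 M A)"
  proof (rule str_isoI)
    show "is_structure S1 A" using As by simp
    show "is_structure S1 (E (D A))" using DA by (rule base.Codual_structure)
    show "eval_alg S1 M A \<in> homs S1 A (E (D A))"
    proof (rule base.hom_into_Codual[OF As(1)])
      show "eval_alg S1 M A \<in> carrier A \<rightarrow>\<^sub>E cont_homs S2 (D A) MT" using ev by (auto simp: eval_alg_def)
      fix x assume "x \<in> carrier (D A)"
      then have x: "x \<in> homs S1 A M" by simp
      have "(\<lambda>a\<in>carrier A. eval_alg S1 M A a x) = x"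
        by (rule extensionalityI[of _ "carrier A"]) (use x in \<open>auto simp: eval_alg_def homs_ext\<close>)
      then show "(\<lambda>a\<in>carrier A. eval_alg S1 M A a x) \<in> homs S1 A M" using x by simp
    qed
    show "separates_structure S1 {eval_alg S1 M A} A (E (D A))"
    proof (rule base.embedding_into_Codual)
      show "separates_structure S1 (homs S1 A M) A M"
        using A unfolding ISP_iff[OF base.M_structure] by simp
    qed (use ev in \<open>auto simp: eval_alg_def\<close>)
    show "carrier (E (D A)) \<subseteq> eval_alg S1 M A ` carrier A"
    proof
      fix \<alpha> assume "\<alpha> \<in> carrier (E (D A))"
      then have \<alpha>: "\<alpha> \<in> cont_homs S2 (D A) MT" by simp
      obtain a where a: "a \<in> carrier A"
        and eq: "\<And>x. x \<in> homs S1 A M \<Longrightarrow> compose (carrier (D A)) \<omega> \<alpha> x = \<omega> (x a)"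
        using cont_hom_on_tflat_Dual[OF A compose_\<omega>_cont_hom[OF DA \<alpha>]] by metis
      \<comment> \<open>The point \<open>a\<close> does not depend on \<open>x\<close>, so
        \<open>eq\<close> can also be used at the transform of \<open>x\<close> by any unary term of
        \<open>MT\<close>. As \<alpha> and evaluation at \<open>a\<close> commute with the term, the
        two sides agree under \<omega> after every such term.\<close>
      have "\<alpha> x = x a" if x: "x \<in> homs S1 A M" for x
      proof (rule eq_by_terms_M)
        show "\<alpha> x \<in> carrier M" using homs_carrier[OF cont_homsD(1)[OF \<alpha>]] x by (simp add: base.carrier_MT)
        show "x a \<in> carrier M" using homs_carrier[OF x a] .
        fix t assume t: "wf_trm S2 1 t"
        note x' = term_on_Dual[OF As(1) t x]
        show "\<omega> (eval_trm MT (\<lambda>k\<in>{..<1}. \<alpha> x) t) = \<omega> (eval_trm MT (\<lambda>k\<in>{..<1}. x a) t)"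
          unfolding x'(2)[OF a, symmetric] x'(3)[OF \<alpha>, symmetric]
          using eq[OF x'(1)] x'(1) by (simp add: compose_eq)
      qed
      then have "\<alpha> = eval_alg S1 M A a"
        using a by (intro homs_eqI[OF cont_homsD(1)[OF \<alpha>] cont_homsD(1)[OF ev[OF a]]]) (simp add: eval_alg_def)
      then show "\<alpha> \<in> eval_alg S1 M A ` carrier A" using a by blast
    qed
  qed
qed

lemma codualises: "codualises TYPE('u) S1 M S2 MT"
  unfolding codualises_def
proof
  fix X :: "('u, 'f2, 'r2) top_struct" assume X: "X \<in> IScP S2 MT"
  note Xs = IScP_structure[OF X]
  have EX: "is_structure S1 (E X)" using base.Codual_structure[OF Xs] .
  have ev: "eval_top S2 MT X x \<in> homs S1 (E X) M" if "x \<in> carrier X" for x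
    using base.evaluation_hom[OF Xs that] that by (simp add: eval_top_def)
  show "top_iso S2 X (D (E X)) (eval_top S2 MT X)"
  proof (rule top_isoI[OF Xs])
    show "compact_space (topo X)" using X unfolding IScP_iff[OF base.total_MT] by simp
    show "is_top_structure S2 (D (E X))" "Hausdorff_space (topo (D (E X)))"
      using base.Dual_top[OF EX] by auto
    show "eval_top S2 MT X \<in> cont_homs S2 X (D (E X))"
    proof (rule base.cont_hom_into_Dual[OF Xs])
      show "eval_top S2 MT X \<in> carrier X \<rightarrow>\<^sub>E homs S1 (E X) M" using ev by (auto simp: eval_top_def)
      fix \<alpha> assume "\<alpha> \<in> carrier (E X)"
      then have \<alpha>: "\<alpha> \<in> cont_homs S2 X MT" by simp
      have "(\<lambda>x\<in>carrier X. eval_top S2 MT X x \<alpha>) = \<alpha>"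
        by (rule extensionalityI[of _ "carrier X"])
           (use \<alpha> homs_ext[OF cont_homsD(1)[OF \<alpha>]] in \<open>auto simp: eval_top_def\<close>)
      then show "(\<lambda>x\<in>carrier X. eval_top S2 MT X x \<alpha>) \<in> cont_homs S2 X MT" using \<alpha> by simp
    qed
    show "separates_structure S2 {eval_top S2 MT X} X (D (E X))"
    proof (rule base.embedding_into_Dual)
      show "separates_structure S2 (cont_homs S2 X MT) X MT"
        using X unfolding IScP_iff[OF base.total_MT] by simp
    qed (use ev in \<open>auto simp: eval_top_def\<close>)
    show "carrier (D (E X)) \<subseteq> eval_top S2 MT X ` carrier X"
    proof
      fix h assume "h \<in> carrier (D (E X))"
      then have h: "h \<in> homs S1 (E X) M" by simp
      obtain x where x: "x \<in> carrier X"
        and eq: "\<And>\<alpha>. \<alpha> \<in> cont_homs S2 X MT \<Longrightarrow> compose (carrier (E X)) \<omega> h \<alpha> = \<omega> (\<alpha> x)"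
        using hom_on_flat_Codual[OF X compose_\<omega>_hom[OF EX h]] by metis
      \<comment> \<open>Again one point \<open>x\<close> serves all morphisms, including the
        transforms of \<alpha> by unary terms of \<open>M\<close>.\<close>
      have "h \<alpha> = \<alpha> x" if \<alpha>: "\<alpha> \<in> cont_homs S2 X MT" for \<alpha>
      proof (rule eq_by_terms_MT)
        show "h \<alpha> \<in> carrier M" using homs_carrier[OF h] \<alpha> by simp
        show "\<alpha> x \<in> carrier M" using homs_carrier[OF cont_homsD(1)[OF \<alpha>] x] by (simp add: base.carrier_MT)
        fix t assume t: "wf_trm S1 1 t"
        note \<alpha>' = term_on_Codual[OF Xs t \<alpha>]
        show "\<omega> (eval_trm M (\<lambda>k\<in>{..<1}. h \<alpha>) t) = \<omega> (eval_trm M (\<lambda>k\<in>{..<1}. \<alpha> x) t)"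
          unfolding \<alpha>'(2)[OF x, symmetric] \<alpha>'(3)[OF h, symmetric]
          using eq[OF \<alpha>'(1)] \<alpha>'(1) by (simp add: compose_eq)
      qed
      then have "h = eval_top S2 MT X x"
        using x by (intro homs_eqI[OF h ev[OF x]]) (simp add: eval_top_def)
      then show "h \<in> eval_top S2 MT X ` carrier X" using x by blast
    qed
  qed
qed

text \<open>On the reducts, \<omega> after \<open>x\<close> extends along \<open>h\<close> by
  injectivity of \<open>N\<close>. By surjectivity of \<Phi> for \<open>B\<close> the extension is
  \<omega> after some homomorphism \<open>y\<close> into \<open>M\<close>; then \<open>y\<close>
  after \<open>h\<close> and \<open>x\<close> have the same image under \<Phi> for \<open>A\<close>,
  and injectivity of that map cancels \<omega>.\<close>

lemma injective_ISP: "injective_in_ISP TYPE('u) S1 M"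
  unfolding injective_in_ISP_def
proof (intro ballI allI impI)
  fix A B :: "('u, 'f1, 'r1) struct" and h x
  assume A: "A \<in> ISP S1 M" and B: "B \<in> ISP S1 M" and emb: "str_embedding S1 A B h"
    and x: "x \<in> homs S1 A M"
  note As = ISP_structure[OF A]
  have h: "h \<in> homs S1 A B" "separates_structure S1 {h} A B"
    using emb str_embedding_iff[OF As] by auto
  have "h \<in> homs R1 (flat A) (flat B)" using homs_reduct[OF As(1) J1 h(1)] .
  moreover have "separates_structure R1 {h} (flat A) (flat B)"
    using separates_reduct[OF As(1) J1 _ h(2)] h(1) by simp
  ultimately obtain z where z: "z \<in> homs R1 (flat B) N"
    and ext: "\<And>a. a \<in> carrier (flat A) \<Longrightarrow> z (h a) = compose (carrier A) \<omega> x a"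
    using injective_in_ISP_extend[OF inj_N target.M_structure inj_singleton_map inj_singleton_map
        flat_in_ISP[OF A] flat_in_ISP[OF B] _ _ compose_\<omega>_hom[OF As(1) x]] by metis
  obtain y where y: "y \<in> homs S1 B M" "z = compose (carrier B) \<omega> y" using \<Phi>_surj[OF B z] by metis
  have yh: "compose (carrier A) y h \<in> homs S1 A M" using homs_compose[OF As(1) h(1) y(1)] .
  have "\<Phi> A (compose (carrier A) y h) a = \<Phi> A x a" if "a \<in> carrier A" for a
    using ext[of a] that homs_carrier[OF h(1) that] yh x by (simp add: \<Phi>_def y(2) compose_eq)
  then have "\<Phi> A (compose (carrier A) y h) = \<Phi> A x"
    using yh x by (intro extensionalityI[of _ "carrier A"]) (auto simp: \<Phi>_def)
  then have "compose (carrier A) y h = x"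
    using yh x by (intro separates_structureD(1)[OF \<Phi>_embedding[OF As(1)]]) auto
  then have "\<forall>a\<in>carrier A. y (h a) = x a" by (metis compose_eq)
  then show "\<exists>y\<in>homs S1 B M. \<forall>a\<in>carrier A. y (h a) = x a" using y(1) by blast
qed

text \<open>The same pull-back with \<Psi>: surjectivity over \<open>Y\<close> lifts the extension
  through \<omega>, injectivity over \<open>X\<close> cancels \<omega>.\<close>

lemma injective_IScP: "injective_in_IScP TYPE('u) S2 MT"
  unfolding injective_in_IScP_def
proof (intro ballI allI impI)
  fix X Y :: "('u, 'f2, 'r2) top_struct" and h \<alpha>
  assume X: "X \<in> IScP S2 MT" and Y: "Y \<in> IScP S2 MT" and emb: "top_embedding S2 X Y h"
    and \<alpha>: "\<alpha> \<in> cont_homs S2 X MT"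
  note Xs = IScP_structure[OF X] and Ys = IScP_structure[OF Y]
  have comp: "compact_space (topo X)" using X unfolding IScP_iff[OF base.total_MT] by simp
  have h: "h \<in> cont_homs S2 X Y" "separates_structure S2 {h} X Y"
    using emb top_embedding_iff[OF Xs comp Ys IScP_Hausdorff[OF base.total_MT Y]] by auto
  note Xs' = top_structureD(1)[OF Xs]
  have "h \<in> cont_homs R2 (tflat X) (tflat Y)" using cont_homs_reduct[OF Xs' J2 h(1)] .
  moreover have "separates_structure R2 {h} (tflat X) (tflat Y)"
    using separates_reduct[OF Xs' J2 _ h(2)] cont_homsD(1)[OF h(1)] by (simp add: top_reduct_def)
  ultimately obtain \<gamma> where \<gamma>: "\<gamma> \<in> cont_homs R2 (tflat Y) NT"
    and ext: "\<And>x. x \<in> carrier (tflat X) \<Longrightarrow> \<gamma> (h x) = compose (carrier X) \<omega> \<alpha> x"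
    using injective_in_IScP_extend[OF inj_NT target.total_MT inj_singleton_map inj_singleton_map
        tflat_in_IScP[OF X] tflat_in_IScP[OF Y] _ _ compose_\<omega>_cont_hom[OF Xs \<alpha>]] by metis
  obtain \<beta> where \<beta>: "\<beta> \<in> cont_homs S2 Y MT" "\<gamma> = compose (carrier Y) \<omega> \<beta>" using \<Psi>_surj[OF Y \<gamma>] by metis
  have \<beta>h: "compose (carrier X) \<beta> h \<in> cont_homs S2 X MT" using cont_homs_compose[OF Xs h(1) \<beta>(1)] .
  have "\<Psi> X (compose (carrier X) \<beta> h) x = \<Psi> X \<alpha> x" if "x \<in> carrier X" for x
    using ext[of x] that homs_carrier[OF cont_homsD(1)[OF h(1)] that] \<beta>h \<alpha>
    by (simp add: \<Psi>_def \<beta>(2) compose_eq)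
  then have "\<Psi> X (compose (carrier X) \<beta> h) = \<Psi> X \<alpha>"
    using \<beta>h \<alpha> by (intro extensionalityI[of _ "carrier X"]) (auto simp: \<Psi>_def)
  then have "compose (carrier X) \<beta> h = \<alpha>"
    using \<beta>h \<alpha> by (intro separates_structureD(1)[OF \<Psi>_embedding[OF Xs]]) auto
  then have "\<forall>x\<in>carrier X. \<beta> (h x) = \<alpha> x" by (metis compose_eq)
  then show "\<exists>\<beta>\<in>cont_homs S2 Y MT. \<forall>x\<in>carrier X. \<beta> (h x) = \<alpha> x" using \<beta>(1) by blast
qed

end

theorem theorem3p7:
  fixes M  :: "('m, 'f1, 'r1) struct"     and S1 :: "('f1, 'r1) signature"
    and MT :: "('m, 'f2, 'r2) top_struct" and S2 :: "('f2, 'r2) signature"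
    and N  :: "('n, 'g1, 's1) struct"     and R1 :: "('g1, 's1) signature"
    and NT :: "('n, 'g2, 's2) top_struct" and R2 :: "('g2, 's2) signature"
    and J1 :: "('f1, 'r1, 'g1, 's1) interp"
    and J2 :: "('f2, 'r2, 'g2, 's2) interp"
    and \<omega> :: "'m \<Rightarrow> 'n"
  assumes M: "total_structure S1 M" "nontrivial M"
    and N: "total_structure R1 N" "nontrivial N"
    and MT: "total_top_structure S2 MT" "alter_ego S1 M S2 MT"
    and NT: "total_top_structure R2 NT" "alter_ego R1 N R2 NT"
    and full_N: "fully_dualises TYPE('u \<Rightarrow> 'm + 'n) R1 N R2 NT"
    and inj_NT: "injective_in_IScP TYPE('u \<Rightarrow> 'm + 'n) R2 NT"
    and inj_N: "injective_in_ISP TYPE('u \<Rightarrow> 'm + 'n) R1 N"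
    and reduct_M: "wf_interp S1 R1 J1" "reduct R1 J1 M \<in> ISP R1 N"
    and reduct_MT: "wf_interp S2 R2 J2" "top_reduct R2 J2 MT \<in> IScP R2 NT"
    and \<omega>: "\<omega> \<in> homs R1 (reduct R1 J1 M) N \<inter> cont_homs R2 (top_reduct R2 J2 MT) NT"
    and conditions:
      "(algebra_type R1 \<and>
        separates_points ((\<circ>) \<omega> ` Clo1 S2 MT) (carrier M) \<and>
        separates_structure R2 ((\<circ>) \<omega> ` Clo1 S1 M) (top_reduct R2 J2 MT) NT \<and>
        (\<forall>r\<in>relsyms R2. \<forall>s\<in>max_rels S1 M \<omega> (rarity R2 r) (rel_of NT r).
           ego_entails TYPE('u \<Rightarrow> 'm + 'n) S1 M S2 MT (rarity R2 r) s))
       \<or>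
       (algebra_type R2 \<and>
        separates_structure R1 ((\<circ>) \<omega> ` Clo1 S2 MT) (reduct R1 J1 M) N \<and>
        separates_points ((\<circ>) \<omega> ` Clo1 S1 M) (carrier M) \<and>
        (relsyms R1 \<noteq> {} \<longrightarrow>
           (\<forall>f\<in>opsyms S2. op_continuous MT (topo MT) S2 f) \<and>
           (\<forall>r\<in>relsyms R1. \<forall>s\<in>max_rels S2 MT \<omega> (rarity R1 r) (rel_of N r).
              base_entails TYPE('u \<Rightarrow> 'm + 'n) S1 M S2 MT (rarity R1 r) s)))
       \<or>
       (algebra_type R1 \<and> algebra_type R2 \<and>
        separates_points ((\<circ>) \<omega> ` Clo1 S2 MT) (carrier M) \<and>
        separates_points ((\<circ>) \<omega> ` Clo1 S1 M) (carrier M))"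
  shows "fully_dualises TYPE('u) S1 M S2 MT \<and>
         (injective_in_ISP TYPE('u) S1 M \<and> injective_in_IScP TYPE('u) S2 MT \<and>
          strongly_dualises TYPE('u) S1 M S2 MT) \<and>
         (\<forall>A \<in> (ISP S1 M :: ('u, 'f1, 'r1) struct set).
            top_iso R2 (top_reduct R2 J2 (Dual S1 M S2 MT A)) (Dual R1 N R2 NT (reduct R1 J1 A))
              (\<lambda>x\<in>homs S1 A M. compose (carrier A) \<omega> x)) \<and>
         (\<forall>X \<in> (IScP S2 MT :: ('u, 'f2, 'r2) top_struct set).
            str_iso R1 (reduct R1 J1 (Codual S1 M S2 MT X)) (Codual R1 N R2 NT (top_reduct R2 J2 X))
              (\<lambda>\<alpha>\<in>cont_homs S2 X MT. compose (carrier X) \<omega> \<alpha>))"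
proof -
  have "carrier MT = carrier M" using MT by (simp add: alter_ego_def)
  \<comment> \<open>Over a signature without relation symbols, separating points is the same as
    separating the structure. Hence each of the three alternatives yields this common pair of
    statements.\<close>
  then have separates:
    "separates_structure R1 ((\<circ>) \<omega> ` Clo1 S2 MT) (reduct R1 J1 M) N"
    "separates_structure R2 ((\<circ>) \<omega> ` Clo1 S1 M) (top_reduct R2 J2 MT) NT"
    using conditions by (auto simp: separates_structure_def algebra_type_def)
  interpret piggyback S1 M S2 MT R1 N R2 NT "TYPE('u \<Rightarrow> 'm + 'n)" J1 J2 \<omega>
    by unfold_locales (use assms separates in \<open>auto simp: fully_dualises_def\<close>)
  show ?thesis
    using dualises codualises injective_ISP injective_IScP \<Phi>_top_iso \<Psi>_str_iso
    by (simp add: fully_dualises_def strongly_dualises_def \<Phi>_def \<Psi>_def)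
qed

end
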